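(* (i) Let $n$ be a positive integer, $d\ge0$ an integer, and let $f\in L^2(S_n)$ be $(r,\gamma_1,\gamma_2,d)$-biglobal with $r>1$, $\gamma_2>\gamma_1>0$ and $d\le\min\left(\tfrac14\log(\gamma_2/\gamma_1),\,10^{-5}n\right)$. Then $$\|f^{=d}\|_2^2\le\gamma_1^2\left(10^6r^2d^{-1}\log(\gamma_2/\gamma_1)\right)^d,$$ where for $d=0$ the right-hand side is read as $\gamma_1^2$. (ii) Furthermore, there is an absolute constant $C>0$ such that if $f\in L^2(S_n)$ is non-zero and $r$-biglobal with $\log(\|f\|_2/\|f\|_1)<10^{-6}n$, then for every integer $d\ge 0$, $$\|f^{=d}\|_2^2\le\|f\|_1^2\left(Cr^2\log(e\|f\|_2/\|f\|_1)\right)^d .$$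
   Context: $L^2(S_n)$ is the space of real functions on $S_n$ with the uniform probability measure, $\langle f,g\rangle=\mathbb{E}_{\sigma\in S_n}[f(\sigma)g(\sigma)]$, and $\|f\|_p=(\mathbb{E}|f|^p)^{1/p}$. $\log$ is natural. Biglobalness: let $[n]_t$ be the set of $t$-tuples of distinct elements of $[n]$. For $I,J\in[n]_t$ let $U_{I\to J}=\{\sigma\in S_n:\sigma(I_s)=J_s\text{ for all }s\}$ and let $f_{I\to J}$ be the restriction of $f$ to $U_{I\to J}$ (a $t$-restriction), with norms taken with respect to the uniform probability measure on $U_{I\to J}$. $f$ is $(r,\gamma_1,\gamma_2,d)$-biglobal if $\|f_{I\to J}\|_1\le r^t\gamma_1$ and $\|f_{I\to J}\|_2\le r^t\gamma_2$ for all $t\le d$ and all $I,J\in[n]_t$. $f$ is $r$-biglobal if it is $(r,\|f\|_1,\|f\|_2,n)$-biglobal. Degree decomposition: let $x_{i\to j}(\sigma)=1$ if $\sigma(i)=j$ and $0$ otherwise. $V_{\le d}\le L^2(S_n)$ is the space of functions expressible as polynomials of degree at most $d$ in the $n^2$ functions $x_{i\to j}$ (with $V_{\le -1}=0$). $f^{\le d}$ is the orthogonal projection of $f$ on $V_{\le d}$, and $f^{=d}=f^{\le d}-f^{\le d-1}$. *)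

theory Defs
  imports "HOL-Probability.Probability" "HOL-Combinatorics.Permutations"
begin

definition Sym :: "nat \<Rightarrow> (nat \<Rightarrow> nat) set" where
  "Sym n = {\<sigma>. \<sigma> permutes {1..n}}"

definition E_unif :: "'a set \<Rightarrow> ('a \<Rightarrow> real) \<Rightarrow> real" where
  "E_unif U f = measure_pmf.expectation (pmf_of_set U) f"

text \<open>Elements of $L^2(S_n)$ are represented by functions on all of \<^typ>\<open>nat \<Rightarrow> nat\<close>; their
  values outside \<open>Sym n\<close> never matter. The norm \<open>Lp_norm U p f\<close> only looks at \<open>f\<close> on
  \<open>U\<close>, so for \<open>U \<subseteq> Sym n\<close> it is the norm of the restriction of \<open>f\<close> to \<open>U\<close>.\<close>

definition Lp_norm :: "'a set \<Rightarrow> real \<Rightarrow> ('a \<Rightarrow> real) \<Rightarrow> real" where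
  "Lp_norm U p f = (E_unif U (\<lambda>\<sigma>. \<bar>f \<sigma>\<bar> powr p)) powr (1 / p)"

definition ip :: "nat \<Rightarrow> ((nat \<Rightarrow> nat) \<Rightarrow> real) \<Rightarrow> ((nat \<Rightarrow> nat) \<Rightarrow> real) \<Rightarrow> real" where
  "ip n f g = E_unif (Sym n) (\<lambda>\<sigma>. f \<sigma> * g \<sigma>)"

definition tuples :: "nat \<Rightarrow> nat \<Rightarrow> nat list set" where
  "tuples n t = {I. length I = t \<and> distinct I \<and> set I \<subseteq> {1..n}}"

definition umvirate :: "nat \<Rightarrow> nat list \<Rightarrow> nat list \<Rightarrow> (nat \<Rightarrow> nat) set" where
  "umvirate n I J = {\<sigma> \<in> Sym n. \<forall>s < length I. \<sigma> (I ! s) = J ! s}"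

definition biglobal ::
  "nat \<Rightarrow> real \<Rightarrow> real \<Rightarrow> real \<Rightarrow> nat \<Rightarrow> ((nat \<Rightarrow> nat) \<Rightarrow> real) \<Rightarrow> bool" where
  "biglobal n r \<gamma>1 \<gamma>2 d f \<longleftrightarrow>
     (\<forall>t\<le>d. \<forall>I \<in> tuples n t. \<forall>J \<in> tuples n t.
        Lp_norm (umvirate n I J) 1 f \<le> r ^ t * \<gamma>1 \<and>
        Lp_norm (umvirate n I J) 2 f \<le> r ^ t * \<gamma>2)"

definition r_biglobal :: "nat \<Rightarrow> real \<Rightarrow> ((nat \<Rightarrow> nat) \<Rightarrow> real) \<Rightarrow> bool" where
  "r_biglobal n r f \<longleftrightarrow> biglobal n r (Lp_norm (Sym n) 1 f) (Lp_norm (Sym n) 2 f) n f"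

definition x_var :: "nat \<Rightarrow> nat \<Rightarrow> (nat \<Rightarrow> nat) \<Rightarrow> real" where
  "x_var i j \<sigma> = (if \<sigma> i = j then 1 else 0)"

text \<open>A monomial in the $n^2$ variables is the multiset of its variables (repetitions are powers);
  its degree is its size. The degree bound is an integer, so that for \<open>k = - 1\<close> there are no
  monomials and \<open>V_le n (- 1)\<close> contains only the zero function.\<close>

definition monomials :: "nat \<Rightarrow> int \<Rightarrow> (nat \<times> nat) multiset set" where
  "monomials n k = {m. set_mset m \<subseteq> {1..n} \<times> {1..n} \<and> int (size m) \<le> k}"

lemma finite_monomials: "finite (monomials n k)"
proof -
  let ?L = "{xs. set xs \<subseteq> {1..n} \<times> {1..n} \<and> length xs \<le> nat k}"
  have "monomials n k \<subseteq> mset ` ?L"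
  proof
    fix m assume m: "m \<in> monomials n k"
    obtain xs where "m = mset xs" using ex_mset by metis
    with m have "xs \<in> ?L" by (auto simp: monomials_def)
    with \<open>m = mset xs\<close> show "m \<in> mset ` ?L" by blast
  qed
  moreover have "finite ?L" by (rule finite_lists_length_le) simp
  ultimately show ?thesis by (meson finite_imageI finite_subset)
qed

text \<open>The functions are taken to be \<^const>\<open>undefined\<close> outside \<open>Sym n\<close> (\<^const>\<open>restrict\<close>), so that
  equality in \<open>V_le n k\<close> is equality on \<open>Sym n\<close> and the projection is unique.\<close>

definition V_le :: "nat \<Rightarrow> int \<Rightarrow> ((nat \<Rightarrow> nat) \<Rightarrow> real) set" where
  "V_le n k = {restrict (\<lambda>\<sigma>. \<Sum>m\<in>monomials n k. c m * (\<Prod>(i, j)\<in>#m. x_var i j \<sigma>)) (Sym n) | c. True}"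

definition proj_le :: "nat \<Rightarrow> int \<Rightarrow> ((nat \<Rightarrow> nat) \<Rightarrow> real) \<Rightarrow> (nat \<Rightarrow> nat) \<Rightarrow> real" where
  "proj_le n k f = (THE g. g \<in> V_le n k \<and> (\<forall>h \<in> V_le n k. ip n (\<lambda>\<sigma>. f \<sigma> - g \<sigma>) h = 0))"

definition deg_part :: "nat \<Rightarrow> nat \<Rightarrow> ((nat \<Rightarrow> nat) \<Rightarrow> real) \<Rightarrow> (nat \<Rightarrow> nat) \<Rightarrow> real" where
  "deg_part n d f = (\<lambda>\<sigma>. proj_le n (int d) f \<sigma> - proj_le n (int d - 1) f \<sigma>)"

end

theory Submission imports Defs begin

text \<open>
  The inequality is first proved on a product space, by induction on the degree, from a hypercontractive
  inequality that bounds \<open>E G^(2k)\<close>, for \<open>G\<close> homogeneous of degree \<open>d\<close>, by the 2-norms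
  of all its derivatives (the one-variable inequality tensorises, since it holds for vector-valued
  functions). The 2-norms of the derivatives are bounded by the level inequality in lower degree, applied
  to restrictions, and \<open>k\<close> is taken to be about \<open>ln (\<gamma>2 / \<gamma>1) / d\<close>.

  To pass to $S_n$, couple a uniform permutation \<open>\<sigma>\<close> with a uniform point \<open>x\<close> of
  $[n]^n$: each value of \<open>x\<close> is taken by \<open>\<sigma>\<close> at a random coordinate where \<open>x\<close> takes
  it, and the rest of \<open>\<sigma>\<close> is random. Conditionally on some coordinates of \<open>x\<close> having values
  \<open>V\<close>, the law of \<open>\<sigma>\<close> is invariant under the permutations of the values that fix \<open>V\<close>, so it
  is a mixture of uniform measures on umvirates of size \<open>card V\<close>. Hence \<open>F(x) = E[f(\<sigma>) | x]\<close> is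
  biglobal with the same constants.

  Conversely, the level-\<open>d\<close> part \<open>g\<close> of \<open>f\<close> is controlled by that of \<open>F\<close>. With
  $P_I$ the conditional expectation on $\sigma|_I$ and \<open>M\<close> the sum of the $P_I$ with \<open>card I = d\<close>,
  one has $M^2 \ge M$ on level \<open>d\<close> because, \<open>g\<close> being orthogonal to lower levels,
  $\langle Mg, Mg\rangle$ expands into a sum of squared norms of averages of \<open>g\<close> over subgroups.
  So $\|g\|^2$ is at most the sum of the $\|P_I g\|^2$. Extending $P_I g$ to the product space gives a function
  whose pairing with \<open>F\<close> is, after averaging over the permutations that preserve the fibres of
  \<open>x\<close>, a sum of squares; it is bounded below by the contribution of the sets \<open>I\<close> that consist of
  singleton fibres, which have probability at least \<open>exp (- 2 d)\<close>.
\<close>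

section \<open>Averages and components on product spaces\<close>

text \<open>The coordinates of a permutation are dependent, so there is no tensor structure to run
  hypercontractivity on; hence the detour through the product space. The choice of \<open>k\<close>
  balances two losses. Pairing \<open>F\<close> with its level-\<open>d\<close> part costs
  \<open>(\<gamma>2 / \<gamma>1)^2\<close> in the \<open>2k\<close>-th power of the level weight
  \<open>V\<close>; spread over \<open>d * k\<close> factors this is at most \<open>exp 2\<close>
  each once \<open>k\<close> is at least \<open>ln (\<gamma>2 / \<gamma>1) / d\<close>.
  Hypercontractivity costs a factor of order \<open>k\<close> per degree, whence the base of the
  final power. The derivative of order 0 is out of reach of the induction, so it is bounded by
  \<open>V\<close> itself and the resulting inequality is implicit in \<open>V\<close>.

  In the coupling, a pair \<open>(x, \<sigma>)\<close> is rewritten as \<open>(y, \<sigma>)\<close>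
  with \<open>y = inv \<sigma> \<circ> x\<close>. The coupling condition says exactly that
  \<open>y\<close> is idempotent, so \<open>\<sigma>\<close> becomes uniform and independent of
  \<open>y\<close>, and averages over groups become available. From M^2 \<ge> M one gets M \<ge> 1
  because M is invertible on level \<open>d\<close>. The constant \<open>10 ^ 6\<close> is
  \<open>10 ^ 4\<close> from the product space times 100, a bound for the \<open>exp 4\<close> per
  degree lost in the coupling.\<close>

lemma weighted_cauchy_schwarz:
  fixes c a b :: "'p \<Rightarrow> real"
  assumes "\<And>p. p \<in> Y \<Longrightarrow> 0 \<le> c p"
  shows "(\<Sum>p\<in>Y. c p * (a p * b p))\<^sup>2 \<le> (\<Sum>p\<in>Y. c p * (a p)\<^sup>2) * (\<Sum>p\<in>Y. c p * (b p)\<^sup>2)"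
proof -
  have "(\<Sum>p\<in>Y. (sqrt (c p) * a p) * (sqrt (c p) * b p))\<^sup>2
      \<le> (\<Sum>p\<in>Y. (sqrt (c p) * a p)\<^sup>2) * (\<Sum>p\<in>Y. (sqrt (c p) * b p)\<^sup>2)"
    by (rule Cauchy_Schwarz_ineq_sum)
  moreover have "(sqrt (c p) * a p) * (sqrt (c p) * b p) = c p * (a p * b p)" if "p \<in> Y" for p
    using assms[OF that] by (metis mult.assoc mult.left_commute real_sqrt_mult_self abs_of_nonneg)
  moreover have "(sqrt (c p) * a p)\<^sup>2 = c p * (a p)\<^sup>2" if "p \<in> Y" for a p
    using assms[OF that] by (simp add: power_mult_distrib)
  ultimately show ?thesis by (simp cong: sum.cong)
qed

locale finite_avg =
  fixes Om :: "'a set"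
  assumes finite_Om: "finite Om" and nonempty_Om: "Om \<noteq> {}"
begin

definition av :: "'i \<Rightarrow> (('i \<Rightarrow> 'a) \<Rightarrow> real) \<Rightarrow> ('i \<Rightarrow> 'a) \<Rightarrow> real" where
  "av i G x = (\<Sum>j\<in>Om. G (x(i := j))) / card Om"

text \<open>Points are total functions and only the coordinates in \<open>A\<close> are resampled;
  the others keep their values, which need not lie in \<open>Om\<close>. Conditional averages and
  restrictions thus become instances of one operator.\<close>

definition AV :: "'i set \<Rightarrow> (('i \<Rightarrow> 'a) \<Rightarrow> real) \<Rightarrow> ('i \<Rightarrow> 'a) \<Rightarrow> real" where
  "AV A G x = (\<Sum>y\<in>A \<rightarrow>\<^sub>E Om. G (override_on x y A)) / card Om ^ card A"

lemma card_Om_pos: "card Om > 0"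
  using finite_Om nonempty_Om by (simp add: card_gt_0_iff)

lemma AV_empty [simp]: "AV {} G = G"
  by (rule ext) (simp add: AV_def)

lemma AV_insert:
  assumes "finite A" "i \<notin> A"
  shows "AV (insert i A) G = av i (AV A G)"
proof
  fix x
  have "(\<Sum>y\<in>insert i A \<rightarrow>\<^sub>E Om. G (override_on x y (insert i A)))
      = (\<Sum>(j, y)\<in>Om \<times> (A \<rightarrow>\<^sub>E Om). G (override_on x (y(i := j)) (insert i A)))"
    unfolding PiE_insert_eq
    using inj_combinator[OF assms(2), of "\<lambda>_. Om"]
    by (subst sum.reindex) (simp_all add: case_prod_unfold)
  also have "\<dots> = (\<Sum>j\<in>Om. \<Sum>y\<in>A \<rightarrow>\<^sub>E Om. G (override_on x (y(i := j)) (insert i A)))"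
    by (simp add: sum.cartesian_product)
  also have "\<dots> = (\<Sum>j\<in>Om. \<Sum>y\<in>A \<rightarrow>\<^sub>E Om. G (override_on (x(i := j)) y A))"
  proof (intro sum.cong refl)
    fix j y
    have "override_on x (y(i := j)) (insert i A) = override_on (x(i := j)) y A"
      using assms(2) by (auto simp: override_on_def)
    then show "G (override_on x (y(i := j)) (insert i A)) = G (override_on (x(i := j)) y A)"
      by simp
  qed
  finally show "AV (insert i A) G x = av i (AV A G) x"
    using assms by (simp add: AV_def av_def sum_divide_distrib field_simps)
qed

lemma av_add: "av i (\<lambda>x. G x + H x) x = av i G x + av i H x"
  by (simp add: av_def sum.distrib add_divide_distrib)
lemma av_diff: "av i (\<lambda>x. G x - H x) x = av i G x - av i H x"
  by (simp add: av_def sum_subtractf diff_divide_distrib)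
lemma av_cmult: "av i (\<lambda>x. c * G x) x = c * av i G x"
  by (simp add: av_def sum_distrib_left)
lemma av_sum: "av i (\<lambda>x. \<Sum>t\<in>T. G t x) x = (\<Sum>t\<in>T. av i (G t) x)"
  unfolding av_def by (subst sum.swap) (simp add: sum_divide_distrib)
lemma av_const [simp]: "av i (\<lambda>x. c) x = c"
  using card_Om_pos by (simp add: av_def)
lemma av_mono: "(\<And>x. G x \<le> H x) \<Longrightarrow> av i G x \<le> av i H x"
  by (simp add: av_def sum_mono divide_right_mono)

lemma AV_add: "AV A (\<lambda>x. G x + H x) x = AV A G x + AV A H x"
  by (simp add: AV_def sum.distrib add_divide_distrib)
lemma AV_diff: "AV A (\<lambda>x. G x - H x) x = AV A G x - AV A H x"
  by (simp add: AV_def sum_subtractf diff_divide_distrib)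
lemma AV_cmult: "AV A (\<lambda>x. c * G x) x = c * AV A G x"
  by (simp add: AV_def sum_distrib_left)
lemma AV_sum: "AV A (\<lambda>x. \<Sum>t\<in>T. G t x) x = (\<Sum>t\<in>T. AV A (G t) x)"
  unfolding AV_def by (subst sum.swap) (simp add: sum_divide_distrib)
lemma AV_const [simp]: "finite A \<Longrightarrow> AV A (\<lambda>x. c) x = c"
  using card_Om_pos by (simp add: AV_def card_PiE)
lemma AV_mono: "(\<And>x. G x \<le> H x) \<Longrightarrow> AV A G x \<le> AV A H x"
  by (simp add: AV_def sum_mono divide_right_mono)
lemma AV_nonneg: "(\<And>x. 0 \<le> H x) \<Longrightarrow> 0 \<le> AV A H x"
  by (simp add: AV_def sum_nonneg)
lemma AV_abs: "\<bar>AV A G x\<bar> \<le> AV A (\<lambda>x. \<bar>G x\<bar>) x"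
  by (simp add: AV_def sum_abs divide_right_mono)

lemma av_av [simp]: "av i (av i G) = av i G"
  using card_Om_pos by (intro ext) (simp add: av_def)

lemma av_commute: "av i (av j G) = av j (av i G)"
proof (cases "i = j")
  case False
  show ?thesis
  proof
    fix x
    have "(\<Sum>k\<in>Om. \<Sum>l\<in>Om. G (x(i := k, j := l))) = (\<Sum>l\<in>Om. \<Sum>k\<in>Om. G (x(j := l, i := k)))"
      by (subst sum.swap) (simp only: fun_upd_twist[OF False])
    then show "av i (av j G) x = av j (av i G) x"
      by (simp add: av_def sum_divide_distrib[symmetric])
  qed
qed simp

lemma av_AV_commute: "finite A \<Longrightarrow> av i (AV A G) = AV A (av i G)"
  by (induction A arbitrary: G rule: finite_induct) (simp_all add: AV_insert av_commute[of i])

lemma AV_av_absorb: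
  assumes "finite A" "i \<in> A" shows "AV A (av i G) = AV A G"
proof -
  obtain B where "A = insert i B" "i \<notin> B" using assms(2) by (meson Set.set_insert)
  then show ?thesis using assms(1) by (simp add: AV_insert av_AV_commute[symmetric])
qed

lemma av_eq_indep: "av i H = H \<Longrightarrow> H (x(i := j)) = H x"
proof -
  assume *: "av i H = H"
  have "H (x(i := j)) = av i H (x(i := j))" using * by simp
  also have "\<dots> = av i H x" by (simp add: av_def)
  finally show ?thesis using * by simp
qed

lemma av_mult_indep:
  assumes "av i K = K" shows "av i (\<lambda>x. K x * H x) x = K x * av i H x"
  by (simp add: av_def av_eq_indep[OF assms] sum_distrib_left)

lemma av_indep_fun:
  assumes "av i K = K" shows "av i (\<lambda>x. \<phi> (K x)) = (\<lambda>x. \<phi> (K x))"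
  using card_Om_pos by (intro ext) (simp add: av_def av_eq_indep[OF assms])

text \<open>Averaging over \<open>i\<close> first is free inside \<open>A\<close>, and in that
  average \<open>K\<close> is a constant factor of a mean-zero function.\<close>

lemma AV_orth:
  assumes "finite A" "i \<in> A" "\<And>x. av i H x = 0" "av i K = K"
  shows "AV A (\<lambda>x. H x * K x) x = 0"
proof -
  have "AV A (\<lambda>x. H x * K x) = AV A (av i (\<lambda>x. K x * H x))"
    by (simp add: AV_av_absorb assms mult.commute)
  also have "av i (\<lambda>x. K x * H x) = (\<lambda>x. 0)"
    by (rule ext) (simp add: av_mult_indep assms)
  finally show ?thesis by (simp add: assms)
qed

lemma AV_indep_const:
  assumes "finite A" "\<And>i. i \<in> A \<Longrightarrow> av i K = K" shows "AV A K = K"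
  using assms by (induction A rule: finite_induct) (simp_all add: AV_insert)

lemma AV_Un:
  assumes "finite A" "finite B" "A \<inter> B = {}"
  shows "AV (A \<union> B) G = AV A (AV B G)"
  using assms by (induction A rule: finite_induct) (simp_all add: AV_insert)

lemma av_AV_in: "finite A \<Longrightarrow> i \<in> A \<Longrightarrow> av i (AV A G) = AV A G"
  by (simp add: av_AV_commute AV_av_absorb)

lemma AV_cauchy_schwarz:
  fixes u v :: "'t \<Rightarrow> ('i \<Rightarrow> 'a) \<Rightarrow> real"
  assumes w: "\<And>t. t \<in> T \<Longrightarrow> 0 \<le> w t"
  shows "(\<Sum>t\<in>T. w t * AV A (\<lambda>z. u t z * v t z) x)\<^sup>2
     \<le> (\<Sum>t\<in>T. w t * AV A (\<lambda>z. (u t z)\<^sup>2) x) * (\<Sum>t\<in>T. w t * AV A (\<lambda>z. (v t z)\<^sup>2) x)"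
proof -
  define Y where "Y = T \<times> (A \<rightarrow>\<^sub>E Om)"
  define c where "c = (\<lambda>p :: 't \<times> ('i \<Rightarrow> 'a). w (fst p) / real (card Om ^ card A))"
  define a where "a = (\<lambda>p. u (fst p) (override_on x (snd p) A))"
  define b where "b = (\<lambda>p. v (fst p) (override_on x (snd p) A))"
  have e: "(\<Sum>t\<in>T. w t * AV A (p t) x) = (\<Sum>q\<in>Y. c q * p (fst q) (override_on x (snd q) A))" for p
    by (simp add: AV_def Y_def c_def case_prod_unfold sum.cartesian_product' sum_distrib_left sum_divide_distrib)
  have "\<And>p. p \<in> Y \<Longrightarrow> 0 \<le> c p" by (auto simp: Y_def c_def w)
  from weighted_cauchy_schwarz[where Y = Y and c = c and a = a and b = b, OF this] show ?thesis
    unfolding e a_def b_def .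
qed

text \<open>Efron-Stein component in the coordinates \<open>P\<close> only: for
  \<open>U \<subseteq> P\<close>, the product of \<open>1 - av i\<close> over \<open>U\<close> and
  of \<open>av i\<close> over \<open>P - U\<close>, expanded by inclusion-exclusion. Coordinates
  outside \<open>P\<close> stay as parameters, so that components of restrictions can be
  taken.\<close>

definition escomp :: "'i set \<Rightarrow> 'i set \<Rightarrow> (('i \<Rightarrow> 'a) \<Rightarrow> real) \<Rightarrow> ('i \<Rightarrow> 'a) \<Rightarrow> real" where
  "escomp P U G x = (\<Sum>T\<in>Pow U. (- 1) ^ card (U - T) * AV (P - T) G x)"

lemma escomp_empty [simp]: "escomp {} {} G = G"
  by (rule ext) (simp add: escomp_def)

lemma escomp_insert_out:
  assumes "finite P" "i \<notin> P" "i \<notin> U"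
  shows "escomp (insert i P) U G = av i (escomp P U G)"
proof
  fix x
  have "AV (insert i P - T) G = av i (AV (P - T) G)" if "T \<in> Pow U" for T
  proof -
    have "insert i P - T = insert i (P - T)" using that assms by auto
    then show ?thesis using assms by (simp add: AV_insert)
  qed
  then show "escomp (insert i P) U G x = av i (escomp P U G) x"
    unfolding escomp_def[abs_def] by (simp add: av_sum av_cmult)
qed

lemma sum_Pow_insert:
  assumes "finite U" "i \<notin> U"
  shows "(\<Sum>T\<in>Pow (insert i U). h T) = (\<Sum>T\<in>Pow U. h T + (h (insert i T) :: real))"
proof -
  have "inj_on (insert i) (Pow U)" using assms by (auto simp: inj_on_def)
  moreover have "Pow U \<inter> insert i ` Pow U = {}" using assms by auto
  ultimately show ?thesis using assms
    by (simp add: Pow_insert sum.union_disjoint sum.reindex sum.distrib)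
qed

lemma escomp_insert_in:
  assumes "finite P" "i \<notin> P" "U \<subseteq> P"
  shows "escomp (insert i P) (insert i U) G = (\<lambda>x. escomp P U G x - av i (escomp P U G) x)"
proof
  fix x
  have fU: "finite U" "i \<notin> U" using assms finite_subset by auto
  have 1: "AV (insert i P - T) G = av i (AV (P - T) G)" if "T \<in> Pow U" for T
  proof -
    have "insert i P - T = insert i (P - T)" using that fU by auto
    then show ?thesis using assms by (simp add: AV_insert)
  qed
  have 2: "P - insert i T = P - T" "U - insert i T = U - T"
     "card (insert i U - T) = Suc (card (U - T))" if "T \<in> Pow U" for T
  proof -
    have "insert i U - T = insert i (U - T)" using that fU by auto
    then show "card (insert i U - T) = Suc (card (U - T))" using fU by simp
  qed (use that assms fU in auto)
  have "escomp (insert i P) (insert i U) G x = (\<Sum>T\<in>Pow U. (- 1) ^ card (U - T) * AV (P - T) G x - (- 1) ^ card (U - T) * av i (AV (P - T) G) x)"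
    unfolding escomp_def sum_Pow_insert[OF fU]
    by (intro sum.cong refl) (simp add: 1 2)
  also have "\<dots> = escomp P U G x - av i (escomp P U G) x"
    unfolding escomp_def[abs_def] by (simp add: av_sum av_cmult sum_subtractf)
  finally show "escomp (insert i P) (insert i U) G x = escomp P U G x - av i (escomp P U G) x" .
qed

lemma av_zero_fun: "av i (\<lambda>x. G x - av i G x) x = 0"
  by (simp add: av_diff) 

lemma av_escomp_in:
  assumes "finite P" "i \<in> U" "U \<subseteq> P" shows "av i (escomp P U G) x = 0"
proof -
  have "i \<notin> P - {i}" "U - {i} \<subseteq> P - {i}" "finite (P - {i})" using assms by auto
  from escomp_insert_in[OF this(3,1,2), of G] have "escomp P U G = (\<lambda>x. escomp (P - {i}) (U - {i}) G x - av i (escomp (P - {i}) (U - {i}) G) x)"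
    using assms by (simp add: insert_absorb subset_iff)
  then show ?thesis by (simp add: av_zero_fun)
qed

lemma av_escomp_out:
  assumes "finite P" "i \<in> P - U" shows "av i (escomp P U G) = escomp P U G"
proof -
  have "i \<notin> P - {i}" "i \<notin> U" "finite (P - {i})" using assms by auto
  from escomp_insert_out[OF this(3,1,2), of G] have "escomp P U G = av i (escomp (P - {i}) U G)"
    using assms by (simp add: insert_absorb)
  then show ?thesis by simp
qed

lemma sum_escomp:
  assumes "finite P" shows "(\<Sum>U\<in>Pow P. escomp P U G x) = G x"
  using assms
proof (induction P arbitrary: x rule: finite_induct)
  case (insert i P)
  have "(\<Sum>U\<in>Pow (insert i P). escomp (insert i P) U G x) = (\<Sum>U\<in>Pow P. escomp P U G x)"
    unfolding sum_Pow_insert[OF insert.hyps]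
  proof (intro sum.cong refl)
    fix U assume "U \<in> Pow P"
    then have "U \<subseteq> P" "i \<notin> U" using insert.hyps by auto
    then show "escomp (insert i P) U G x + escomp (insert i P) (insert i U) G x = escomp P U G x"
      using insert.hyps by (simp add: escomp_insert_out escomp_insert_in)
  qed
  then show ?case using insert by simp
qed simp

text \<open>With \<open>U = A\<close>, this exhibits a component containing \<open>A\<close> as an
  iterated difference, in the coordinates \<open>A\<close>, of a component of lower degree of the
  restricted function. The induction on the degree enters through this.\<close>

lemma escomp_split:
  assumes "finite A" "finite B" "A \<inter> B = {}" "U \<subseteq> A" "W \<subseteq> B"
  shows "escomp (A \<union> B) (U \<union> W) F = escomp A U (escomp B W F)"
  using assms
proof (induction A arbitrary: U rule: finite_induct)
  case (insert i A)
  show ?case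
  proof (cases "i \<in> U")
    case True
    then obtain U' where U': "U = insert i U'" "i \<notin> U'" by (meson Set.set_insert)
    then have "U' \<subseteq> A" using insert by auto
    then show ?thesis using insert U' by (auto simp: escomp_insert_in subset_iff)
  next
    case False
    then have "U \<subseteq> A" using insert by auto
    moreover have "i \<notin> W" using insert by auto
    ultimately show ?thesis using insert False by (simp add: escomp_insert_out)
  qed
qed simp

text \<open>A function that is mean-zero in the coordinates of \<open>V\<close> and constant in the
  rest of \<open>P\<close> is killed by the factor of any coordinate where \<open>U\<close> and
  \<open>V\<close> disagree. Components of a sum of components can then be read off.\<close>

lemma escomp_pure:
  assumes "finite P" "U \<subseteq> P"
    and "\<And>i. i \<in> P - V \<Longrightarrow> av i H = H" and "\<And>i x. i \<in> P \<inter> V \<Longrightarrow> av i H x = 0"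
  shows "escomp P U H x = (if U = P \<inter> V then H x else 0)"
  using assms
proof (induction P arbitrary: U x rule: finite_induct)
  case (insert i P)
  have IH: "escomp P U H = (\<lambda>x. if U = P \<inter> V then H x else 0)" if "U \<subseteq> P" for U
    using insert that by (intro ext) simp
  show ?case
  proof (cases "i \<in> U")
    case True
    then obtain U' where U': "U = insert i U'" "i \<notin> U'" by (meson Set.set_insert)
    then have s: "U' \<subseteq> P" using insert by auto
    have c: "escomp (insert i P) U H x = (if U' = P \<inter> V then H x else 0) - av i (\<lambda>x. if U' = P \<inter> V then H x else 0) x"
      using insert U' s IH[OF s] by (simp add: escomp_insert_in)
    show ?thesis
    proof (cases "i \<in> V")
      case True
      then have "U = insert i P \<inter> V \<longleftrightarrow> U' = P \<inter> V"
        using U' insert.hyps by (simp add: insert_ident)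
      then show ?thesis using c insert.prems(3)[of i] True
        by (cases "U' = P \<inter> V") simp_all
    next
      case False
      then have "U \<noteq> insert i P \<inter> V" using U' by auto
      then show ?thesis using c insert.prems(2)[of i] False
        by (cases "U' = P \<inter> V") simp_all
    qed
  next
    case False
    then have s: "U \<subseteq> P" using insert by auto
    have c: "escomp (insert i P) U H x = av i (\<lambda>x. if U = P \<inter> V then H x else 0) x"
      using insert False s IH[OF s] by (simp add: escomp_insert_out)
    show ?thesis
    proof (cases "i \<in> V")
      case True
      then have "U \<noteq> insert i P \<inter> V" using False by auto
      then show ?thesis using c insert.prems(3)[of i] True
        by (cases "U = P \<inter> V") simp_all
    next
      case F: False
      then have "U = insert i P \<inter> V \<longleftrightarrow> U = P \<inter> V" by auto
      then show ?thesis using c insert.prems(2)[of i] F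
        by (cases "U = P \<inter> V") simp_all
    qed
  qed
qed auto

end

section \<open>Hypercontractivity on product spaces\<close>

text \<open>As a function of \<open>\<beta>\<close> the left side is convex on the interval from
  \<open>- A * \<zeta>\<close> to \<open>A * \<zeta>\<close>, hence below its chord, whose slope is
  at least \<open>2 * k * A ^ (2 * k - 2)\<close>. The smaller slope does not involve
  \<open>\<zeta>\<close>, so the terms in \<open>\<beta>\<close> will cancel once the
  \<open>\<beta> j\<close> sum to 0. The induction below avoids the chord.\<close>

lemma power_le_tangent:
  fixes A \<zeta> \<beta> :: real
  assumes "A \<ge> 0" "\<zeta> \<ge> 0" "\<bar>\<beta>\<bar> \<le> A * \<zeta>"
  shows "(A\<^sup>2 + 2 * \<beta> + \<zeta>\<^sup>2) ^ k \<le> (A + \<zeta>) ^ (2 * k) - 2 * k * A ^ (2 * k - 2) * (A * \<zeta> - \<beta>)"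
proof (induction k)
  case (Suc k)
  define y where "y = A\<^sup>2 + 2 * \<beta> + \<zeta>\<^sup>2"
  define Y where "Y = (A + \<zeta>)\<^sup>2"
  define \<delta> where "\<delta> = A * \<zeta> - \<beta>"
  have d0: "\<delta> \<ge> 0" using assms by (simp add: \<delta>_def)
  have Yy: "Y = y + 2 * \<delta>" by (simp add: Y_def y_def \<delta>_def power2_eq_square algebra_simps)
  have y1: "y \<ge> (A - \<zeta>)\<^sup>2" using assms(3) by (simp add: y_def power2_eq_square algebra_simps abs_le_iff)
  then have y0: "y \<ge> 0" using zero_le_power2 order_trans by blast
  have IH: "y ^ k \<le> Y ^ k - 2 * k * A ^ (2 * k - 2) * \<delta>"
    using Suc by (simp add: y_def Y_def \<delta>_def power_mult)
  \<comment> \<open>Bernoulli bounds \<open>Y ^ k\<close> below by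
    \<open>A ^ (2 * k) + 2 * k * A ^ (2 * k - 1) * \<zeta>\<close>, and \<open>y\<close> is at least
    \<open>A\<^sup>2 - 2 * A * \<zeta>\<close>; the terms linear in \<open>\<zeta>\<close>
    cancel.\<close>
  have key: "(k + 1) * A ^ (2 * k) \<le> Y ^ k + k * y * A ^ (2 * k - 2)"
  proof (cases "k = 0")
    case False
    then obtain m where m: "k = Suc m" by (meson not0_implies_Suc)
    have p: "A ^ (2 * k - 2) = A ^ (2*m)" "A ^ (2 * k) = A\<^sup>2 * A ^ (2*m)"
      by (simp_all add: m power2_eq_square)
    have "Y ^ k \<ge> (A\<^sup>2 + 2 * A * \<zeta>) ^ k"
      unfolding Y_def using assms by (intro power_mono) (simp_all add: power2_eq_square algebra_simps)
    moreover have "(A\<^sup>2 + 2 * A * \<zeta>) ^ k \<ge> A\<^sup>2 * A ^ (2*m) + k * A ^ (2*m) * (2 * A * \<zeta>)"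
    proof -
      have "A\<^sup>2 ^ k + of_nat k * A\<^sup>2 ^ (k - 1) * (2 * A * \<zeta>) \<le> (A\<^sup>2 + 2 * A * \<zeta>) ^ k" 
      proof (cases "A = 0")
        case True then show ?thesis by simp
      next
        case False
        have "1 + of_nat k * (2 * A * \<zeta> / A\<^sup>2) \<le> (1 + 2 * A * \<zeta> / A\<^sup>2) ^ k"
          by (rule Bernoulli_inequality) (use assms in \<open>simp add: order_trans[of _ 0]\<close>)
        then have "A\<^sup>2 ^ k * (1 + of_nat k * (2 * A * \<zeta> / A\<^sup>2)) \<le> A\<^sup>2 ^ k * (1 + 2 * A * \<zeta> / A\<^sup>2) ^ k"
          by (intro mult_left_mono) auto
        also have "\<dots> = (A\<^sup>2 * (1 + 2 * A * \<zeta> / A\<^sup>2)) ^ k" by (simp only: power_mult_distrib)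
        also have "A\<^sup>2 * (1 + 2 * A * \<zeta> / A\<^sup>2) = A\<^sup>2 + 2 * A * \<zeta>" using False by (simp add: field_simps)
        also have "A\<^sup>2 ^ k * (1 + of_nat k * (2 * A * \<zeta> / A\<^sup>2)) = A\<^sup>2 ^ k + of_nat k * A\<^sup>2 ^ (k - 1) * (2 * A * \<zeta>)"
          using False by (simp add: m field_simps)
        finally show ?thesis .
      qed
      then show ?thesis by (simp add: m power_mult)
    qed
    moreover have "A\<^sup>2 - 2 * A * \<zeta> \<le> y"
      using y1 zero_le_power2[of \<zeta>] unfolding power2_diff by linarith
    then have "k * y * A ^ (2*m) \<ge> k * (A\<^sup>2 - 2 * A * \<zeta>) * A ^ (2*m)"
      using assms(1) by (intro mult_right_mono mult_left_mono) auto
    ultimately show ?thesis unfolding p by (simp add: algebra_simps)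
  qed simp
  have "y ^ Suc k \<le> y * (Y ^ k - 2 * k * A ^ (2 * k - 2) * \<delta>)"
    using mult_left_mono[OF IH y0] by simp
  also have "\<dots> = Y ^ Suc k - 2 * \<delta> * (Y ^ k + k * y * A ^ (2 * k - 2))"
    unfolding power_Suc by (subst (2) Yy) (simp add: algebra_simps)
  also have "\<dots> \<le> Y ^ Suc k - 2 * \<delta> * ((k + 1) * A ^ (2 * k))"
    using key d0 by (intro diff_left_mono mult_left_mono) auto
  finally have fin: "y ^ Suc k \<le> Y ^ Suc k - 2 * \<delta> * ((k + 1) * A ^ (2 * k))" .
  have e: "(A + \<zeta>) ^ (2 * Suc k) = Y ^ Suc k" "2 * Suc k - 2 = 2 * k"
    by (simp_all only: Y_def power_mult) simp
  show ?case
    unfolding y_def[symmetric] e \<delta>_def[symmetric] using fin by (simp add: algebra_simps)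
qed simp

text \<open>If \<open>\<zeta>\<close> is at most \<open>A / (2 * k)\<close>, bounding by the
  exponential to second order gives \<open>4 * k\<^sup>2\<close>; otherwise
  \<open>A + \<zeta> \<le> 3 * k * \<zeta>\<close>, the origin of \<open>(3 * k) ^ (2 * k)\<close>.
  The first-order term has to be exact, since it must cancel against the one in
  \<open>power_le_tangent\<close>.\<close>

lemma power_add_le_tangent:
  fixes A \<zeta> :: real
  assumes "A \<ge> 0" "\<zeta> \<ge> 0" "k \<ge> 1"
  shows "(A + \<zeta>) ^ (2 * k) \<le> A ^ (2 * k) + 2 * k * A ^ (2 * k - 1) * \<zeta>
     + 4 * k\<^sup>2 * A ^ (2 * k - 2) * \<zeta>\<^sup>2 + (3 * k) ^ (2 * k) * \<zeta> ^ (2 * k)"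
proof (cases "2 * k * \<zeta> \<le> A \<and> A > 0")
  case True
  define \<tau> where "\<tau> = \<zeta> / A"
  have \<tau>: "\<zeta> = A * \<tau>" "\<tau> \<ge> 0" "2 * k * \<tau> \<le> 1" using True assms by (auto simp: \<tau>_def field_simps)
  have "(1 + \<tau>) ^ (2 * k) \<le> exp \<tau> ^ (2 * k)"
    using \<tau> by (intro power_mono) (auto simp: exp_ge_add_one_self)
  also have "\<dots> = exp (2 * k * \<tau>)" by (simp add: exp_of_nat_mult[symmetric])
  also have "\<dots> \<le> 1 + 2 * k * \<tau> + (2 * k * \<tau>)\<^sup>2" using \<tau> by (intro exp_bound) auto
  finally have *: "(1 + \<tau>) ^ (2 * k) \<le> 1 + 2 * k * \<tau> + 4 * k\<^sup>2 * \<tau>\<^sup>2" by (simp add: power_mult_distrib)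
  obtain m where m: "k = Suc m" using assms(3) by (cases k) auto
  have "(A + \<zeta>) ^ (2 * k) = (A * (1 + \<tau>)) ^ (2 * k)" by (simp add: \<tau> algebra_simps)
  also have "\<dots> = A ^ (2*k) * (1 + \<tau>) ^ (2 * k)" by (simp add: power_mult_distrib)
  also have "\<dots> \<le> A ^ (2*k) * (1 + 2 * k * \<tau> + 4 * k\<^sup>2 * \<tau>\<^sup>2)"
    using * True by (intro mult_left_mono) auto
  also have "\<dots> = A ^ (2 * k) + 2 * k * A ^ (2 * k - 1) * \<zeta> + 4 * k\<^sup>2 * A ^ (2 * k - 2) * \<zeta>\<^sup>2"
    by (simp add: m \<tau> power2_eq_square algebra_simps)
  finally show ?thesis using assms by (simp add: add_increasing2)
next
  case False
  then have "A \<le> 2 * k * \<zeta>" using assms by (auto simp: not_less)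
  then have "A + \<zeta> \<le> 3 * k * \<zeta>"
    using assms mult_right_mono[of 1 "real k" \<zeta>] by (simp add: algebra_simps)
  then have "(A + \<zeta>) ^ (2 * k) \<le> (3 * k * \<zeta>) ^ (2 * k)" using assms by (intro power_mono) auto
  then show ?thesis using assms by (simp add: power_mult_distrib add_increasing)
qed

text \<open>The one-variable step of the hypercontractive inequality: for a vector \<open>a\<close> with squared norm
  \<open>q\<close> and mean-zero vectors \<open>h j\<close> with squared norms \<open>z j\<close>, \<open>\<beta> j\<close> is the inner product of the two.\<close>

lemma one_variable_step:
  fixes \<beta> z :: "'a \<Rightarrow> real"
  assumes "finite Om" "Om \<noteq> {}" "q \<ge> 0" "k \<ge> 1"
    and z: "\<And>j. j \<in> Om \<Longrightarrow> z j \<ge> 0"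
    and \<beta>: "\<And>j. j \<in> Om \<Longrightarrow> (\<beta> j)\<^sup>2 \<le> q * z j" and s: "(\<Sum>j\<in>Om. \<beta> j) = 0"
  shows "(\<Sum>j\<in>Om. (q + 2 * \<beta> j + z j) ^ k) / card Om
    \<le> (q + 4 * k * ((\<Sum>j\<in>Om. z j) / card Om)) ^ k + (3 * k) ^ (2 * k) * ((\<Sum>j\<in>Om. z j ^ k) / card Om)"
proof -
  define A where "A = sqrt q"
  have A: "A \<ge> 0" "A\<^sup>2 = q" using assms by (auto simp: A_def)
  have N: "real (card Om) > 0" using assms by (simp add: card_gt_0_iff)
  have ptw: "(q + 2 * \<beta> j + z j) ^ k \<le> q ^ k + 2 * k * A ^ (2 * k - 2) * \<beta> j
      + 4 * k\<^sup>2 * q ^ (k - 1) * z j + (3 * k) ^ (2 * k) * z j ^ k" if j: "j \<in> Om" for j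
  proof -
    define \<zeta> where "\<zeta> = sqrt (z j)"
    have \<zeta>: "\<zeta> \<ge> 0" "\<zeta>\<^sup>2 = z j" using z[OF j] by (auto simp: \<zeta>_def)
    have "\<bar>\<beta> j\<bar> \<le> A * \<zeta>"
      using real_sqrt_le_mono[OF \<beta>[OF j]] by (simp add: A_def \<zeta>_def real_sqrt_mult)
    \<comment> \<open>The two bounds contain \<open>2 * k * A ^ (2 * k - 1) * \<zeta>\<close> with
      opposite signs. A surviving term linear in the norm \<open>\<zeta>\<close> would not be
      controlled by the mean of the \<open>z j\<close>.\<close>
    from power_le_tangent[OF A(1) \<zeta>(1) this, of k] power_add_le_tangent[OF A(1) \<zeta>(1) assms(4)]
    have "(q + 2 * \<beta> j + z j) ^ k \<le> A ^ (2 * k) + 2 * k * A ^ (2 * k - 1) * \<zeta>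
     + 4 * k\<^sup>2 * A ^ (2 * k - 2) * \<zeta>\<^sup>2 + (3 * k) ^ (2 * k) * \<zeta> ^ (2 * k) - 2 * k * A ^ (2 * k - 2) * (A * \<zeta> - \<beta> j)"
      by (simp add: A \<zeta>)
    moreover have "A ^ (2 * k - 1) = A ^ (2 * k - 2) * A"
      using assms(4) by (cases k) simp_all
    moreover have "A ^ (2 * k) = q ^ k" "\<zeta> ^ (2 * k) = z j ^ k" by (simp_all add: power_mult A \<zeta>)
    moreover have "A ^ (2 * k - 2) = q ^ (k - 1)"
      using A(2) by (metis diff_mult_distrib2 mult.right_neutral power_mult)
    ultimately show ?thesis by (simp add: \<zeta> algebra_simps)
  qed
  have "(\<Sum>j\<in>Om. (q + 2 * \<beta> j + z j) ^ k) \<le> (\<Sum>j\<in>Om. q ^ k + 2 * k * A ^ (2 * k - 2) * \<beta> j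
      + 4 * k\<^sup>2 * q ^ (k - 1) * z j + (3 * k) ^ (2 * k) * z j ^ k)"
    by (intro sum_mono ptw)
  also have "\<dots> = card Om * (q ^ k + k * q ^ (k - 1) * (4 * k * ((\<Sum>j\<in>Om. z j) / card Om))
      + (3 * k) ^ (2 * k) * ((\<Sum>j\<in>Om. z j ^ k) / card Om))"
  proof -
    have lin: "(\<Sum>j\<in>Om. a + b * \<beta> j + c * z j + d * z j ^ k)
        = card Om * a + b * (\<Sum>j\<in>Om. \<beta> j) + c * (\<Sum>j\<in>Om. z j) + d * (\<Sum>j\<in>Om. z j ^ k)" for a b c d :: real
      by (simp add: sum.distrib sum_distrib_left)
    show ?thesis unfolding lin s using N by (simp add: distrib_left power2_eq_square)
  qed
  finally have 1: "(\<Sum>j\<in>Om. (q + 2 * \<beta> j + z j) ^ k) / card Om \<le> q ^ k + k * q ^ (k - 1) * (4 * k * ((\<Sum>j\<in>Om. z j) / card Om))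
      + (3 * k) ^ (2 * k) * ((\<Sum>j\<in>Om. z j ^ k) / card Om)"
    using N by (simp add: pos_divide_le_eq mult.commute)
  \<comment> \<open>Bernoulli moves the quadratic term inside the power; this uses up one of the two
    factors \<open>k\<close> and leaves \<open>4 * k\<close>.\<close>
  have "q ^ k + k * q ^ (k - 1) * w \<le> (q + w) ^ k" if "w \<ge> 0" for w
  proof (cases "q = 0")
    case True
    then show ?thesis using that assms(4) by (cases "k = 1") (auto simp: power_0_left)
  next
    case False
    then have q: "q > 0" using assms by simp
    have "q ^ k * (1 + k * (w / q)) \<le> q ^ k * (1 + w / q) ^ k"
      using q that by (intro mult_left_mono Bernoulli_inequality) (auto simp: order_trans[of _ 0])
    also have "\<dots> = (q * (1 + w / q)) ^ k" by (simp add: power_mult_distrib)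
    also have "q * (1 + w / q) = q + w" using q by (simp add: field_simps)
    also have "q ^ k * (1 + k * (w / q)) = q ^ k + k * q ^ (k - 1) * w"
      using q assms(4) by (cases k) (auto simp: field_simps)
    finally show ?thesis .
  qed
  moreover have "4 * k * ((\<Sum>j\<in>Om. z j) / card Om) \<ge> 0" using z by (simp add: sum_nonneg)
  ultimately show ?thesis using 1 by fastforce
qed

context finite_avg begin

text \<open>The one-variable step for the vector with entries \<open>v t\<close>, in the space of
  functions of \<open>t\<close> and of the coordinates in \<open>A\<close>, weighted by
  \<open>w\<close>. In the first summand the coordinate \<open>i\<close> joins the norm; in the
  second it stays outside the \<open>k\<close>-th power and the vector is replaced by its deviation
  from the mean.\<close>

lemma hypercontractive_step:
  fixes v :: "'t \<Rightarrow> ('i \<Rightarrow> 'a) \<Rightarrow> real"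
  assumes "i \<notin> A" "k \<ge> 1" and w: "\<And>t. t \<in> TT \<Longrightarrow> 0 \<le> w t"
  shows "av i (\<lambda>x. (\<Sum>t\<in>TT. w t * AV A (\<lambda>z. (v t z)\<^sup>2) x) ^ k) x
    \<le> ((\<Sum>t\<in>TT. w t * AV A (\<lambda>z. (av i (v t) z)\<^sup>2) x)
         + 4 * k * (\<Sum>t\<in>TT. w t * av i (AV A (\<lambda>z. (v t z - av i (v t) z)\<^sup>2)) x)) ^ k
      + (3 * k) ^ (2 * k) * av i (\<lambda>x. (\<Sum>t\<in>TT. w t * AV A (\<lambda>z. (v t z - av i (v t) z)\<^sup>2) x) ^ k) x"
    (is "?L \<le> ?R")
proof -
  define h where "h = (\<lambda>j t z. v t (z(i := j)) - av i (v t) z)"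
  have upd: "AV A G (x(i := j)) = AV A (\<lambda>z. G (z(i := j))) x" for G :: "('i \<Rightarrow> 'a) \<Rightarrow> real" and j
  proof -
    have "override_on (x(i := j)) y A = (override_on x y A)(i := j)" for y
      using assms(1) by (auto simp: override_on_def)
    then show ?thesis by (simp add: AV_def)
  qed
  have avi: "av i (v t) (z(i := j)) = av i (v t) z" for t z j by (simp add: av_def)
  define q where "q = (\<Sum>t\<in>TT. w t * AV A (\<lambda>z. (av i (v t) z)\<^sup>2) x)"
  define \<beta> where "\<beta> = (\<lambda>j. \<Sum>t\<in>TT. w t * AV A (\<lambda>z. av i (v t) z * h j t z) x)"
  define z where "z = (\<lambda>j. \<Sum>t\<in>TT. w t * AV A (\<lambda>z. (h j t z)\<^sup>2) x)"
  have z: "z j \<ge> 0" for j unfolding z_def using w by (intro sum_nonneg mult_nonneg_nonneg AV_nonneg) auto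
  have q: "q \<ge> 0" unfolding q_def using w by (intro sum_nonneg mult_nonneg_nonneg AV_nonneg) auto
  have eq: "(\<Sum>t\<in>TT. w t * AV A (\<lambda>z. (v t z)\<^sup>2) (x(i := j))) = q + 2 * \<beta> j + z j" for j
  proof -
    have "(v t (z(i := j)))\<^sup>2 = (av i (v t) z)\<^sup>2 + 2 * (av i (v t) z * h j t z) + (h j t z)\<^sup>2" for t z
      by (simp add: h_def power2_eq_square algebra_simps)
    then show ?thesis
      by (simp add: upd AV_add AV_cmult q_def \<beta>_def z_def sum.distrib distrib_left sum_distrib_left mult.left_commute)
  qed
  have zeq: "(\<Sum>t\<in>TT. w t * AV A (\<lambda>z. (v t z - av i (v t) z)\<^sup>2) (x(i := j))) = z j" for j
    by (simp add: upd avi z_def h_def)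
  have h0: "(\<Sum>j\<in>Om. h j t z) = 0" for t z
    using card_Om_pos by (simp add: h_def sum_subtractf av_def)
  have "(\<Sum>j\<in>Om. \<beta> j) = (\<Sum>t\<in>TT. w t * AV A (\<lambda>z. av i (v t) z * (\<Sum>j\<in>Om. h j t z)) x)"
    unfolding \<beta>_def by (subst sum.swap) (simp add: sum_distrib_left AV_sum)
  then have s: "(\<Sum>j\<in>Om. \<beta> j) = 0" by (simp add: h0 AV_def)
  have cs: "(\<beta> j)\<^sup>2 \<le> q * z j" for j
    unfolding \<beta>_def q_def z_def by (rule AV_cauchy_schwarz) (rule w)
  have "?L = (\<Sum>j\<in>Om. (q + 2 * \<beta> j + z j) ^ k) / card Om" by (simp add: av_def[of i "\<lambda>x. _ x ^ k"] eq)
  also have "\<dots> \<le> (q + 4 * k * ((\<Sum>j\<in>Om. z j) / card Om)) ^ k + (3 * k) ^ (2 * k) * ((\<Sum>j\<in>Om. z j ^ k) / card Om)"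
    using one_variable_step[of Om q k z \<beta>] finite_Om nonempty_Om q assms(2) z cs s by simp
  also have "(\<Sum>j\<in>Om. z j) / card Om = (\<Sum>t\<in>TT. w t * av i (AV A (\<lambda>z. (v t z - av i (v t) z)\<^sup>2)) x)"
    unfolding zeq[symmetric] by (subst sum.swap) (simp add: av_def[of i "AV _ _"] sum_distrib_left sum_divide_distrib)
  also have "(\<Sum>j\<in>Om. z j ^ k) / card Om = av i (\<lambda>x. (\<Sum>t\<in>TT. w t * AV A (\<lambda>z. (v t z - av i (v t) z)\<^sup>2) x) ^ k) x"
    by (simp add: av_def[of i "\<lambda>x. _ x ^ k"] zeq)
  finally show ?thesis unfolding q_def by simp
qed


text \<open>\<open>S\<close> collects the coordinates that stay outside the \<open>k\<close>-th
  power, with a difference taken, at cost \<open>(3 * k) ^ (2 * k)\<close> each. The others are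
  integrated inside the norm; those in \<open>T\<close> also carry a difference, at cost
  \<open>4 * k\<close>. Inserting a coordinate into \<open>P\<close> applies the one-variable step
  to every summand.\<close>

lemma hypercontractive:
  assumes "finite P" "k \<ge> 1"
  shows "AV P (\<lambda>x. G x ^ (2 * k)) x
    \<le> (\<Sum>S\<in>Pow P. real ((3 * k) ^ (2 * k)) ^ card S *
        AV P (\<lambda>x. (\<Sum>T\<in>Pow (P - S). real (4 * k) ^ card T * AV (P - S) (\<lambda>z. (escomp P (S \<union> T) G z)\<^sup>2) x) ^ k) x)"
  using assms
proof (induction P arbitrary: x rule: finite_induct)
  case empty
  then show ?case by (simp add: power_mult)
next
  case (insert i P)
  define E where "E = (\<lambda>P S x. \<Sum>T\<in>Pow (P - S). real (4 * k) ^ card T * AV (P - S) (\<lambda>z. (escomp P (S \<union> T) G z)\<^sup>2) x)"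
  define b where "b = real ((3 * k) ^ (2 * k))"
  let ?P = "insert i P"
  have step: "av i (\<lambda>x. E P S x ^ k) y \<le> av i (\<lambda>x. E ?P S x ^ k) y + b * av i (\<lambda>x. E ?P (insert i S) x ^ k) y"
    if "S \<in> Pow P" for S y
  proof -
    have S: "S \<subseteq> P" "i \<notin> S" "i \<notin> P - S" "finite (P - S)" "?P - S = insert i (P - S)"
      using that insert by auto
    define v where "v = (\<lambda>T. escomp P (S \<union> T) G)"
    have c1: "escomp ?P (S \<union> T) G = av i (v T)" if "T \<in> Pow (P - S)" for T
      using that S insert by (auto simp: v_def intro!: escomp_insert_out)
    have c2: "escomp ?P (insert i (S \<union> T)) G = (\<lambda>z. v T z - av i (v T) z)" if "T \<in> Pow (P - S)" for T
      using that S insert by (auto simp: v_def intro!: escomp_insert_in)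
    have E2: "E ?P (insert i S) x = (\<Sum>T\<in>Pow (P - S). real (4 * k) ^ card T * AV (P - S) (\<lambda>z. (v T z - av i (v T) z)\<^sup>2) x)" for x
    proof -
      have D: "?P - insert i S = P - S" using S by auto
      show ?thesis unfolding E_def D by (intro sum.cong refl) (simp add: c2 del: Pow_iff)
    qed
    have E1: "E ?P S x = (\<Sum>T\<in>Pow (P - S). real (4 * k) ^ card T * AV (P - S) (\<lambda>z. (av i (v T) z)\<^sup>2) x)
         + 4 * k * (\<Sum>T\<in>Pow (P - S). real (4 * k) ^ card T * av i (AV (P - S) (\<lambda>z. (v T z - av i (v T) z)\<^sup>2)) x)" for x
    proof -
      have "AV (insert i (P - S)) (\<lambda>z. (av i (v T) z)\<^sup>2) = AV (P - S) (\<lambda>z. (av i (v T) z)\<^sup>2)" for T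
        using S av_indep_fun[of i "av i (v T)" "\<lambda>y. y\<^sup>2"] by (simp add: AV_insert av_AV_commute)
      moreover have "card (insert i T) = Suc (card T)" if "T \<in> Pow (P - S)" for T
        using that S by (subst card_insert_disjoint) (auto intro: finite_subset)
      ultimately show ?thesis
        unfolding E_def S(5) sum_Pow_insert[OF S(4,3)] sum.distrib sum_distrib_left
        using S by (intro arg_cong2[of _ _ _ _ "(+)"] sum.cong refl) (simp_all add: c1 c2 AV_insert del: Pow_iff)
    qed
    have *: "av i (\<lambda>x. E P S x ^ k) z \<le> E ?P S z ^ k + b * av i (\<lambda>x. E ?P (insert i S) x ^ k) z" for z
      unfolding E2 E1 unfolding E_def b_def v_def
      using hypercontractive_step[OF S(3) insert.prems, of "Pow (P - S)" "\<lambda>T. real (4 * k) ^ card T" "\<lambda>T. escomp P (S \<union> T) G" z]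
      by simp
    \<comment> \<open>Averaging a second time puts both terms of the pointwise bound under an
      average over \<open>i\<close>, the shape in which they are absorbed into
      \<open>AV ?P\<close>.\<close>
    have "av i (\<lambda>x. E P S x ^ k) y = av i (av i (\<lambda>x. E P S x ^ k)) y" by simp
    also have "\<dots> \<le> av i (\<lambda>z. E ?P S z ^ k + b * av i (\<lambda>x. E ?P (insert i S) x ^ k) z) y"
      by (rule av_mono) (rule *)
    also have "\<dots> = av i (\<lambda>x. E ?P S x ^ k) y + b * av i (\<lambda>x. E ?P (insert i S) x ^ k) y"
      by (simp add: av_add av_cmult)
    finally show ?thesis .
  qed
  have "AV ?P (\<lambda>x. G x ^ (2 * k)) x = av i (AV P (\<lambda>x. G x ^ (2 * k))) x"
    using insert by (simp add: AV_insert)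
  also have "\<dots> \<le> av i (\<lambda>x. \<Sum>S\<in>Pow P. b ^ card S * AV P (\<lambda>x. E P S x ^ k) x) x"
    using insert.IH[OF insert.prems] by (intro av_mono) (simp add: E_def b_def)
  also have "\<dots> = (\<Sum>S\<in>Pow P. b ^ card S * AV P (av i (\<lambda>x. E P S x ^ k)) x)"
    using insert by (simp add: av_sum av_cmult av_AV_commute)
  also have "\<dots> \<le> (\<Sum>S\<in>Pow P. b ^ card S * AV P (\<lambda>y. av i (\<lambda>x. E ?P S x ^ k) y + b * av i (\<lambda>x. E ?P (insert i S) x ^ k) y) x)"
    by (intro sum_mono mult_left_mono AV_mono step) (auto simp: b_def)
  also have "\<dots> = (\<Sum>S\<in>Pow P. b ^ card S * AV ?P (\<lambda>x. E ?P S x ^ k) x + b ^ card (insert i S) * AV ?P (\<lambda>x. E ?P (insert i S) x ^ k) x)"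
  proof (intro sum.cong refl)
    fix S assume S: "S \<in> Pow P"
    then have "card (insert i S) = Suc (card S)"
      using insert by (subst card_insert_disjoint) (auto intro: finite_subset)
    then show "b ^ card S * AV P (\<lambda>y. av i (\<lambda>x. E ?P S x ^ k) y + b * av i (\<lambda>x. E ?P (insert i S) x ^ k) y) x
      = b ^ card S * AV ?P (\<lambda>x. E ?P S x ^ k) x + b ^ card (insert i S) * AV ?P (\<lambda>x. E ?P (insert i S) x ^ k) x"
      using insert by (simp add: AV_insert av_AV_commute AV_add AV_cmult algebra_simps)
  qed
  also have "\<dots> = (\<Sum>S\<in>Pow ?P. b ^ card S * AV ?P (\<lambda>x. E ?P S x ^ k) x)"
    using insert by (simp add: sum_Pow_insert)
  finally show ?case by (simp add: E_def b_def)
qed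

end

section \<open>The level-d inequality on product spaces\<close>

lemma exp_two_le: "exp (2::real) \<le> 8"
proof -
  have "exp (2::real) = exp 1 * exp 1" by (simp add: exp_add[symmetric])
  also have "\<dots> \<le> (272 / 100) * (272 / 100)" using e_less_272 by (intro mult_mono) auto
  finally show ?thesis by simp
qed

text \<open>Here \<open>l\<close> is to be \<open>L / d\<close>, \<open>k\<close> its ceiling, and
  \<open>m ^ d\<close> the target for the normalised weight. Since \<open>l \<ge> 4\<close>,
  \<open>k \<le> 5 / 4 * l\<close>, so the first left side is at most \<open>40 * l\<close>, and 40
  is a 250th of \<open>10 ^ 4\<close>. In the second,
  \<open>9 * k * exp 1 * r\<^sup>2 \<le> m / 100\<close>, and the spare \<open>100 ^ (k - 1)\<close>
  absorbs the one unmatched factor \<open>9 * k / 4\<close>.\<close>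

lemma level_bound_constants:
  fixes r l :: real
  assumes "l \<ge> 4" "r \<ge> 1" "l \<le> real k" "real k \<le> l + 1"
  defines "m \<equiv> 10 ^ 4 * r\<^sup>2 * l"
  shows "exp 2 * (4 * k) \<le> m / 250" and "(9 * real k / 4) ^ k * (4 * exp 1 * r\<^sup>2) ^ (k - 1) \<le> m ^ (k - 1)"
proof -
  have k: "k \<ge> 4" using assms by linarith
  have e1: "exp (1::real) \<le> 272 / 100" using e_less_272 by simp
  have kl: "real k \<le> 5 / 4 * l" using assms by simp
  have r2: "r\<^sup>2 \<ge> 1" using assms(2) by simp
  have l2: "l \<le> r\<^sup>2 * l" using mult_right_mono[OF r2, of l] assms by simp
  have "exp 2 * (4 * k) \<le> 8 * real (4 * k)" using exp_two_le by (intro mult_right_mono) auto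
  also have "\<dots> \<le> 40 * (r\<^sup>2 * l)" using kl l2 by linarith
  finally show "exp 2 * (4 * k) \<le> m / 250" by (simp add: m_def)
  obtain j where j: "k = Suc j" "j \<ge> 1" using k by (cases k) auto
  have m0: "m > 0" unfolding m_def using assms(1,2) by (intro mult_pos_pos) auto
  have "9 * real k * exp 1 * r\<^sup>2 \<le> 9 * (5 / 4 * l) * (272 / 100) * r\<^sup>2"
    using e1 kl assms by (intro mult_right_mono mult_mono) auto
  also have "\<dots> \<le> m / 100" using assms by (simp add: m_def)
  finally have q: "9 * real k * exp 1 * r\<^sup>2 \<le> m / 100" .
  have p100: "9 * real (Suc j) / 4 \<le> 100 ^ j" using j(2)
    by (induction j rule: dec_induct) auto
  have A: "p ^ Suc j * q ^ j = p * (p * q) ^ j" for p q :: real by (simp add: power_mult_distrib)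
  have e: "(9 * real k / 4) * (4 * exp 1 * r\<^sup>2) = 9 * real k * exp 1 * r\<^sup>2" by simp
  have "(9 * real k / 4) ^ k * (4 * exp 1 * r\<^sup>2) ^ (k - 1) = (9 * real k / 4) ^ Suc j * (4 * exp 1 * r\<^sup>2) ^ j"
    using j(1) by (simp only: of_nat_mult of_nat_numeral diff_Suc_1)
  also have "\<dots> = 9 * real k / 4 * (9 * real k * exp 1 * r\<^sup>2) ^ j"
    by (simp only: A e)
  also have "\<dots> \<le> 9 * real k / 4 * (m / 100) ^ j"
    using q by (intro mult_left_mono power_mono) auto
  also have "\<dots> \<le> 100 ^ j * (m / 100) ^ j" using p100 m0 j by (intro mult_right_mono) auto
  also have "\<dots> = m ^ (k - 1)" by (simp add: j power_divide)
  finally show "(9 * real k / 4) ^ k * (4 * exp 1 * r\<^sup>2) ^ (k - 1) \<le> m ^ (k - 1)" .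
qed

text \<open>Solves the implicit inequality for \<open>V\<close>. If
  \<open>U = V / \<gamma>\<^sup>2\<close> exceeded \<open>m ^ d\<close>, every normalised summand
  would be at most \<open>\<epsilon> ^ (d * k) * U ^ (2 * k)\<close>, powers of \<open>m ^ d\<close>
  being exchanged for powers of \<open>U\<close>. The binomials add up to \<open>2 ^ d\<close>, and
  \<open>2 ^ d * \<epsilon> ^ (d * k) < 1\<close> is the contradiction.\<close>

lemma level_bound_arith:
  fixes r L V \<gamma> :: real and \<Lambda> :: "nat \<Rightarrow> real"
  assumes d: "d \<ge> 1" and L: "4 * real d \<le> L" and r: "r \<ge> 1" and \<gamma>: "\<gamma> > 0"
    and k: "k = nat \<lceil>L / d\<rceil>"
    and \<Lambda>0: "\<Lambda> 0 = V"
    and \<Lambda>: "\<And>t. 1 \<le> t \<Longrightarrow> t \<le> d \<Longrightarrow> \<Lambda> t = 4 ^ t * r ^ (2 * t) * \<gamma>\<^sup>2 * (10 ^ 4 * r\<^sup>2 * L / real (d - t)) ^ (d - t)"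
    and V: "V ^ (2 * k) \<le> \<gamma> ^ (2 * k) * exp (2 * L) *
        (\<Sum>t\<le>d. real (d choose t) * (real ((3 * k) ^ (2 * k)) ^ t * (4 * k) ^ ((d - t) * k) * \<Lambda> t ^ (k - 1) * V))"
  shows "V \<le> \<gamma>\<^sup>2 * (10 ^ 4 * r\<^sup>2 * L / d) ^ d"
proof (rule ccontr)
  define l where "l = L / d"
  define m where "m = 10 ^ 4 * r\<^sup>2 * l"
  define U where "U = V / \<gamma>\<^sup>2"
  define \<epsilon> where "\<epsilon> = (1/250::real)"
  assume "\<not> V \<le> \<gamma>\<^sup>2 * (10 ^ 4 * r\<^sup>2 * L / d) ^ d"
  then have Um: "U > m ^ d" using \<gamma> by (simp add: U_def m_def l_def field_simps)
  have l4: "l \<ge> 4" using L d by (simp add: l_def field_simps)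
  have kl: "l \<le> real k" "real k \<le> l + 1"
    using l4 unfolding k l_def[symmetric] by linarith+
  have k4: "k \<ge> 4" using kl l4 by linarith
  have Ll: "L = l * d" using d by (simp add: l_def)
  have VU: "V = \<gamma>\<^sup>2 * U" using \<gamma> by (simp add: U_def)
  note c = level_bound_constants[OF l4 r kl, folded m_def]
  have m1: "m \<ge> 1"
  proof -
    have "1 * 1 * 1 \<le> 10 ^ 4 * r\<^sup>2 * l" using r l4 by (intro mult_mono) auto
    then show ?thesis by (simp add: m_def)
  qed
  have md: "m ^ d \<ge> 1" using m1 by simp
  have U1: "U > 1" using Um md by linarith
  \<comment> \<open>As \<open>L = l * d\<close> and \<open>l \<le> k\<close>, the loss
    \<open>exp (2 * L)\<close> is at most \<open>exp 2\<close> for each of the \<open>d * k\<close>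
    factors.\<close>
  have expo: "exp (2 * L) * (4 * k) ^ (d * k) \<le> (\<epsilon> * m) ^ (d * k)"
  proof -
    have "exp (2 * L) \<le> exp (real (d * k) * 2)" using kl d by (simp add: Ll mult.commute)
    also have "\<dots> = exp 2 ^ (d * k)" by (simp only: exp_of_nat_mult)
    finally have "exp (2 * L) * (4 * k) ^ (d * k) \<le> exp 2 ^ (d * k) * (4 * k) ^ (d * k)"
      by (intro mult_right_mono) auto
    also have "\<dots> = (exp 2 * (4 * k)) ^ (d * k)" by (simp add: power_mult_distrib)
    also have "\<dots> \<le> (\<epsilon> * m) ^ (d * k)" using c(1) by (intro power_mono) (auto simp: \<epsilon>_def)
    finally show ?thesis .
  qed
  define X where "X = (\<lambda>t. exp (2 * L) * (real ((3 * k) ^ (2 * k)) ^ t * (4 * k) ^ ((d - t) * k) * (\<Lambda> t / \<gamma>\<^sup>2) ^ (k - 1) * U))"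
  have X: "X t \<le> \<epsilon> ^ (d * k) * U ^ (2 * k)" if t: "t \<le> d" for t
  proof (cases "t = 0")
    case True
    have "X t = (exp (2 * L) * (4 * k) ^ (d * k)) * U ^ k"
      using \<gamma> k4 by (simp add: X_def True \<Lambda>0 VU power_eq_if[of U k])
    also have "\<dots> \<le> (\<epsilon> * m) ^ (d * k) * U ^ k" using expo U1 by (intro mult_right_mono) auto
    also have "\<dots> = \<epsilon> ^ (d * k) * (m ^ d) ^ k * U ^ k" by (simp add: power_mult_distrib power_mult)
    also have "\<dots> \<le> \<epsilon> ^ (d * k) * U ^ k * U ^ k"
      using Um md U1 by (intro mult_right_mono mult_left_mono power_mono) (auto simp: \<epsilon>_def)
    also have "\<dots> = \<epsilon> ^ (d * k) * U ^ (2 * k)" by (simp add: mult_2 power_add)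
    finally show ?thesis .
  next
    case False
    then have t1: "t \<ge> 1" by simp
    \<comment> \<open>Lowering the degree from \<open>d\<close> to \<open>s = d - t\<close> raises
      the base from \<open>L / d\<close> to \<open>L / s\<close>; the total effect is
      \<open>(1 + t / s) ^ s\<close>, at most \<open>exp 1 ^ t\<close>.\<close>
    have B: "(10 ^ 4 * r\<^sup>2 * L / real (d - t)) ^ (d - t) \<le> m ^ (d - t) * exp 1 ^ t"
    proof (cases "t = d")
      case True then show ?thesis by simp
    next
      case False
      define s where "s = d - t"
      have s: "s \<ge> 1" "real d = real s + real t" using False t by (auto simp: s_def)
      have "(10 ^ 4 * r\<^sup>2 * L / real s) ^ s = (m * (1 + real t / real s)) ^ s"
        using s by (simp add: m_def Ll field_simps)
      also have "\<dots> = m ^ s * (1 + real t / real s) ^ s" by (simp add: power_mult_distrib)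
      also have "\<dots> \<le> m ^ s * exp (real t / real s) ^ s"
        using m1 by (intro mult_left_mono power_mono) (auto simp: exp_ge_add_one_self)
      also have "exp (real t / real s) ^ s = exp 1 ^ t"
        using s by (simp add: exp_of_nat_mult[symmetric])
      finally show ?thesis by (simp add: s_def)
    qed
    have "\<Lambda> t / \<gamma>\<^sup>2 = 4 ^ t * r ^ (2 * t) * (10 ^ 4 * r\<^sup>2 * L / real (d - t)) ^ (d - t)"
      using \<gamma> by (simp add: \<Lambda>[OF t1 t])
    also have "\<dots> \<le> 4 ^ t * r ^ (2 * t) * (m ^ (d - t) * exp 1 ^ t)"
      using B r by (intro mult_left_mono) auto
    also have "\<dots> = (4 * exp 1 * r\<^sup>2) ^ t * m ^ (d - t)"
      by (simp add: power_mult_distrib power_mult)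
    finally have L1: "\<Lambda> t / \<gamma>\<^sup>2 \<le> (4 * exp 1 * r\<^sup>2) ^ t * m ^ (d - t)" .
    have L0: "\<Lambda> t / \<gamma>\<^sup>2 \<ge> 0" unfolding \<Lambda>[OF t1 t] using r L by (auto intro!: mult_nonneg_nonneg divide_nonneg_nonneg zero_le_power)
    \<comment> \<open>From \<open>(3 * k)\<^sup>2 = (4 * k) * (9 * k / 4)\<close>: the factors
      \<open>4 * k\<close> are collected into one power that is the same for all
      \<open>t\<close>.\<close>
    have b: "real ((3 * k) ^ (2 * k)) ^ t * (4 * k) ^ ((d - t) * k) = (4 * k) ^ (d * k) * ((9 * real k / 4) ^ k) ^ t"
    proof -
      have "real ((3 * k) ^ (2 * k)) = ((3 * real k)\<^sup>2) ^ k"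
        by (simp only: power_mult of_nat_power of_nat_mult of_nat_numeral)
      also have "(3 * real k)\<^sup>2 = real (4 * k) * (9 * real k / 4)" by (simp add: power2_eq_square)
      finally have "real ((3 * k) ^ (2 * k)) = real (4 * k) ^ k * (9 * real k / 4) ^ k"
        by (simp only: power_mult_distrib)
      moreover have "(p ^ k * q) ^ t = p ^ (t * k) * q ^ t" for p q :: real
        by (simp only: power_mult_distrib power_mult[symmetric] mult.commute[of t])
      ultimately have "real ((3 * k) ^ (2 * k)) ^ t = real (4 * k) ^ (t * k) * ((9 * real k / 4) ^ k) ^ t"
        by (simp only:)
      moreover have "real (4 * k) ^ (t * k) * real (4 * k) ^ ((d - t) * k) = real (4 * k) ^ (d * k)"
        using t by (simp only: power_add[symmetric] add_mult_distrib[symmetric] le_add_diff_inverse)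
      ultimately show ?thesis by (simp add: mult_ac)
    qed
    have gen: "(p ^ k) ^ t * (q ^ t * m ^ (d - t)) ^ (k - 1) = (p ^ k * q ^ (k - 1)) ^ t * m ^ ((d - t) * (k - 1))" for p q :: real
      by (simp only: power_mult_distrib power_mult[symmetric] mult.commute[of t] mult.assoc)
    have "X t = (exp (2 * L) * (4 * k) ^ (d * k)) * (((9 * real k / 4) ^ k) ^ t * (\<Lambda> t / \<gamma>\<^sup>2) ^ (k - 1)) * U"
      unfolding X_def b by simp
    also have "\<dots> \<le> (\<epsilon> * m) ^ (d * k) * (((9 * real k / 4) ^ k) ^ t * ((4 * exp 1 * r\<^sup>2) ^ t * m ^ (d - t)) ^ (k - 1)) * U"
      using expo L1 L0 U1 m1 by (intro mult_mono power_mono mult_nonneg_nonneg) (auto simp: \<epsilon>_def)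
    also have "((9 * real k / 4) ^ k) ^ t * ((4 * exp 1 * r\<^sup>2) ^ t * m ^ (d - t)) ^ (k - 1)
        = ((9 * real k / 4) ^ k * (4 * exp 1 * r\<^sup>2) ^ (k - 1)) ^ t * m ^ ((d - t) * (k - 1))"
      by (rule gen)
    also have "(\<epsilon> * m) ^ (d * k) * \<dots> * U \<le> (\<epsilon> * m) ^ (d * k) * ((m ^ (k - 1)) ^ t * m ^ ((d - t) * (k - 1))) * U"
      using c(2) U1 m1 by (intro mult_right_mono mult_left_mono power_mono) (auto simp: \<epsilon>_def)
    also have "(m ^ (k - 1)) ^ t * m ^ ((d - t) * (k - 1)) = m ^ (d * (k - 1))"
    proof -
      have "d * (k - 1) = (k - 1) * t + (d - t) * (k - 1)"
        using t by (metis add_mult_distrib le_add_diff_inverse mult.commute)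
      then show ?thesis by (simp add: power_mult[symmetric] power_add[symmetric])
    qed
    also have "(\<epsilon> * m) ^ (d * k) * m ^ (d * (k - 1)) * U = \<epsilon> ^ (d * k) * ((m ^ d) ^ k * (m ^ d) ^ (k - 1) * U)"
      by (simp add: power_mult_distrib power_mult)
    also have "\<dots> \<le> \<epsilon> ^ (d * k) * (U ^ k * U ^ (k - 1) * U)"
      using Um md U1 m1 by (intro mult_right_mono mult_left_mono mult_mono power_mono) (auto simp: \<epsilon>_def)
    also have "U ^ k * U ^ (k - 1) * U = U ^ (2 * k)"
      using k4 by (simp add: mult_2 power_add power_eq_if[of U k])
    finally show ?thesis .
  qed
  have g: "\<gamma> ^ (2 * k) * \<gamma> ^ (2 * k) = (\<gamma>\<^sup>2) ^ (2 * k)"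
    by (simp only: power_add[symmetric] power_mult[symmetric]) (simp add: mult_2)
  have gk: "\<gamma> ^ (2 * k) = (\<gamma>\<^sup>2) ^ (k - 1) * \<gamma>\<^sup>2" 
    using k4 by (simp add: power_mult power_eq_if[of "\<gamma>\<^sup>2" k])
  have "(\<gamma>\<^sup>2) ^ (2 * k) * U ^ (2 * k) = V ^ (2 * k)" by (simp add: VU power_mult_distrib)
  also have "\<dots> \<le> \<gamma> ^ (2 * k) * (\<gamma> ^ (2 * k) * (\<Sum>t\<le>d. real (d choose t) * X t))"
  proof -
    have "\<Lambda> t ^ (k - 1) * V = \<gamma> ^ (2 * k) * ((\<Lambda> t / \<gamma>\<^sup>2) ^ (k - 1) * U)" for t
      using \<gamma> by (simp add: gk VU power_divide)
    then have "exp (2 * L) * (\<Sum>t\<le>d. real (d choose t) * (real ((3 * k) ^ (2 * k)) ^ t * (4 * k) ^ ((d - t) * k) * \<Lambda> t ^ (k - 1) * V))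
      = \<gamma> ^ (2 * k) * (\<Sum>t\<le>d. real (d choose t) * X t)"
      unfolding X_def sum_distrib_left by (intro sum.cong refl) (simp add: mult_ac)
    then show ?thesis using V by (simp add: mult.assoc)
  qed
  also have "\<dots> = (\<gamma>\<^sup>2) ^ (2 * k) * (\<Sum>t\<le>d. real (d choose t) * X t)"
    by (simp add: g[symmetric] mult.assoc)
  finally have "U ^ (2 * k) \<le> (\<Sum>t\<le>d. real (d choose t) * X t)"
    using \<gamma> by (simp del: power_mult)
  also have "\<dots> \<le> (\<Sum>t\<le>d. real (d choose t) * (\<epsilon> ^ (d * k) * U ^ (2 * k)))"
    using X by (intro sum_mono mult_left_mono) auto
  also have "\<dots> = 2 ^ d * \<epsilon> ^ (d * k) * U ^ (2 * k)"
    using choose_row_sum[of d] by (simp add: sum_distrib_right[symmetric] of_nat_sum[symmetric] del: of_nat_sum)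
  also have "\<dots> < 1 * U ^ (2 * k)"
  proof (rule mult_strict_right_mono)
    have "(2::real) ^ d * \<epsilon> ^ (d * k) = (2 * \<epsilon> ^ k) ^ d"
      by (simp only: power_mult_distrib power_mult[symmetric] mult.commute[of d])
    moreover have "\<epsilon> ^ k \<le> \<epsilon> ^ 1" using k4 by (intro power_decreasing) (auto simp: \<epsilon>_def)
    then have x: "2 * \<epsilon> ^ k < 1" "0 \<le> 2 * \<epsilon> ^ k" by (auto simp: \<epsilon>_def)
    moreover have "(2 * \<epsilon> ^ k) ^ d \<le> (2 * \<epsilon> ^ k) ^ 1" using d x by (intro power_decreasing) auto
    ultimately show "2 ^ d * \<epsilon> ^ (d * k) < 1" by simp
  qed (use U1 in simp)
  finally show False by simp
qed

section \<open>Jensen and Hoelder inequalities for averages\<close>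

lemma power_ge_tangent:
  fixes g s :: real
  assumes "g \<ge> 0" "s \<ge> 0"
  shows "s ^ Suc k + Suc k * s ^ k * (g - s) \<le> g ^ Suc k"
proof (induction k)
  case (Suc k)
  have "s ^ Suc (Suc k) + Suc (Suc k) * s ^ Suc k * (g - s) \<le> s ^ Suc (Suc k) + Suc (Suc k) * s ^ Suc k * (g - s) + Suc k * s ^ k * (g - s)\<^sup>2"
    using assms by simp
  also have "\<dots> = g * (s ^ Suc k + Suc k * s ^ k * (g - s))"
    by (simp add: power2_eq_square algebra_simps)
  also have "\<dots> \<le> g * g ^ Suc k" using Suc assms by (intro mult_left_mono) auto
  finally show ?case by simp
qed simp

context finite_avg begin

lemma AV_cauchy_schwarz1:
  fixes G H :: "('i \<Rightarrow> 'a) \<Rightarrow> real"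
  shows "(AV A (\<lambda>z. G z * H z) x)\<^sup>2 \<le> AV A (\<lambda>z. (G z)\<^sup>2) x * AV A (\<lambda>z. (H z)\<^sup>2) x"
  using AV_cauchy_schwarz[of "{()}" "\<lambda>_. 1" A "\<lambda>_. G" "\<lambda>_. H" x] by simp

text \<open>Jensen for a power under the weight \<open>f\<close> normalised to mass 1: integrate the
  tangent at the weighted mean \<open>s\<close>. If the weight has mass 0, the left side vanishes by
  Cauchy-Schwarz.\<close>

lemma AV_jensen:
  fixes f g :: "('i \<Rightarrow> 'a) \<Rightarrow> real"
  assumes "\<And>x. f x \<ge> 0" "\<And>x. g x \<ge> 0"
  shows "(AV A (\<lambda>z. f z * g z) x) ^ Suc k \<le> (AV A f x) ^ k * AV A (\<lambda>z. f z * g z ^ Suc k) x"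
proof (cases "AV A f x = 0")
  case True
  have "AV A (\<lambda>z. sqrt (f z) * (sqrt (f z) * g z)) x = 0"
    using AV_cauchy_schwarz1[of A "\<lambda>z. sqrt (f z)" "\<lambda>z. sqrt (f z) * g z" x] True assms by simp
  moreover have "(\<lambda>z. sqrt (f z) * (sqrt (f z) * g z)) = (\<lambda>z. f z * g z)"
    using assms by (intro ext) (simp add: mult.assoc[symmetric])
  ultimately show ?thesis using True assms by (simp add: AV_nonneg)
next
  case False
  define a where "a = AV A f x"
  have a: "a > 0" using False AV_nonneg[of f A x] assms by (simp add: a_def)
  define s where "s = AV A (\<lambda>z. f z * g z) x / a"
  have s: "s \<ge> 0" using a assms by (simp add: s_def AV_nonneg)
  have "a * s ^ Suc k = AV A (\<lambda>z. s ^ Suc k * f z + Suc k * s ^ k * (f z * g z) - Suc k * s ^ Suc k * f z) x"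
    unfolding AV_diff AV_add AV_cmult using a by (simp add: a_def s_def field_simps)
  also have "\<dots> = AV A (\<lambda>z. f z * (s ^ Suc k + Suc k * s ^ k * (g z - s))) x"
    by (simp add: algebra_simps)
  also have "\<dots> \<le> AV A (\<lambda>z. f z * g z ^ Suc k) x"
    by (intro AV_mono mult_left_mono power_ge_tangent assms s)
  finally have *: "a * s ^ Suc k \<le> AV A (\<lambda>z. f z * g z ^ Suc k) x" .
  have "AV A (\<lambda>z. f z * g z) x = a * s" using a by (simp add: s_def)
  then have "(AV A (\<lambda>z. f z * g z) x) ^ Suc k = a ^ k * (a * s ^ Suc k)"
    by (simp add: power_mult_distrib)
  also have "\<dots> \<le> a ^ k * AV A (\<lambda>z. f z * g z ^ Suc k) x"
    using a * by (intro mult_left_mono) auto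
  finally show ?thesis by (simp only: a_def)
qed

text \<open>Instead of the dual exponent of \<open>2 * k\<close>, this uses the two norms of
  \<open>F\<close> that biglobalness controls: Jensen with the weight \<open>\<bar>F\<bar>\<close>
  reduces to the mean of \<open>\<bar>F\<bar> * \<bar>G\<bar> ^ k\<close>, to which Cauchy-Schwarz
  applies.\<close>

lemma AV_hoelder:
  assumes "k \<ge> 1"
  shows "(AV A (\<lambda>z. F z * G z) x) ^ (2 * k)
    \<le> (AV A (\<lambda>z. \<bar>F z\<bar>) x) ^ (2 * k - 2) * AV A (\<lambda>z. (F z)\<^sup>2) x * AV A (\<lambda>z. G z ^ (2 * k)) x"
proof -
  obtain j where j: "k = Suc j" using assms by (cases k) auto
  let ?p = "AV A (\<lambda>z. \<bar>F z\<bar> * \<bar>G z\<bar>) x" and ?q = "AV A (\<lambda>z. \<bar>F z\<bar> * \<bar>G z\<bar> ^ k) x"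
  have p0: "?p \<ge> 0" by (intro AV_nonneg) auto
  have "(AV A (\<lambda>z. F z * G z) x) ^ (2 * k) = \<bar>AV A (\<lambda>z. F z * G z) x\<bar> ^ (2 * k)"
    by (simp add: power_mult)
  also have "\<dots> \<le> ?p ^ (2 * k)"
    using AV_abs[of A "\<lambda>z. F z * G z" x] by (intro power_mono) (auto simp: abs_mult)
  also have "\<dots> = (?p ^ k)\<^sup>2" by (simp add: power_mult[symmetric] mult.commute)
  also have "\<dots> \<le> ((AV A (\<lambda>z. \<bar>F z\<bar>) x) ^ j * ?q)\<^sup>2"
    unfolding j by (intro power_mono AV_jensen) (use p0 in auto)
  also have "\<dots> = (AV A (\<lambda>z. \<bar>F z\<bar>) x) ^ (2 * k - 2) * ?q\<^sup>2"
    by (simp add: j power_mult_distrib power_mult[symmetric] mult.commute)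
  also have "\<dots> \<le> (AV A (\<lambda>z. \<bar>F z\<bar>) x) ^ (2 * k - 2) * (AV A (\<lambda>z. \<bar>F z\<bar>\<^sup>2) x * AV A (\<lambda>z. (\<bar>G z\<bar> ^ k)\<^sup>2) x)"
    by (intro mult_left_mono AV_cauchy_schwarz1 zero_le_power AV_nonneg) auto
  also have "(\<lambda>z. (\<bar>G z\<bar> ^ k)\<^sup>2) = (\<lambda>z. G z ^ (2 * k))"
    by (intro ext) (simp add: power_even_abs power_mult power2_eq_square power_mult_distrib[symmetric] flip: abs_mult)
  finally show ?thesis by (simp add: mult.assoc)
qed

end

section \<open>Level weights, restrictions and the induction on the degree\<close>

context finite_avg begin

lemma AV_mono_on:
  assumes "\<And>y. (\<And>i. i \<notin> A \<Longrightarrow> y i = x i) \<Longrightarrow> G y \<le> H y"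
  shows "AV A G x \<le> AV A H x"
  unfolding AV_def by (intro divide_right_mono sum_mono assms) (auto simp: override_on_def)

lemma escomp_sum: "escomp P U (\<lambda>x. \<Sum>t\<in>T. H t x) x = (\<Sum>t\<in>T. escomp P U (H t) x)"
proof -
  have "escomp P U (\<lambda>x. \<Sum>t\<in>T. H t x) x = (\<Sum>V\<in>Pow U. \<Sum>t\<in>T. (- 1) ^ card (U - V) * AV (P - V) (H t) x)"
    unfolding escomp_def by (intro sum.cong refl) (simp only: AV_sum sum_distrib_left)
  also have "\<dots> = (\<Sum>t\<in>T. \<Sum>V\<in>Pow U. (- 1) ^ card (U - V) * AV (P - V) (H t) x)"
    by (rule sum.swap)
  finally show ?thesis by (simp only: escomp_def)
qed

lemma AV_zero [simp]: "AV A (\<lambda>x. 0) x = 0"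
  by (simp add: AV_def)

lemma AV_escomp_orth:
  assumes "finite N" "U \<subseteq> N" "W \<subseteq> N" "U \<noteq> W"
    and "\<And>i. i \<in> N - W \<Longrightarrow> av i H = H" and "\<And>i x. i \<in> W \<Longrightarrow> av i H x = 0"
  shows "AV N (\<lambda>x. escomp N U F x * H x) x = 0"
proof -
  from assms(4) consider i where "i \<in> U - W" | i where "i \<in> W - U" by auto
  then show ?thesis
  proof cases
    case 1
    then show ?thesis using assms by (intro AV_orth[of N i]) (auto simp: av_escomp_in)
  next
    case 2
    then have "AV N (\<lambda>x. H x * escomp N U F x) x = 0"
      using assms by (intro AV_orth[of N i]) (auto simp: av_escomp_out)
    then show ?thesis by (simp add: mult.commute)
  qed
qed

lemma AV_mult_pure:
  assumes "finite N" "W \<subseteq> N"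
    and "\<And>i. i \<in> N - W \<Longrightarrow> av i H = H" and "\<And>i x. i \<in> W \<Longrightarrow> av i H x = 0"
  shows "AV N (\<lambda>x. F x * H x) x = AV N (\<lambda>x. escomp N W F x * H x) x"
proof -
  have "AV N (\<lambda>x. F x * H x) x = AV N (\<lambda>x. \<Sum>U\<in>Pow N. escomp N U F x * H x) x"
    by (simp add: sum_escomp[OF assms(1), of F, symmetric] sum_distrib_right)
  also have "\<dots> = (\<Sum>U\<in>Pow N. AV N (\<lambda>x. escomp N U F x * H x) x)" by (rule AV_sum)
  also have "\<dots> = (\<Sum>U\<in>Pow N. if U = W then AV N (\<lambda>x. escomp N W F x * H x) x else 0)"
  proof (intro sum.cong refl)
    fix U assume U: "U \<in> Pow N"
    show "AV N (\<lambda>x. escomp N U F x * H x) x = (if U = W then AV N (\<lambda>x. escomp N W F x * H x) x else 0)"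
      using AV_escomp_orth[OF assms(1) _ assms(2) _ assms(3,4), of U F x] U by auto
  qed
  finally show ?thesis using assms(1,2) by simp
qed

text \<open>Each difference costs a factor \<open>4 = 2 + 2\<close>, through
  \<open>(a - c)\<^sup>2 \<le> 2 * a\<^sup>2 + 2 * c\<^sup>2\<close>. The bound is assumed at every
  point, so it survives averaging over the new coordinate.\<close>

lemma AV_escomp_diff_bound:
  assumes "finite S" "finite M" "S \<inter> M = {}"
    and "\<And>x. (\<Sum>I\<in>\<I>. AV M (\<lambda>z. (u I z)\<^sup>2) x) \<le> b"
  shows "(\<Sum>I\<in>\<I>. AV M (\<lambda>z. (escomp S S (u I) z)\<^sup>2) x) \<le> 4 ^ card S * b"
  using assms
proof (induction S arbitrary: x rule: finite_induct)
  case (insert i S)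
  have IH: "(\<Sum>I\<in>\<I>. AV M (\<lambda>z. (escomp S S (u I) z)\<^sup>2) x) \<le> 4 ^ card S * b" for x
    using insert by auto
  let ?v = "\<lambda>I. escomp S S (u I)"
  have sq: "(a - c)\<^sup>2 \<le> 2 * a\<^sup>2 + 2 * c\<^sup>2" for a c :: real
    using zero_le_power2[of "a + c"] unfolding power2_sum power2_diff by linarith
  have av_sq: "(av i G z)\<^sup>2 \<le> av i (\<lambda>z. (G z)\<^sup>2) z" for G z
    using AV_cauchy_schwarz1[of "{i}" G "\<lambda>_. 1" z] by (simp add: AV_insert)
  have "(\<Sum>I\<in>\<I>. AV M (\<lambda>z. (escomp (insert i S) (insert i S) (u I) z)\<^sup>2) x)
      \<le> (\<Sum>I\<in>\<I>. AV M (\<lambda>z. 2 * (?v I z)\<^sup>2 + 2 * av i (\<lambda>z. (?v I z)\<^sup>2) z) x)"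
  proof (intro sum_mono AV_mono)
    fix I z
    have "(?v I z - av i (?v I) z)\<^sup>2 \<le> 2 * (?v I z)\<^sup>2 + 2 * (av i (?v I) z)\<^sup>2" by (rule sq)
    also have "\<dots> \<le> 2 * (?v I z)\<^sup>2 + 2 * av i (\<lambda>z. (?v I z)\<^sup>2) z" using av_sq[of "?v I" z] by simp
    finally show "(escomp (insert i S) (insert i S) (u I) z)\<^sup>2 \<le> 2 * (?v I z)\<^sup>2 + 2 * av i (\<lambda>z. (?v I z)\<^sup>2) z"
      using insert.hyps by (simp add: escomp_insert_in)
  qed
  also have "\<dots> = 2 * (\<Sum>I\<in>\<I>. AV M (\<lambda>z. (?v I z)\<^sup>2) x) + 2 * av i (\<lambda>x. \<Sum>I\<in>\<I>. AV M (\<lambda>z. (?v I z)\<^sup>2) x) x"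
    using insert.prems by (simp add: AV_add AV_cmult sum.distrib sum_distrib_left av_sum av_AV_commute)
  also have "\<dots> \<le> 2 * (4 ^ card S * b) + 2 * av i (\<lambda>x. 4 ^ card S * b) x"
    by (intro add_mono mult_left_mono av_mono IH) auto
  also have "\<dots> = 4 ^ card (insert i S) * b" using insert.hyps by simp
  finally show ?case .
qed simp

definition level_weight :: "'i set \<Rightarrow> nat \<Rightarrow> (('i \<Rightarrow> 'a) \<Rightarrow> real) \<Rightarrow> ('i \<Rightarrow> 'a) \<Rightarrow> real" where
  "level_weight N d F x = (\<Sum>I | I \<subseteq> N \<and> card I = d. AV N (\<lambda>z. (escomp N I F z)\<^sup>2) x)"

text \<open>The restriction to \<open>S\<close> is the average over \<open>N - S\<close> with the
  values on \<open>S\<close> taken from \<open>x\<close>. As \<open>x\<close> is arbitrary, values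
  outside \<open>Om\<close> are included; the lifted functions to which this is applied vanish at
  such points.\<close>

definition product_biglobal :: "'i set \<Rightarrow> real \<Rightarrow> real \<Rightarrow> real \<Rightarrow> nat \<Rightarrow> (('i \<Rightarrow> 'a) \<Rightarrow> real) \<Rightarrow> bool" where
  "product_biglobal N r \<gamma>1 \<gamma>2 d F \<longleftrightarrow> (\<forall>S. S \<subseteq> N \<longrightarrow> card S \<le> d \<longrightarrow> (\<forall>x.
     AV (N - S) (\<lambda>z. \<bar>F z\<bar>) x \<le> r ^ card S * \<gamma>1 \<and>
     AV (N - S) (\<lambda>z. (F z)\<^sup>2) x \<le> (r ^ card S * \<gamma>2)\<^sup>2))"

text \<open>The restricted function is still \<open>F\<close>, seen on fewer coordinates. Both
  constants grow by the same factor, so their ratio, and with it \<open>L\<close>, is unchanged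
  while the degree drops.\<close>

lemma product_biglobal_restrict:
  assumes "product_biglobal N r \<gamma>1 \<gamma>2 d F" "finite N" "S \<subseteq> N" "card S \<le> d"
  shows "product_biglobal (N - S) r (r ^ card S * \<gamma>1) (r ^ card S * \<gamma>2) (d - card S) F"
  unfolding product_biglobal_def
proof (intro allI impI)
  fix S' x assume S': "S' \<subseteq> N - S" "card S' \<le> d - card S"
  have c: "card (S \<union> S') = card S + card S'" "S \<union> S' \<subseteq> N"
    using S' assms by (auto intro!: card_Un_disjoint intro: finite_subset)
  have e: "N - S - S' = N - (S \<union> S')" by auto
  have "AV (N - (S \<union> S')) (\<lambda>z. \<bar>F z\<bar>) x \<le> r ^ card (S \<union> S') * \<gamma>1 \<and>
     AV (N - (S \<union> S')) (\<lambda>z. (F z)\<^sup>2) x \<le> (r ^ card (S \<union> S') * \<gamma>2)\<^sup>2"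
    using assms(1)[unfolded product_biglobal_def, rule_format, of "S \<union> S'" x] assms(4) S'(2) c by linarith
  then show "AV (N - S - S') (\<lambda>z. \<bar>F z\<bar>) x \<le> r ^ card S' * (r ^ card S * \<gamma>1) \<and>
     AV (N - S - S') (\<lambda>z. (F z)\<^sup>2) x \<le> (r ^ card S' * (r ^ card S * \<gamma>2))\<^sup>2"
    unfolding e c(1) by (simp add: power_add mult_ac)
qed

lemma card_supersets:
  assumes "finite N" "S \<subseteq> N"
  shows "bij_betw (\<lambda>T. S \<union> T) {T. T \<subseteq> N - S \<and> card T = d - card S \<and> card S \<le> d} {I. I \<subseteq> N \<and> card I = d \<and> S \<subseteq> I}"
proof (rule bij_betw_byWitness[where f' = "\<lambda>I. I - S"])
  have fS: "finite S" using assms finite_subset by auto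
  show "(\<lambda>T. S \<union> T) ` {T. T \<subseteq> N - S \<and> card T = d - card S \<and> card S \<le> d} \<subseteq> {I. I \<subseteq> N \<and> card I = d \<and> S \<subseteq> I}"
  proof clarify
    fix T assume T: "T \<subseteq> N - S" "card T = d - card S" "card S \<le> d"
    then have "finite T" using assms finite_subset by blast
    then have "card (S \<union> T) = card S + card T" using T fS by (intro card_Un_disjoint) auto
    then show "S \<union> T \<subseteq> N \<and> card (S \<union> T) = d \<and> S \<subseteq> S \<union> T" using T assms by auto
  qed
  show "(\<lambda>I. I - S) ` {I. I \<subseteq> N \<and> card I = d \<and> S \<subseteq> I} \<subseteq> {T. T \<subseteq> N - S \<and> card T = d - card S \<and> card S \<le> d}"
    using fS assms by (auto simp: card_Diff_subset intro!: card_mono intro: finite_subset)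
qed auto

text \<open>Double counting: a set \<open>I\<close> of size \<open>d\<close> arises from each of its
  \<open>d choose t\<close> subsets \<open>S\<close>.\<close>

lemma level_weight_derivatives:
  fixes F :: "('i \<Rightarrow> 'a) \<Rightarrow> real"
  assumes N: "finite N" and t: "t \<le> d"
  shows "(\<Sum>S | S \<subseteq> N \<and> card S = t. AV N (\<lambda>x. \<Sum>T | T \<subseteq> N - S \<and> card T = d - card S. AV (N - S) (\<lambda>z. (escomp N (S \<union> T) F z)\<^sup>2) x) x)
    = real (d choose t) * level_weight N d F x"
proof -
  define w where "w = (\<lambda>I. AV N (\<lambda>z. (escomp N I F z)\<^sup>2) x)"
  have fin: "finite {I. I \<subseteq> N \<and> P I}" for P using N by simp
  have a: "AV N (\<lambda>x. \<Sum>T | T \<subseteq> N - S \<and> card T = d - card S. AV (N - S) (\<lambda>z. (escomp N (S \<union> T) F z)\<^sup>2) x) x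
     = (\<Sum>I | I \<subseteq> N \<and> card I = d \<and> S \<subseteq> I. w I)" if S: "S \<subseteq> N" "card S = t" for S
  proof -
    have absorb: "AV N (AV (N - S) G) = AV N G" for G :: "('i \<Rightarrow> 'a) \<Rightarrow> real"
    proof -
      have "AV N (AV (N - S) G) = AV S (AV (N - S) (AV (N - S) G))"
        using N S AV_Un[of S "N - S" "AV (N - S) G"] by (simp add: finite_subset Un_absorb1)
      also have "AV (N - S) (AV (N - S) G) = AV (N - S) G"
        using N by (intro AV_indep_const) (auto simp: av_AV_in)
      also have "AV S (AV (N - S) G) = AV N G"
        using N S AV_Un[of S "N - S" G] by (simp add: finite_subset Un_absorb1)
      finally show ?thesis .
    qed
    have "AV N (\<lambda>x. \<Sum>T | T \<subseteq> N - S \<and> card T = d - card S. AV (N - S) (\<lambda>z. (escomp N (S \<union> T) F z)\<^sup>2) x) x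
      = (\<Sum>T | T \<subseteq> N - S \<and> card T = d - card S \<and> card S \<le> d. w (S \<union> T))"
      using t S by (simp add: AV_sum absorb w_def)
    also have "\<dots> = (\<Sum>I | I \<subseteq> N \<and> card I = d \<and> S \<subseteq> I. w I)"
      using sum.reindex_bij_betw[OF card_supersets[OF N S(1), of d], of w] by simp
    finally show ?thesis .
  qed
  have "(\<Sum>S | S \<subseteq> N \<and> card S = t. AV N (\<lambda>x. \<Sum>T | T \<subseteq> N - S \<and> card T = d - card S. AV (N - S) (\<lambda>z. (escomp N (S \<union> T) F z)\<^sup>2) x) x)
     = (\<Sum>S | S \<subseteq> N \<and> card S = t. \<Sum>I | I \<subseteq> N \<and> card I = d \<and> S \<subseteq> I. w I)"
    by (intro sum.cong refl) (use a in auto)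
  also have "\<dots> = (\<Sum>S | S \<subseteq> N \<and> card S = t. \<Sum>I | I \<subseteq> N \<and> card I = d. if S \<subseteq> I then w I else 0)"
    using fin by (intro sum.cong refl sum.mono_neutral_cong_left) auto
  also have "\<dots> = (\<Sum>I | I \<subseteq> N \<and> card I = d. \<Sum>S | S \<subseteq> N \<and> card S = t. if S \<subseteq> I then w I else 0)"
    by (rule sum.swap)
  also have "\<dots> = (\<Sum>I | I \<subseteq> N \<and> card I = d. real (d choose t) * w I)"
  proof (intro sum.cong refl)
    fix I assume I: "I \<in> {I. I \<subseteq> N \<and> card I = d}"
    then have fI: "finite I" using N finite_subset by auto
    have "(\<Sum>S | S \<subseteq> N \<and> card S = t. if S \<subseteq> I then w I else 0) = (\<Sum>S | S \<subseteq> I \<and> card S = t. w I)"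
      using fin I by (intro sum.mono_neutral_cong_right) auto
    also have "\<dots> = real (d choose t) * w I" using n_subsets[OF fI, of t] I by simp
    finally show "(\<Sum>S | S \<subseteq> N \<and> card S = t. if S \<subseteq> I then w I else 0) = real (d choose t) * w I" .
  qed
  also have "\<dots> = real (d choose t) * level_weight N d F x"
    by (simp add: level_weight_def w_def sum_distrib_left)
  finally show ?thesis .
qed

text \<open>For homogeneous \<open>G\<close> only \<open>T\<close> with
  \<open>card S + card T = d\<close> survive. Of the \<open>k\<close> equal factors for a given
  \<open>S\<close>, \<open>k - 1\<close> are bounded by \<open>\<Lambda>\<close> and the last one is
  averaged, which turns the sum over \<open>S\<close> into a multiple of the level weight. The bound
  is demanded only at points agreeing with \<open>x\<close> outside \<open>N\<close>, because for
  \<open>S = {}\<close> it will be the level weight at \<open>x\<close> itself.\<close>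

lemma hypercontractive_pure:
  assumes N: "finite N" and k: "k \<ge> 1"
    and \<Lambda>: "\<And>S y. S \<subseteq> N \<Longrightarrow> card S \<le> d \<Longrightarrow> (\<And>i. i \<notin> N \<Longrightarrow> y i = x i) \<Longrightarrow>
       (\<Sum>T | T \<subseteq> N - S \<and> card T = d - card S. AV (N - S) (\<lambda>z. (escomp N (S \<union> T) F z)\<^sup>2) y) \<le> \<Lambda> (card S)"
    and \<Lambda>0: "\<And>t. \<Lambda> t \<ge> 0"
  defines "G \<equiv> (\<lambda>x. \<Sum>I | I \<subseteq> N \<and> card I = d. escomp N I F x)"
  shows "AV N (\<lambda>x. G x ^ (2 * k)) x \<le> (\<Sum>t\<le>d. real (d choose t) *
     (real ((3 * k) ^ (2 * k)) ^ t * (4 * k) ^ ((d - t) * k) * \<Lambda> t ^ (k - 1) * level_weight N d F x))"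
proof -
  define b where "b = real ((3 * k) ^ (2 * k))"
  define c where "c = real (4 * k)"
  define D where "D = (\<lambda>S x. \<Sum>T | T \<subseteq> N - S \<and> card T = d - card S. AV (N - S) (\<lambda>z. (escomp N (S \<union> T) F z)\<^sup>2) x)"
  have fin: "finite {I. I \<subseteq> N \<and> P I}" for P using N by simp
  have D0: "D S x \<ge> 0" for S x unfolding D_def by (intro sum_nonneg AV_nonneg) auto
  have G: "escomp N U G z = (if card U = d then escomp N U F z else 0)" if U: "U \<subseteq> N" for U z
  proof -
    have "escomp N U (escomp N I F) z = (if U = I then escomp N I F z else 0)" if I: "I \<subseteq> N" for I
      using escomp_pure[OF N U, of I "escomp N I F" z] I N
      by (auto simp: av_escomp_in av_escomp_out Int_absorb1)
    then have "escomp N U G z = (\<Sum>I | I \<subseteq> N \<and> card I = d. if U = I then escomp N I F z else 0)"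
      unfolding G_def escomp_sum by (intro sum.cong refl) auto
    then show ?thesis using fin U by simp
  qed
  have inner: "(\<Sum>T\<in>Pow (N - S). c ^ card T * AV (N - S) (\<lambda>z. (escomp N (S \<union> T) G z)\<^sup>2) x)
     = (if card S \<le> d then c ^ (d - card S) * D S x else 0)" if S: "S \<subseteq> N" for S x
  proof -
    have cU: "card (S \<union> T) = card S + card T" "S \<union> T \<subseteq> N" if "T \<subseteq> N - S" for T
      using that S N by (auto intro!: card_Un_disjoint intro: finite_subset)
    have "(\<Sum>T\<in>Pow (N - S). c ^ card T * AV (N - S) (\<lambda>z. (escomp N (S \<union> T) G z)\<^sup>2) x)
       = (\<Sum>T\<in>Pow (N - S). if card S + card T = d then c ^ card T * AV (N - S) (\<lambda>z. (escomp N (S \<union> T) F z)\<^sup>2) x else 0)"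
    proof (intro sum.cong refl)
      fix T assume "T \<in> Pow (N - S)"
      then have T: "card (S \<union> T) = card S + card T" "S \<union> T \<subseteq> N" by (simp_all only: cU Pow_iff)
      show "c ^ card T * AV (N - S) (\<lambda>z. (escomp N (S \<union> T) G z)\<^sup>2) x =
          (if card S + card T = d then c ^ card T * AV (N - S) (\<lambda>z. (escomp N (S \<union> T) F z)\<^sup>2) x else 0)"
        unfolding G[OF T(2)] T(1) by simp
    qed
    also have "\<dots> = (\<Sum>T | T \<in> Pow (N - S) \<and> card S + card T = d. c ^ card T * AV (N - S) (\<lambda>z. (escomp N (S \<union> T) F z)\<^sup>2) x)"
      using N by (subst sum.inter_filter[symmetric]) auto
    also have "\<dots> = (if card S \<le> d then c ^ (d - card S) * D S x else 0)"
    proof (cases "card S \<le> d")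
      case True
      then have "{T. T \<in> Pow (N - S) \<and> card S + card T = d} = {T. T \<subseteq> N - S \<and> card T = d - card S}" by auto
      then show ?thesis using True by (simp add: D_def sum_distrib_left)
    next
      case False
      then have "{T. T \<in> Pow (N - S) \<and> card S + card T = d} = {}" by auto
      then show ?thesis using False by (metis (no_types, lifting) sum.empty)
    qed
    finally show ?thesis .
  qed
  have "AV N (\<lambda>x. G x ^ (2 * k)) x \<le> (\<Sum>S\<in>Pow N. b ^ card S *
      AV N (\<lambda>x. (\<Sum>T\<in>Pow (N - S). c ^ card T * AV (N - S) (\<lambda>z. (escomp N (S \<union> T) G z)\<^sup>2) x) ^ k) x)"
    using hypercontractive[OF N k, of G x] by (simp add: b_def c_def)
  also have "\<dots> = (\<Sum>S\<in>Pow N. if card S \<le> d then b ^ card S * AV N (\<lambda>x. (c ^ (d - card S) * D S x) ^ k) x else 0)"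
    using k N by (intro sum.cong refl) (auto simp: inner power_0_left)
  also have "\<dots> \<le> (\<Sum>S\<in>Pow N. if card S \<le> d then b ^ card S * (c ^ ((d - card S) * k) * \<Lambda> (card S) ^ (k - 1) * AV N (D S) x) else 0)"
  proof (rule sum_mono)
    fix S assume S: "S \<in> Pow N"
    show "(if card S \<le> d then b ^ card S * AV N (\<lambda>x. (c ^ (d - card S) * D S x) ^ k) x else 0)
       \<le> (if card S \<le> d then b ^ card S * (c ^ ((d - card S) * k) * \<Lambda> (card S) ^ (k - 1) * AV N (D S) x) else 0)"
    proof (cases "card S \<le> d")
      case True
      have "AV N (\<lambda>x. (c ^ (d - card S) * D S x) ^ k) x \<le> AV N (\<lambda>x. c ^ ((d - card S) * k) * \<Lambda> (card S) ^ (k - 1) * D S x) x"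
      proof (rule AV_mono_on)
        fix y assume y: "\<And>i. i \<notin> N \<Longrightarrow> y i = x i"
        have "D S y ^ k = D S y ^ (k - 1) * D S y" using k by (simp add: power_eq_if)
        also have "\<dots> \<le> \<Lambda> (card S) ^ (k - 1) * D S y"
          using \<Lambda>[of S y, OF _ True y] S D0 by (intro mult_right_mono power_mono) (auto simp: D_def)
        finally have "c ^ ((d - card S) * k) * D S y ^ k \<le> c ^ ((d - card S) * k) * (\<Lambda> (card S) ^ (k - 1) * D S y)"
          by (intro mult_left_mono) (auto simp: c_def)
        then show "(c ^ (d - card S) * D S y) ^ k \<le> c ^ ((d - card S) * k) * \<Lambda> (card S) ^ (k - 1) * D S y"
          by (simp add: power_mult_distrib power_mult mult.assoc)
      qed
      then have "b ^ card S * AV N (\<lambda>x. (c ^ (d - card S) * D S x) ^ k) x \<le> b ^ card S * AV N (\<lambda>x. c ^ ((d - card S) * k) * \<Lambda> (card S) ^ (k - 1) * D S x) x"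
        by (intro mult_left_mono) (auto simp: b_def)
      then show ?thesis using True by (simp only: AV_cmult if_True)
    qed simp
  qed
  also have "\<dots> = (\<Sum>t\<le>d. \<Sum>S | S \<subseteq> N \<and> card S = t. b ^ t * (c ^ ((d - t) * k) * \<Lambda> t ^ (k - 1) * AV N (D S) x))"
  proof -
    have "(\<Sum>S\<in>Pow N. if card S \<le> d then b ^ card S * (c ^ ((d - card S) * k) * \<Lambda> (card S) ^ (k - 1) * AV N (D S) x) else 0)
      = (\<Sum>S | S \<subseteq> N \<and> card S \<le> d. b ^ card S * (c ^ ((d - card S) * k) * \<Lambda> (card S) ^ (k - 1) * AV N (D S) x))"
      using N by (subst sum.inter_filter[symmetric]) (auto intro!: sum.cong)
    also have "\<dots> = (\<Sum>t\<le>d. \<Sum>S | S \<in> {S. S \<subseteq> N \<and> card S \<le> d} \<and> card S = t. b ^ card S * (c ^ ((d - card S) * k) * \<Lambda> (card S) ^ (k - 1) * AV N (D S) x))"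
      using fin by (intro sum.group[symmetric]) auto
    also have "\<dots> = (\<Sum>t\<le>d. \<Sum>S | S \<subseteq> N \<and> card S = t. b ^ t * (c ^ ((d - t) * k) * \<Lambda> t ^ (k - 1) * AV N (D S) x))"
      by (intro sum.cong refl) auto
    finally show ?thesis .
  qed
  also have "\<dots> = (\<Sum>t\<le>d. real (d choose t) * (b ^ t * c ^ ((d - t) * k) * \<Lambda> t ^ (k - 1) * level_weight N d F x))"
  proof (intro sum.cong refl)
    fix t assume "t \<in> {..d}"
    then have "(\<Sum>S | S \<subseteq> N \<and> card S = t. AV N (D S) x) = real (d choose t) * level_weight N d F x"
      using level_weight_derivatives[OF N, of t d F x] by (simp add: D_def)
    then show "(\<Sum>S | S \<subseteq> N \<and> card S = t. b ^ t * (c ^ ((d - t) * k) * \<Lambda> t ^ (k - 1) * AV N (D S) x))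
       = real (d choose t) * (b ^ t * c ^ ((d - t) * k) * \<Lambda> t ^ (k - 1) * level_weight N d F x)"
      unfolding sum_distrib_left[symmetric] by (simp only: mult_ac)
  qed
  finally show ?thesis by (simp add: b_def c_def)
qed

lemma level_weight_pairing:
  assumes N: "finite N"
  shows "AV N (\<lambda>x. F x * (\<Sum>I | I \<subseteq> N \<and> card I = d. escomp N I F x)) x = level_weight N d F x"
proof -
  have "AV N (\<lambda>x. F x * (\<Sum>I | I \<subseteq> N \<and> card I = d. escomp N I F x)) x
     = (\<Sum>I | I \<subseteq> N \<and> card I = d. AV N (\<lambda>x. F x * escomp N I F x) x)"
    by (simp add: sum_distrib_left AV_sum)
  also have "\<dots> = (\<Sum>I | I \<subseteq> N \<and> card I = d. AV N (\<lambda>x. escomp N I F x * escomp N I F x) x)"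
    by (intro sum.cong refl AV_mult_pure) (use N in \<open>auto simp: av_escomp_in av_escomp_out\<close>)
  finally show ?thesis by (simp add: level_weight_def power2_eq_square)
qed

theorem product_level_inequality:
  assumes "finite N" "r \<ge> 1" "\<gamma>1 > 0" "\<gamma>2 = \<gamma>1 * exp L" "4 * real d \<le> L"
    and "product_biglobal N r \<gamma>1 \<gamma>2 d F"
  shows "level_weight N d F x \<le> \<gamma>1\<^sup>2 * (10 ^ 4 * r\<^sup>2 * L / d) ^ d"
  using assms
proof (induction d arbitrary: N \<gamma>1 \<gamma>2 x rule: less_induct)
  case (less d)
  note N = less.prems(1) and r = less.prems(2) and \<gamma>1 = less.prems(3) and \<gamma>2 = less.prems(4)
    and L = less.prems(5) and glob = less.prems(6)
  have one: "AV N (\<lambda>z. \<bar>F z\<bar>) x \<le> \<gamma>1" and two: "AV N (\<lambda>z. (F z)\<^sup>2) x \<le> \<gamma>2\<^sup>2"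
    using glob unfolding product_biglobal_def by (metis Diff_empty card.empty empty_subsetI le0 mult_1 power_0)+
  show ?case
  proof (cases "d = 0")
    case True
    have sub: "{I. I \<subseteq> N \<and> card I = 0} = {{}}" using N finite_subset by fastforce
    have e: "escomp N {} F = AV N F" by (rule ext) (simp add: escomp_def)
    have "av i (AV N F) = AV N F" if "i \<in> N" for i using N that by (rule av_AV_in)
    then have "AV N (\<lambda>z. (AV N F z)\<^sup>2) = (\<lambda>z. (AV N F z)\<^sup>2)"
      using N by (intro AV_indep_const av_indep_fun[where \<phi> = "\<lambda>y. y\<^sup>2"]) auto
    then have "level_weight N d F x = (AV N F x)\<^sup>2" by (simp add: level_weight_def True sub e)
    also have "\<dots> \<le> \<gamma>1\<^sup>2" using AV_abs[of N F x] one by (intro power2_le_iff_abs_le[THEN iffD2]) (use \<gamma>1 in auto)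
    finally show ?thesis using True by simp
  next
    case False
    define k where "k = nat \<lceil>L / d\<rceil>"
    define V where "V = level_weight N d F x"
    \<comment> \<open>For \<open>t = 0\<close> the induction hypothesis would be the claim itself,
      so the bound is \<open>V\<close>. For \<open>t > 0\<close>, \<open>4 ^ t\<close> comes from
      \<open>t\<close> differences and \<open>r ^ (2 * t)\<close> from restricting \<open>t\<close>
      coordinates.\<close>
    define \<Lambda> where "\<Lambda> = (\<lambda>t. if t = 0 then V else 4 ^ t * r ^ (2 * t) * \<gamma>1\<^sup>2 * (10 ^ 4 * r\<^sup>2 * L / real (d - t)) ^ (d - t))"
    have k: "k \<ge> 1" using False L by (simp add: k_def Suc_le_eq field_simps)
    have V0: "V \<ge> 0" unfolding V_def level_weight_def by (intro sum_nonneg AV_nonneg) auto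
    have \<Lambda>0: "\<Lambda> t \<ge> 0" for t using V0 r L by (simp add: \<Lambda>_def)
    define G where "G = (\<lambda>x. \<Sum>I | I \<subseteq> N \<and> card I = d. escomp N I F x)"
    have V_const: "level_weight N d F y = V" if "\<And>i. i \<notin> N \<Longrightarrow> y i = x i" for y
    proof -
      have "override_on y z N = override_on x z N" for z using that by (auto simp: override_on_def)
      then show ?thesis by (simp add: V_def level_weight_def AV_def)
    qed
    have hyp: "AV N (\<lambda>x. G x ^ (2 * k)) x \<le> (\<Sum>t\<le>d. real (d choose t) *
       (real ((3 * k) ^ (2 * k)) ^ t * (4 * k) ^ ((d - t) * k) * \<Lambda> t ^ (k - 1) * V))"
      unfolding V_def G_def
    proof (rule hypercontractive_pure[OF N k])
      fix S y assume S: "S \<subseteq> N" "card S \<le> d" and y: "\<And>i. i \<notin> N \<Longrightarrow> y i = x i"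
      have fS: "finite S" using S N finite_subset by auto
      show "(\<Sum>T | T \<subseteq> N - S \<and> card T = d - card S. AV (N - S) (\<lambda>z. (escomp N (S \<union> T) F z)\<^sup>2) y) \<le> \<Lambda> (card S)"
      proof (cases "card S = 0")
        case True
        then show ?thesis using fS V_const[OF y] by (simp add: \<Lambda>_def level_weight_def)
      next
        case S0: False
        let ?t = "card S"
        have "(\<Sum>T | T \<subseteq> N - S \<and> card T = d - ?t. AV (N - S) (\<lambda>z. (escomp N (S \<union> T) F z)\<^sup>2) y)
          = (\<Sum>T | T \<subseteq> N - S \<and> card T = d - ?t. AV (N - S) (\<lambda>z. (escomp S S (escomp (N - S) T F) z)\<^sup>2) y)"
        proof (intro sum.cong refl)
          fix T assume "T \<in> {T. T \<subseteq> N - S \<and> card T = d - ?t}"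
          then have "escomp (S \<union> (N - S)) (S \<union> T) F = escomp S S (escomp (N - S) T F)"
            using fS N by (intro escomp_split) auto
          moreover have "S \<union> (N - S) = N" using S by auto
          ultimately show "AV (N - S) (\<lambda>z. (escomp N (S \<union> T) F z)\<^sup>2) y = AV (N - S) (\<lambda>z. (escomp S S (escomp (N - S) T F) z)\<^sup>2) y"
            by simp
        qed
        also have "\<dots> \<le> 4 ^ ?t * ((r ^ ?t * \<gamma>1)\<^sup>2 * (10 ^ 4 * r\<^sup>2 * L / (d - ?t)) ^ (d - ?t))"
        proof (rule AV_escomp_diff_bound)
          fix x
          have "level_weight (N - S) (d - ?t) F x \<le> (r ^ ?t * \<gamma>1)\<^sup>2 * (10 ^ 4 * r\<^sup>2 * L / (d - ?t)) ^ (d - ?t)"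
          proof (rule less.IH[OF _ _ r _ _ _ product_biglobal_restrict[OF glob N S]])
            show "r ^ ?t * \<gamma>2 = r ^ ?t * \<gamma>1 * exp L" by (simp add: \<gamma>2)
          qed (use S0 S N r \<gamma>1 L in auto)
          then show "(\<Sum>T | T \<subseteq> N - S \<and> card T = d - ?t. AV (N - S) (\<lambda>z. (escomp (N - S) T F z)\<^sup>2) x)
             \<le> (r ^ ?t * \<gamma>1)\<^sup>2 * (10 ^ 4 * r\<^sup>2 * L / (d - ?t)) ^ (d - ?t)"
            by (simp add: level_weight_def)
        qed (use fS N in auto)
        also have "\<dots> = \<Lambda> ?t"
          using S0 by (simp add: \<Lambda>_def power_mult_distrib power_mult[symmetric] mult.commute[of 2])
        finally show ?thesis .
      qed
    qed (rule \<Lambda>0)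
    have "V ^ (2 * k) = (AV N (\<lambda>z. F z * G z) x) ^ (2 * k)"
      using level_weight_pairing[OF N, of F d x] by (simp add: V_def G_def)
    also have "\<dots> \<le> (AV N (\<lambda>z. \<bar>F z\<bar>) x) ^ (2 * k - 2) * AV N (\<lambda>z. (F z)\<^sup>2) x * AV N (\<lambda>z. G z ^ (2 * k)) x"
      by (rule AV_hoelder[OF k])
    also have "\<dots> \<le> \<gamma>1 ^ (2 * k - 2) * \<gamma>2\<^sup>2 * AV N (\<lambda>z. G z ^ (2 * k)) x"
      using one two \<gamma>1 by (intro mult_right_mono mult_mono power_mono AV_nonneg) (auto simp: power_mult)
    also have "\<gamma>1 ^ (2 * k - 2) * \<gamma>2\<^sup>2 = \<gamma>1 ^ (2 * k) * exp (2 * L)"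
    proof -
      obtain j where "k = Suc j" using k by (cases k) auto
      then show ?thesis by (simp add: \<gamma>2 power_mult_distrib power2_eq_square exp_add[symmetric] mult_ac)
    qed
    also have "\<dots> * AV N (\<lambda>z. G z ^ (2 * k)) x \<le> \<dots> * (\<Sum>t\<le>d. real (d choose t) *
       (real ((3 * k) ^ (2 * k)) ^ t * (4 * k) ^ ((d - t) * k) * \<Lambda> t ^ (k - 1) * V))"
      using \<gamma>1 by (intro mult_left_mono hyp) auto
    finally have "V ^ (2 * k) \<le> \<gamma>1 ^ (2 * k) * exp (2 * L) * (\<Sum>t\<le>d. real (d choose t) *
       (real ((3 * k) ^ (2 * k)) ^ t * (4 * k) ^ ((d - t) * k) * \<Lambda> t ^ (k - 1) * V))" .
    then show ?thesis unfolding V_def[symmetric]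
      by (intro level_bound_arith[where \<Lambda> = \<Lambda> and k = k])
         (use False L r \<gamma>1 k_def in \<open>auto simp: \<Lambda>_def\<close>)
  qed
qed

end

section \<open>Functions of bounded degree on the symmetric group\<close>

definition fixing :: "nat \<Rightarrow> nat set \<Rightarrow> (nat \<Rightarrow> nat) set" where
  "fixing n I = {\<phi>. \<phi> permutes {1..n} - I}"

definition group_avg :: "(nat \<Rightarrow> nat) set \<Rightarrow> ((nat \<Rightarrow> nat) \<Rightarrow> real) \<Rightarrow> (nat \<Rightarrow> nat) \<Rightarrow> real" where
  "group_avg H g \<sigma> = (\<Sum>\<phi>\<in>H. g (\<sigma> \<circ> \<phi>)) / card H"

text \<open>As a function on \<open>Sym n\<close>, \<open>cond n I g\<close> is the conditional expectation of \<open>g\<close> given the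
  values on \<open>I\<close>.\<close>

abbreviation cond :: "nat \<Rightarrow> nat set \<Rightarrow> ((nat \<Rightarrow> nat) \<Rightarrow> real) \<Rightarrow> (nat \<Rightarrow> nat) \<Rightarrow> real" where
  "cond n I \<equiv> group_avg (fixing n I)"

definition perm_group :: "nat \<Rightarrow> (nat \<Rightarrow> nat) set \<Rightarrow> bool" where
  "perm_group n H \<longleftrightarrow> H \<subseteq> Sym n \<and> id \<in> H \<and> (\<forall>\<pi>\<in>H. \<forall>\<psi>\<in>H. \<pi> \<circ> \<psi> \<in> H) \<and> (\<forall>\<pi>\<in>H. inv \<pi> \<in> H)"

section \<open>Permutations, pointwise stabilisers and the inner product\<close>

lemma Sym_iff: "\<sigma> \<in> Sym n \<longleftrightarrow> \<sigma> permutes {1..n}" by (simp add: Sym_def)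
lemma finite_Sym [simp]: "finite (Sym n)" unfolding Sym_def by (rule finite_permutations) simp
lemma id_Sym [simp]: "id \<in> Sym n" by (simp add: Sym_iff permutes_id)
lemma Sym_nonempty [simp]: "Sym n \<noteq> {}" using id_Sym by blast
lemma card_Sym: "card (Sym n) = fact n" unfolding Sym_def by (rule card_permutations) auto
lemma Sym_comp: "\<sigma> \<in> Sym n \<Longrightarrow> \<rho> \<in> Sym n \<Longrightarrow> \<sigma> \<circ> \<rho> \<in> Sym n" by (simp add: Sym_iff permutes_compose)
lemma Sym_inv: "\<sigma> \<in> Sym n \<Longrightarrow> inv \<sigma> \<in> Sym n" by (simp add: Sym_iff permutes_inv)

lemma finite_fixing [simp]: "finite (fixing n I)" unfolding fixing_def by (rule finite_permutations) simp
lemma id_fixing [simp]: "id \<in> fixing n I" by (simp add: fixing_def permutes_id)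
lemma fixing_Sym: "\<phi> \<in> fixing n I \<Longrightarrow> \<phi> \<in> Sym n"
  by (auto simp: fixing_def Sym_iff intro: permutes_subset)
lemma fixing_iff: "\<phi> \<in> fixing n I \<longleftrightarrow> \<phi> \<in> Sym n \<and> (\<forall>i\<in>I. \<phi> i = i)"
proof
  assume a: "\<phi> \<in> Sym n \<and> (\<forall>i\<in>I. \<phi> i = i)"
  then have "\<phi> permutes {1..n}" by (simp add: Sym_iff)
  then have "\<phi> permutes {1..n} - I"
    by (rule permutes_superset) (use a in blast)
  then show "\<phi> \<in> fixing n I" by (simp add: fixing_def)
next
  assume "\<phi> \<in> fixing n I"
  then show "\<phi> \<in> Sym n \<and> (\<forall>i\<in>I. \<phi> i = i)"
    using fixing_Sym[of \<phi> n I] permutes_not_in[of \<phi> "{1..n} - I"] by (auto simp: fixing_def)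
qed
lemma fixing_comp: "\<phi> \<in> fixing n I \<Longrightarrow> \<psi> \<in> fixing n I \<Longrightarrow> \<phi> \<circ> \<psi> \<in> fixing n I"
  by (simp add: fixing_def permutes_compose)
lemma fixing_inv: "\<phi> \<in> fixing n I \<Longrightarrow> inv \<phi> \<in> fixing n I"
  by (simp add: fixing_def permutes_inv)
lemma card_fixing: "I \<subseteq> {1..n} \<Longrightarrow> card (fixing n I) = fact (n - card I)"
  unfolding fixing_def by (rule card_permutations) (auto simp: card_Diff_subset finite_subset[of I "{1..n}"])
lemma card_fixing_pos: "card (fixing n I) > 0"
  using id_fixing[of n I] by (metis card_gt_0_iff empty_iff finite_fixing)

lemma fixing_nonempty [simp]: "fixing n I \<noteq> {}" using id_fixing by blast
lemma Sym_inv_inv: "\<sigma> \<in> Sym n \<Longrightarrow> inv (inv \<sigma>) = \<sigma>" by (simp add: Sym_iff permutes_inv_inv)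

lemma Sym_inv_comp [simp]: "\<sigma> \<in> Sym n \<Longrightarrow> inv \<sigma> \<circ> \<sigma> = id" "\<sigma> \<in> Sym n \<Longrightarrow> \<sigma> \<circ> inv \<sigma> = id"
  by (simp_all add: Sym_iff permutes_inv_o)

lemma sum_right_translate:
  assumes "\<And>\<pi>. \<pi> \<in> T \<Longrightarrow> \<pi> \<circ> \<rho> \<in> T" "\<And>\<pi>. \<pi> \<in> T \<Longrightarrow> \<pi> \<circ> inv \<rho> \<in> T" "\<rho> \<in> Sym n"
  shows "(\<Sum>\<pi>\<in>T. f (\<pi> \<circ> \<rho>)) = (\<Sum>\<pi>\<in>T. f \<pi>)"
  by (rule sum.reindex_bij_witness[of _ "\<lambda>\<pi>. \<pi> \<circ> inv \<rho>" "\<lambda>\<pi>. \<pi> \<circ> \<rho>"])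
     (use assms in \<open>auto simp: comp_assoc\<close>)

lemma sum_Sym_right: "\<rho> \<in> Sym n \<Longrightarrow> (\<Sum>\<sigma>\<in>Sym n. f (\<sigma> \<circ> \<rho>)) = (\<Sum>\<sigma>\<in>Sym n. f \<sigma>)"
  by (rule sum_right_translate[of _ _ n]) (auto intro: Sym_comp Sym_inv)

lemma ip_eq: "ip n f g = (\<Sum>\<sigma>\<in>Sym n. f \<sigma> * g \<sigma>) / card (Sym n)"
  unfolding ip_def E_unif_def by (rule integral_pmf_of_set) simp_all

lemma ip_commute: "ip n f g = ip n g f" by (simp add: ip_eq mult.commute)
lemma ip_cong: "(\<And>\<sigma>. \<sigma> \<in> Sym n \<Longrightarrow> f \<sigma> = f' \<sigma>) \<Longrightarrow> (\<And>\<sigma>. \<sigma> \<in> Sym n \<Longrightarrow> g \<sigma> = g' \<sigma>) \<Longrightarrow> ip n f g = ip n f' g'"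
  by (simp add: ip_eq cong: sum.cong)
lemma ip_add_right: "ip n f (\<lambda>\<sigma>. g \<sigma> + h \<sigma>) = ip n f g + ip n f h"
  by (simp add: ip_eq distrib_left sum.distrib add_divide_distrib)
lemma ip_diff_right: "ip n f (\<lambda>\<sigma>. g \<sigma> - h \<sigma>) = ip n f g - ip n f h"
  by (simp add: ip_eq right_diff_distrib sum_subtractf diff_divide_distrib)
lemma ip_cmult_right: "ip n f (\<lambda>\<sigma>. c * g \<sigma>) = c * ip n f g"
  by (simp add: ip_eq sum_distrib_left mult.left_commute)
lemma ip_divide_right: "ip n f (\<lambda>\<sigma>. g \<sigma> / c) = ip n f g / c"
  using ip_cmult_right[of n f "1 / c" g] by simp
lemma ip_sum_right: "ip n f (\<lambda>\<sigma>. \<Sum>t\<in>T. g t \<sigma>) = (\<Sum>t\<in>T. ip n f (g t))"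
  unfolding ip_eq sum_distrib_left by (subst sum.swap) (simp add: sum_divide_distrib)
lemma ip_diff_left: "ip n (\<lambda>\<sigma>. g \<sigma> - h \<sigma>) f = ip n g f - ip n h f"
  by (simp only: ip_commute[of n _ f] ip_diff_right)
lemma ip_cmult_left: "ip n (\<lambda>\<sigma>. c * g \<sigma>) f = c * ip n g f"
  by (simp only: ip_commute[of n _ f] ip_cmult_right)
lemma ip_sum_left: "ip n (\<lambda>\<sigma>. \<Sum>t\<in>T. g t \<sigma>) f = (\<Sum>t\<in>T. ip n (g t) f)"
  by (simp only: ip_commute[of n _ f] ip_sum_right)
lemma ip_ge_0: "ip n f f \<ge> 0" by (simp add: ip_eq sum_nonneg)
lemma ip_eq_0_iff: "ip n f f = 0 \<longleftrightarrow> (\<forall>\<sigma>\<in>Sym n. f \<sigma> = 0)"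
  by (simp add: ip_eq sum_nonneg_eq_0_iff)
lemma ip_zero_right [simp]: "ip n f (\<lambda>\<sigma>. 0) = 0" by (simp add: ip_eq)
lemma ip_translate: "\<rho> \<in> Sym n \<Longrightarrow> ip n (\<lambda>\<sigma>. f (\<sigma> \<circ> \<rho>)) (\<lambda>\<sigma>. g (\<sigma> \<circ> \<rho>)) = ip n f g"
  using sum_Sym_right[of \<rho> n "\<lambda>\<sigma>. f \<sigma> * g \<sigma>"] by (simp add: ip_eq)

text \<open>Gram-Schmidt by induction on \<open>A\<close>, with no independence assumed: if the
  residue \<open>v\<close> of the new vector has norm 0, its coefficient \<open>t\<close> is 0. It
  serves both for the projections to bounded degree and for the surjectivity of the level
  operator.\<close>

lemma ip_orth_exists:
  fixes \<phi> :: "'m \<Rightarrow> (nat \<Rightarrow> nat) \<Rightarrow> real"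
  assumes "finite A"
  shows "\<exists>c. \<forall>a\<in>A. ip n (\<lambda>\<sigma>. f \<sigma> - (\<Sum>m\<in>A. c m * \<phi> m \<sigma>)) (\<phi> a) = 0"
  using assms
proof (induction A arbitrary: f rule: finite_induct)
  case (insert b A)
  obtain c where c: "\<And>a. a \<in> A \<Longrightarrow> ip n (\<lambda>\<sigma>. f \<sigma> - (\<Sum>m\<in>A. c m * \<phi> m \<sigma>)) (\<phi> a) = 0"
    using insert.IH[of f] by auto
  obtain e where e: "\<And>a. a \<in> A \<Longrightarrow> ip n (\<lambda>\<sigma>. \<phi> b \<sigma> - (\<Sum>m\<in>A. e m * \<phi> m \<sigma>)) (\<phi> a) = 0"
    using insert.IH[of "\<phi> b"] by auto
  define u where "u = (\<lambda>\<sigma>. f \<sigma> - (\<Sum>m\<in>A. c m * \<phi> m \<sigma>))"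
  define v where "v = (\<lambda>\<sigma>. \<phi> b \<sigma> - (\<Sum>m\<in>A. e m * \<phi> m \<sigma>))"
  define t where "t = (if ip n v v = 0 then 0 else ip n u v / ip n v v)"
  define c' where "c' = (\<lambda>m. if m = b then t else c m - t * e m)"
  have r: "(\<lambda>\<sigma>. f \<sigma> - (\<Sum>m\<in>insert b A. c' m * \<phi> m \<sigma>)) = (\<lambda>\<sigma>. u \<sigma> - t * v \<sigma>)"
  proof
    fix \<sigma>
    have "(\<Sum>m\<in>A. c' m * \<phi> m \<sigma>) = (\<Sum>m\<in>A. c m * \<phi> m \<sigma> - t * (e m * \<phi> m \<sigma>))"
      using insert.hyps by (intro sum.cong) (auto simp: c'_def algebra_simps)
    then show "f \<sigma> - (\<Sum>m\<in>insert b A. c' m * \<phi> m \<sigma>) = u \<sigma> - t * v \<sigma>"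
      using insert.hyps by (simp add: u_def v_def c'_def sum_subtractf sum_distrib_left[symmetric] algebra_simps)
  qed
  have uA: "ip n u (\<phi> a) = 0" and vA: "ip n v (\<phi> a) = 0" if "a \<in> A" for a
    using c e that by (simp_all add: u_def v_def)
  have A: "ip n (\<lambda>\<sigma>. u \<sigma> - t * v \<sigma>) (\<phi> a) = 0" if "a \<in> A" for a
    using uA vA that by (simp add: ip_diff_left ip_cmult_left)
  have b: "ip n (\<lambda>\<sigma>. u \<sigma> - t * v \<sigma>) (\<phi> b) = 0"
  proof -
    have pb: "\<phi> b = (\<lambda>\<sigma>. v \<sigma> + (\<Sum>m\<in>A. e m * \<phi> m \<sigma>))" by (simp add: v_def)
    have "ip n (\<lambda>\<sigma>. u \<sigma> - t * v \<sigma>) (\<phi> b) = ip n (\<lambda>\<sigma>. u \<sigma> - t * v \<sigma>) v"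
      by (subst pb) (simp add: ip_add_right ip_sum_right ip_cmult_right A)
    also have "\<dots> = ip n u v - t * ip n v v" by (simp add: ip_diff_left ip_cmult_left)
    also have "\<dots> = 0"
    proof (cases "ip n v v = 0")
      case True
      then have "ip n u v = ip n u (\<lambda>\<sigma>. 0)" by (intro ip_cong) (auto simp: ip_eq_0_iff)
      then show ?thesis using True by simp
    qed (simp add: t_def)
    finally show ?thesis .
  qed
  show ?case by (rule exI[of _ c']) (use A b r in auto)
qed simp

section \<open>Averages over subgroups as orthogonal projections\<close>

lemma perm_groupD:
  assumes "perm_group n H"
  shows "finite H" "card H > 0" "\<pi> \<in> H \<Longrightarrow> \<pi> \<in> Sym n"
    "\<pi> \<in> H \<Longrightarrow> \<psi> \<in> H \<Longrightarrow> \<pi> \<circ> \<psi> \<in> H" "\<pi> \<in> H \<Longrightarrow> inv \<pi> \<in> H"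
proof -
  show "finite H" using assms finite_subset[OF _ finite_Sym] by (auto simp: perm_group_def)
  then show "card H > 0" using assms by (auto simp: perm_group_def card_gt_0_iff)
qed (use assms in \<open>auto simp: perm_group_def\<close>)

lemma perm_group_fixing: "perm_group n (fixing n I)"
  by (auto simp: perm_group_def fixing_Sym fixing_comp fixing_inv)

lemma group_avg_selfadjoint:
  assumes H: "perm_group n H" shows "ip n (group_avg H f) g = ip n f (group_avg H g)"
proof -
  note D = perm_groupD[OF H]
  have "ip n (\<lambda>\<sigma>. f (\<sigma> \<circ> \<phi>)) g = ip n f (\<lambda>\<sigma>. g (\<sigma> \<circ> inv \<phi>))" if "\<phi> \<in> H" for \<phi>
    using ip_translate[OF Sym_inv[OF D(3)[OF that]], of "\<lambda>\<sigma>. f (\<sigma> \<circ> \<phi>)" g]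
    by (simp only: comp_assoc Sym_inv_comp(1)[OF D(3)[OF that]] comp_id)
  then have "(\<Sum>\<phi>\<in>H. ip n (\<lambda>\<sigma>. f (\<sigma> \<circ> \<phi>)) g) = (\<Sum>\<phi>\<in>H. ip n f (\<lambda>\<sigma>. g (\<sigma> \<circ> inv \<phi>)))"
    by simp
  also have "\<dots> = (\<Sum>\<phi>\<in>H. ip n f (\<lambda>\<sigma>. g (\<sigma> \<circ> \<phi>)))"
    by (rule sum.reindex_bij_witness[of _ inv inv]) (simp_all add: D(5) Sym_inv_inv[OF D(3)])
  finally have *: "(\<Sum>\<phi>\<in>H. ip n (\<lambda>\<sigma>. f (\<sigma> \<circ> \<phi>)) g) = (\<Sum>\<phi>\<in>H. ip n f (\<lambda>\<sigma>. g (\<sigma> \<circ> \<phi>)))" .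
  show ?thesis
    unfolding ip_commute[of n "group_avg H f"]
    by (simp only: group_avg_def[abs_def] ip_divide_right ip_sum_right ip_commute[of n g] *)
qed

lemma group_avg_invariant:
  assumes "perm_group n H" "\<And>\<phi>. \<phi> \<in> H \<Longrightarrow> g (\<sigma> \<circ> \<phi>) = g \<sigma>"
  shows "group_avg H g \<sigma> = g \<sigma>"
  using assms(2) perm_groupD(2)[OF assms(1)] by (simp add: group_avg_def card_gt_0_iff)

lemma group_avg_translate:
  assumes H: "perm_group n H" and p: "\<phi> \<in> H"
  shows "group_avg H g (\<sigma> \<circ> \<phi>) = group_avg H g \<sigma>"
proof -
  have "(\<Sum>\<psi>\<in>H. g (\<sigma> \<circ> \<phi> \<circ> \<psi>)) = (\<Sum>\<psi>\<in>H. g (\<sigma> \<circ> \<psi>))"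
    by (rule sum.reindex_bij_witness[of _ "\<lambda>\<psi>. inv \<phi> \<circ> \<psi>" "\<lambda>\<psi>. \<phi> \<circ> \<psi>"])
       (use p perm_groupD(3)[OF H p] perm_groupD(4,5)[OF H] in \<open>auto simp: comp_assoc[symmetric]\<close>)
  then show ?thesis by (simp add: group_avg_def)
qed

lemma ip_group_avg:
  assumes H: "perm_group n H"
  shows "ip n (group_avg H f) (group_avg H g) = ip n f (group_avg H g)"
proof -
  have "group_avg H (group_avg H g) = group_avg H g"
    by (intro ext group_avg_invariant[OF H] group_avg_translate[OF H])
  then show ?thesis by (simp add: group_avg_selfadjoint[OF H])
qed

lemma group_avg_absorb:
  assumes H: "perm_group n H" and K: "perm_group n K" "K \<subseteq> H"
  shows "group_avg H (group_avg K g) = group_avg H g"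
proof
  fix \<sigma>
  have "(\<Sum>\<phi>\<in>H. g (\<sigma> \<circ> \<phi> \<circ> \<psi>)) = (\<Sum>\<phi>\<in>H. g (\<sigma> \<circ> \<phi>))" if "\<psi> \<in> K" for \<psi>
    using sum_right_translate[of H \<psi> n "\<lambda>\<pi>. g (\<sigma> \<circ> \<pi>)"] that K perm_groupD(3-5)[OF H]
    by (auto simp: comp_assoc)
  then have "(\<Sum>\<phi>\<in>H. \<Sum>\<psi>\<in>K. g (\<sigma> \<circ> \<phi> \<circ> \<psi>)) = card K * (\<Sum>\<phi>\<in>H. g (\<sigma> \<circ> \<phi>))"
    by (subst sum.swap) simp
  then show "group_avg H (group_avg K g) \<sigma> = group_avg H g \<sigma>"
    using perm_groupD(2)[OF K(1)] by (simp add: group_avg_def sum_divide_distrib[symmetric] card_gt_0_iff)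
qed

lemmas cond_selfadjoint = group_avg_selfadjoint[OF perm_group_fixing]
lemmas ip_cond = ip_group_avg[OF perm_group_fixing]

section \<open>Composition of two conditional expectations\<close>

lemma extend_to_permutation:
  assumes "finite N" "A \<subseteq> N" "inj_on h A" "h ` A \<subseteq> N"
  shows "\<exists>\<tau>. \<tau> permutes N \<and> (\<forall>a\<in>A. \<tau> a = h a)"
proof -
  have "card (N - A) = card (N - h ` A)"
    using assms by (simp add: card_Diff_subset finite_subset card_image)
  then obtain k where k: "bij_betw k (N - A) (N - h ` A)"
    using finite_same_card_bij[of "N - A" "N - h ` A"] assms(1) by auto
  define \<tau> where "\<tau> = (\<lambda>i. if i \<in> A then h i else if i \<in> N then k i else i)"
  have "bij_betw \<tau> (A \<union> (N - A)) (h ` A \<union> (N - h ` A))"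
  proof (rule bij_betw_combine)
    show "bij_betw \<tau> A (h ` A)" using assms(3) by (auto simp: \<tau>_def bij_betw_def inj_on_def)
    show "bij_betw \<tau> (N - A) (N - h ` A)" 
    proof -
      have "bij_betw \<tau> (N - A) (N - h ` A) = bij_betw k (N - A) (N - h ` A)"
        by (rule bij_betw_cong) (simp add: \<tau>_def)
      then show ?thesis using k by simp
    qed
  qed auto
  moreover have "A \<union> (N - A) = N" "h ` A \<union> (N - h ` A) = N" using assms by auto
  ultimately have "\<tau> permutes N" using assms(2) by (intro bij_imp_permutes) (auto simp: \<tau>_def)
  then show ?thesis by (intro exI[of _ \<tau>]) (auto simp: \<tau>_def)
qed

text \<open>\<open>T\<close> is a union of left cosets of \<open>fixing n E\<close>, and each coset
  sum is a multiple of a value of \<open>cond n E g\<close>.\<close>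

lemma sum_cosets_eq_0:
  assumes "finite T" "T \<subseteq> Sym n" "\<And>\<pi> \<phi>. \<pi> \<in> T \<Longrightarrow> \<phi> \<in> fixing n E \<Longrightarrow> \<pi> \<circ> \<phi> \<in> T"
    and "\<And>\<sigma>. \<sigma> \<in> Sym n \<Longrightarrow> cond n E g \<sigma> = 0" and "\<sigma> \<in> Sym n"
  shows "(\<Sum>\<pi>\<in>T. g (\<sigma> \<circ> \<pi>)) = 0"
proof -
  have "(\<Sum>\<pi>\<in>T. g (\<sigma> \<circ> \<pi> \<circ> \<phi>)) = (\<Sum>\<pi>\<in>T. g (\<sigma> \<circ> \<pi>))" if "\<phi> \<in> fixing n E" for \<phi>
    using sum_right_translate[of T \<phi> n "\<lambda>\<pi>. g (\<sigma> \<circ> \<pi>)"] assms(3) that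
    by (simp add: fixing_inv fixing_Sym comp_assoc)
  then have "(\<Sum>\<pi>\<in>T. \<Sum>\<phi>\<in>fixing n E. g (\<sigma> \<circ> \<pi> \<circ> \<phi>)) = card (fixing n E) * (\<Sum>\<pi>\<in>T. g (\<sigma> \<circ> \<pi>))"
    by (subst sum.swap) simp
  moreover have "(\<Sum>\<phi>\<in>fixing n E. g (\<sigma> \<circ> \<pi> \<circ> \<phi>)) = 0" if "\<pi> \<in> T" for \<pi>
    using assms(4)[of "\<sigma> \<circ> \<pi>"] assms(2,5) that card_fixing_pos[of n E] by (auto simp: group_avg_def Sym_comp subset_iff)
  ultimately show ?thesis using card_fixing_pos[of n E] by simp
qed

text \<open>Dropping the condition at one point \<open>b\<close> leaves a union of cosets of the subgroup fixing
  the other points of \<open>C \<union> B\<close>, over which \<open>g\<close> sums to 0; so moving \<open>b\<close> into \<open>X\<close> flips the sign.\<close>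

lemma avoid_flip:
  assumes CB: "C \<inter> B = {}" "C \<union> B \<subseteq> {1..n}" and X: "X \<subseteq> B"
    and kill: "\<And>E \<sigma>. E \<subset> C \<union> B \<Longrightarrow> \<sigma> \<in> Sym n \<Longrightarrow> cond n E g \<sigma> = 0" and \<sigma>: "\<sigma> \<in> Sym n"
  shows "(\<Sum>\<pi> | \<pi> \<in> fixing n C \<and> (\<forall>b\<in>X. \<pi> b \<in> A) \<and> (\<forall>b\<in>B - X. \<pi> b \<notin> A). g (\<sigma> \<circ> \<pi>))
     = (- 1) ^ card X * (\<Sum>\<pi> | \<pi> \<in> fixing n C \<and> (\<forall>b\<in>B. \<pi> b \<notin> A). g (\<sigma> \<circ> \<pi>))"
proof -
  have "finite X" using X CB finite_subset by (metis Un_subset_iff finite_atLeastAtMost)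
  then show ?thesis using X
  proof (induction X rule: finite_induct)
    case (insert b X)
    let ?T = "{\<pi> \<in> fixing n C. (\<forall>b\<in>X. \<pi> b \<in> A) \<and> (\<forall>b\<in>B - insert b X. \<pi> b \<notin> A)}"
    let ?T1 = "{\<pi> \<in> fixing n C. (\<forall>b\<in>insert b X. \<pi> b \<in> A) \<and> (\<forall>b\<in>B - insert b X. \<pi> b \<notin> A)}"
    let ?T2 = "{\<pi> \<in> fixing n C. (\<forall>b\<in>X. \<pi> b \<in> A) \<and> (\<forall>b\<in>B - X. \<pi> b \<notin> A)}"
    have b: "b \<in> B" "b \<notin> C" using insert CB by auto
    have "(\<Sum>\<pi>\<in>?T. g (\<sigma> \<circ> \<pi>)) = 0"
    proof (rule sum_cosets_eq_0[where n = n and E = "C \<union> B - {b}"])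
      show "\<pi> \<circ> \<phi> \<in> ?T" if "\<pi> \<in> ?T" "\<phi> \<in> fixing n (C \<union> B - {b})" for \<pi> \<phi>
      proof -
        have "\<phi> i = i" if "i \<in> C \<or> i \<in> X \<or> i \<in> B - insert b X" for i
          using that \<open>\<phi> \<in> _\<close> insert.hyps insert.prems b by (auto simp: fixing_iff)
        then show ?thesis using that by (auto simp: fixing_iff Sym_comp)
      qed
      show "cond n (C \<union> B - {b}) g \<sigma> = 0" if "\<sigma> \<in> Sym n" for \<sigma>
        using b that by (intro kill) auto
    qed (use \<sigma> in \<open>auto simp: fixing_iff\<close>)
    moreover have "?T = ?T1 \<union> ?T2" "?T1 \<inter> ?T2 = {}" using b insert.hyps by auto
    then have "(\<Sum>\<pi>\<in>?T. g (\<sigma> \<circ> \<pi>)) = (\<Sum>\<pi>\<in>?T1. g (\<sigma> \<circ> \<pi>)) + (\<Sum>\<pi>\<in>?T2. g (\<sigma> \<circ> \<pi>))"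
      by (simp only:) (intro sum.union_disjoint, auto)
    ultimately have "(\<Sum>\<pi>\<in>?T1. g (\<sigma> \<circ> \<pi>)) = - (\<Sum>\<pi>\<in>?T2. g (\<sigma> \<circ> \<pi>))" by linarith
    also have "(\<Sum>\<pi>\<in>?T2. g (\<sigma> \<circ> \<pi>)) = (- 1) ^ card X * (\<Sum>\<pi> | \<pi> \<in> fixing n C \<and> (\<forall>b\<in>B. \<pi> b \<notin> A). g (\<sigma> \<circ> \<pi>))"
      by (rule insert.IH) (use insert.prems in auto)
    finally have F: "(\<Sum>\<pi>\<in>?T1. g (\<sigma> \<circ> \<pi>)) = - ((- 1) ^ card X * (\<Sum>\<pi> | \<pi> \<in> fixing n C \<and> (\<forall>b\<in>B. \<pi> b \<notin> A). g (\<sigma> \<circ> \<pi>)))" .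
    show ?case unfolding F card_insert_disjoint[OF insert.hyps] by (simp add: comp_def)
  qed simp
qed

text \<open>In a factorisation \<open>\<rho>\<close> must fix \<open>I\<close> and agree with
  \<open>\<pi>\<close> on \<open>I'\<close>. The hypotheses on \<open>\<pi>\<close> make this
  prescription injective, so it extends to a permutation \<open>\<rho>0\<close>; the other solutions
  are \<open>\<rho>0 \<circ> \<psi>\<close> with \<open>\<psi>\<close> fixing
  \<open>I \<union> I'\<close>.\<close>

lemma cond_cond_fibre:
  assumes I: "I \<subseteq> {1..n}" "I' \<subseteq> {1..n}" and \<pi>: "\<pi> \<in> fixing n (I \<inter> I')" "\<forall>b\<in>I' - I. \<pi> b \<notin> I - I'"
  shows "card {(\<rho>, \<rho>'). \<rho> \<in> fixing n I \<and> \<rho>' \<in> fixing n I' \<and> \<rho> \<circ> \<rho>' = \<pi>} = fact (n - card (I \<union> I'))"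
proof -
  have pS: "\<pi> \<in> Sym n" using \<pi> fixing_Sym by auto
  have pi_inj: "inj \<pi>" using pS by (simp add: Sym_iff permutes_inj)
  have "\<pi> b \<notin> I" if b: "b \<in> I' - I" for b
  proof
    assume "\<pi> b \<in> I"
    then have "\<pi> b \<in> I \<inter> I'" using \<pi>(2) b by auto
    then have "\<pi> (\<pi> b) = \<pi> b" using \<pi>(1) by (auto simp: fixing_iff)
    then have "\<pi> b = b" using pi_inj by (auto dest: injD)
    then show False using b \<open>\<pi> b \<in> I\<close> by auto
  qed
  moreover have "\<pi> b \<in> {1..n}" if "b \<in> I'" for b
    using pS I(2) that by (auto simp: Sym_iff permutes_in_image simp del: atLeastAtMost_iff)
  ultimately have "\<pi> ` (I' - I) \<subseteq> {1..n} - I" by auto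
  moreover have "I' - I \<subseteq> {1..n} - I" "inj_on \<pi> (I' - I)" using I pi_inj by (auto intro: inj_on_subset)
  ultimately obtain \<rho>0 where r0: "\<rho>0 permutes {1..n} - I" "\<And>b. b \<in> I' - I \<Longrightarrow> \<rho>0 b = \<pi> b"
    using extend_to_permutation[of "{1..n} - I" "I' - I" \<pi>] by auto
  then have r0F: "\<rho>0 \<in> fixing n I" by (simp add: fixing_def)
  have r0S: "\<rho>0 \<in> Sym n" using r0F by (rule fixing_Sym)
  have "bij_betw (\<lambda>\<psi>. (\<rho>0 \<circ> \<psi>, inv (\<rho>0 \<circ> \<psi>) \<circ> \<pi>)) (fixing n (I \<union> I'))
     {(\<rho>, \<rho>'). \<rho> \<in> fixing n I \<and> \<rho>' \<in> fixing n I' \<and> \<rho> \<circ> \<rho>' = \<pi>}"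
  proof (rule bij_betw_byWitness[where f' = "\<lambda>(\<rho>, \<rho>'). inv \<rho>0 \<circ> \<rho>"])
    show "\<forall>\<psi>\<in>fixing n (I \<union> I'). (case (\<rho>0 \<circ> \<psi>, inv (\<rho>0 \<circ> \<psi>) \<circ> \<pi>) of (\<rho>, \<rho>') \<Rightarrow> inv \<rho>0 \<circ> \<rho>) = \<psi>"
      using r0S by (simp add: comp_assoc[symmetric])
    show "(\<lambda>\<psi>. (\<rho>0 \<circ> \<psi>, inv (\<rho>0 \<circ> \<psi>) \<circ> \<pi>)) ` fixing n (I \<union> I') \<subseteq> {(\<rho>, \<rho>'). \<rho> \<in> fixing n I \<and> \<rho>' \<in> fixing n I' \<and> \<rho> \<circ> \<rho>' = \<pi>}"
    proof clarify
      fix \<psi> assume psi: "\<psi> \<in> fixing n (I \<union> I')"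
      then have a: "\<rho>0 \<circ> \<psi> \<in> fixing n I" using r0F by (auto simp: fixing_iff Sym_comp)
      have S: "\<rho>0 \<circ> \<psi> \<in> Sym n" using a by (rule fixing_Sym)
      have "inv (\<rho>0 \<circ> \<psi>) (\<pi> i) = i" if i: "i \<in> I'" for i
      proof -
        have "(\<rho>0 \<circ> \<psi>) i = \<pi> i"
        proof (cases "i \<in> I")
          case True
          then show ?thesis using a \<pi>(1) i by (simp add: fixing_iff)
        next
          case False
          then show ?thesis using psi r0(2) i by (simp add: fixing_iff)
        qed
        then show ?thesis using S by (metis Sym_iff permutes_inverses(2))
      qed
      moreover have "inv (\<rho>0 \<circ> \<psi>) \<circ> \<pi> \<in> Sym n" by (rule Sym_comp[OF Sym_inv[OF S] pS])
      ultimately have "inv (\<rho>0 \<circ> \<psi>) \<circ> \<pi> \<in> fixing n I'" by (simp add: fixing_iff)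
      moreover have "\<rho>0 \<circ> \<psi> \<circ> (inv (\<rho>0 \<circ> \<psi>) \<circ> \<pi>) = \<pi>"
        using Sym_inv_comp(2)[OF S] by (simp only: comp_assoc[symmetric] id_comp)
      ultimately show "\<rho>0 \<circ> \<psi> \<in> fixing n I \<and> inv (\<rho>0 \<circ> \<psi>) \<circ> \<pi> \<in> fixing n I' \<and> \<rho>0 \<circ> \<psi> \<circ> (inv (\<rho>0 \<circ> \<psi>) \<circ> \<pi>) = \<pi>"
        using a by simp
    qed
    show "\<forall>p\<in>{(\<rho>, \<rho>'). \<rho> \<in> fixing n I \<and> \<rho>' \<in> fixing n I' \<and> \<rho> \<circ> \<rho>' = \<pi>}. 
       (\<rho>0 \<circ> (case p of (\<rho>, \<rho>') \<Rightarrow> inv \<rho>0 \<circ> \<rho>), inv (\<rho>0 \<circ> (case p of (\<rho>, \<rho>') \<Rightarrow> inv \<rho>0 \<circ> \<rho>)) \<circ> \<pi>) = p"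
    proof clarify
      fix \<rho> \<rho>' assume a: "\<rho> \<in> fixing n I" "\<rho>' \<in> fixing n I'" "\<pi> = \<rho> \<circ> \<rho>'"
      have e: "\<rho>0 \<circ> (inv \<rho>0 \<circ> \<rho>) = \<rho>" using r0S by (simp add: comp_assoc[symmetric])
      have "inv \<rho> \<circ> (\<rho> \<circ> \<rho>') = \<rho>'" using fixing_Sym[OF a(1)] by (simp add: comp_assoc[symmetric])
      then show "\<rho>0 \<circ> (inv \<rho>0 \<circ> \<rho>) = \<rho> \<and> inv (\<rho>0 \<circ> (inv \<rho>0 \<circ> \<rho>)) \<circ> (\<rho> \<circ> \<rho>') = \<rho>'" by (simp add: e)
    qed
    show "(\<lambda>(\<rho>, \<rho>'). inv \<rho>0 \<circ> \<rho>) ` {(\<rho>, \<rho>'). \<rho> \<in> fixing n I \<and> \<rho>' \<in> fixing n I' \<and> \<rho> \<circ> \<rho>' = \<pi>} \<subseteq> fixing n (I \<union> I')"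
    proof clarify
      fix \<rho> \<rho>' assume a: "\<rho> \<in> fixing n I" "\<rho>' \<in> fixing n I'" "\<pi> = \<rho> \<circ> \<rho>'"
      have "inv \<rho>0 (\<rho> i) = i" if "i \<in> I \<union> I'" for i
      proof -
        have "\<rho> i = \<rho>0 i"
        proof (cases "i \<in> I")
          case True then show ?thesis using a(1) r0F by (simp add: fixing_iff)
        next
          case False
          then have "\<rho>' i = i" "\<rho>0 i = \<pi> i" using a(2) r0(2) that by (auto simp: fixing_iff)
          then show ?thesis using a(3) by simp
        qed
        then show ?thesis using r0S by (simp add: Sym_iff permutes_inverses(2))
      qed
      moreover have "inv \<rho>0 \<circ> \<rho> \<in> Sym n" using r0S fixing_Sym[OF a(1)] by (intro Sym_comp Sym_inv)
      ultimately show "inv \<rho>0 \<circ> \<rho> \<in> fixing n (I \<union> I')" by (simp add: fixing_iff)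
    qed
  qed
  then have "card (fixing n (I \<union> I')) = card {(\<rho>, \<rho>'). \<rho> \<in> fixing n I \<and> \<rho>' \<in> fixing n I' \<and> \<rho> \<circ> \<rho>' = \<pi>}"
    by (rule bij_betw_same_card)
  then show ?thesis using I by (simp add: card_fixing)
qed

text \<open>The products \<open>\<rho> \<circ> \<rho>'\<close> cover evenly the permutations that
  fix \<open>I \<inter> I'\<close> and send no point of \<open>I' - I\<close> into
  \<open>I - I'\<close>. Each of these points can be flipped because proper subsets of
  \<open>I'\<close> have fewer than \<open>d\<close> elements; this trades avoiding for hitting, at
  the price of a sign.\<close>

lemma cond_cond:
  assumes I: "I \<subseteq> {1..n}" "card I = d" and I': "I' \<subseteq> {1..n}" "card I' = d"
    and kill: "\<And>E \<sigma>. E \<subseteq> {1..n} \<Longrightarrow> card E < d \<Longrightarrow> \<sigma> \<in> Sym n \<Longrightarrow> cond n E g \<sigma> = 0" and \<sigma>: "\<sigma> \<in> Sym n"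
  shows "cond n I (cond n I' g) \<sigma> = fact (n - card (I \<union> I')) / (fact (n - d))\<^sup>2 * (- 1) ^ card (I' - I) *
     (\<Sum>\<pi> | \<pi> \<in> fixing n (I \<inter> I') \<and> (\<forall>b\<in>I' - I. \<pi> b \<in> I - I'). g (\<sigma> \<circ> \<pi>))"
proof -
  let ?T = "{\<pi> \<in> fixing n (I \<inter> I'). \<forall>b\<in>I' - I. \<pi> b \<notin> I - I'}"
  let ?h = "\<lambda>p :: (nat \<Rightarrow> nat) \<times> (nat \<Rightarrow> nat). fst p \<circ> snd p"
  have T: "?h ` (fixing n I \<times> fixing n I') \<subseteq> ?T"
  proof clarify
    fix \<rho> \<rho>' assume r: "\<rho> \<in> fixing n I" "\<rho>' \<in> fixing n I'"
    have "\<rho> b \<notin> I" if "b \<notin> I" for b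
    proof
      assume "\<rho> b \<in> I"
      then have "\<rho> (\<rho> b) = \<rho> b" using r by (simp add: fixing_iff)
      moreover have "inj \<rho>" using r by (simp add: fixing_def permutes_inj)
      ultimately have "\<rho> b = b" by (auto dest: injD)
      then show False using that \<open>\<rho> b \<in> I\<close> by simp
    qed
    then show "?h (\<rho>, \<rho>') \<in> fixing n (I \<inter> I') \<and> (\<forall>b\<in>I' - I. ?h (\<rho>, \<rho>') b \<notin> I - I')"
      using r by (auto simp: fixing_iff Sym_comp)
  qed
  have "(\<Sum>\<rho>\<in>fixing n I. \<Sum>\<rho>'\<in>fixing n I'. g (\<sigma> \<circ> \<rho> \<circ> \<rho>')) = (\<Sum>p\<in>fixing n I \<times> fixing n I'. g (\<sigma> \<circ> ?h p))"
    by (simp add: sum.cartesian_product' comp_assoc)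
  also have "\<dots> = (\<Sum>\<pi>\<in>?T. \<Sum>p | p \<in> fixing n I \<times> fixing n I' \<and> ?h p = \<pi>. g (\<sigma> \<circ> ?h p))"
    by (rule sum.group[symmetric]) (use T in auto)
  also have "\<dots> = (\<Sum>\<pi>\<in>?T. fact (n - card (I \<union> I')) * g (\<sigma> \<circ> \<pi>))"
  proof (intro sum.cong refl)
    fix \<pi> assume \<pi>: "\<pi> \<in> ?T"
    have e: "{p. p \<in> fixing n I \<times> fixing n I' \<and> ?h p = \<pi>} = {(\<rho>, \<rho>'). \<rho> \<in> fixing n I \<and> \<rho>' \<in> fixing n I' \<and> \<rho> \<circ> \<rho>' = \<pi>}"
      by auto
    have "(\<Sum>p | p \<in> fixing n I \<times> fixing n I' \<and> ?h p = \<pi>. g (\<sigma> \<circ> ?h p))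
       = (\<Sum>p | p \<in> fixing n I \<times> fixing n I' \<and> ?h p = \<pi>. g (\<sigma> \<circ> \<pi>))" by (intro sum.cong) auto
    then show "(\<Sum>p | p \<in> fixing n I \<times> fixing n I' \<and> ?h p = \<pi>. g (\<sigma> \<circ> ?h p)) = fact (n - card (I \<union> I')) * g (\<sigma> \<circ> \<pi>)"
      using cond_cond_fibre[OF I(1) I'(1), of \<pi>] \<pi> unfolding e by simp
  qed
  also have "\<dots> = fact (n - card (I \<union> I')) * (\<Sum>\<pi>\<in>?T. g (\<sigma> \<circ> \<pi>))" by (simp add: sum_distrib_left)
  also have "(\<Sum>\<pi>\<in>?T. g (\<sigma> \<circ> \<pi>)) = (- 1) ^ card (I' - I) *
     (\<Sum>\<pi> | \<pi> \<in> fixing n (I \<inter> I') \<and> (\<forall>b\<in>I' - I. \<pi> b \<in> I - I'). g (\<sigma> \<circ> \<pi>))"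
  proof -
    have "(\<Sum>\<pi> | \<pi> \<in> fixing n (I \<inter> I') \<and> (\<forall>b\<in>I' - I. \<pi> b \<in> I - I') \<and> (\<forall>b\<in>(I' - I) - (I' - I). \<pi> b \<notin> I - I'). g (\<sigma> \<circ> \<pi>))
       = (- 1) ^ card (I' - I) * (\<Sum>\<pi>\<in>?T. g (\<sigma> \<circ> \<pi>))"
    proof (rule avoid_flip[OF _ _ order_refl _ \<sigma>])
      fix E \<sigma> assume E: "E \<subset> I \<inter> I' \<union> (I' - I)" "\<sigma> \<in> Sym n"
      then have "E \<subset> I'" by auto
      then have "card E < d" using I' by (metis finite_atLeastAtMost finite_subset psubset_card_mono)
      then show "cond n E g \<sigma> = 0" using E I' by (intro kill) auto
    qed (use I' in auto)
    then have "(- 1) ^ card (I' - I) * (\<Sum>\<pi> | \<pi> \<in> fixing n (I \<inter> I') \<and> (\<forall>b\<in>I' - I. \<pi> b \<in> I - I'). g (\<sigma> \<circ> \<pi>))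
      = (- 1) ^ card (I' - I) * ((- 1) ^ card (I' - I) * (\<Sum>\<pi>\<in>?T. g (\<sigma> \<circ> \<pi>)))"
      by simp
    then show ?thesis by (simp add: mult.assoc[symmetric] power_mult_distrib[symmetric])
  qed
  finally have "(\<Sum>\<rho>\<in>fixing n I. \<Sum>\<rho>'\<in>fixing n I'. g (\<sigma> \<circ> \<rho> \<circ> \<rho>')) = fact (n - card (I \<union> I')) * ((- 1) ^ card (I' - I) *
     (\<Sum>\<pi> | \<pi> \<in> fixing n (I \<inter> I') \<and> (\<forall>b\<in>I' - I. \<pi> b \<in> I - I'). g (\<sigma> \<circ> \<pi>)))" .
  then show ?thesis
    using I I' by (simp add: group_avg_def sum_divide_distrib[symmetric] card_fixing power2_eq_square)
qed

text \<open>For finite \<open>B \<subseteq> D\<close> this is the product of the symmetric groups of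
  \<open>B\<close> and of the complement of \<open>D\<close>. That it is a group is what makes the
  sums over it nonnegative forms.\<close>

definition block_perms :: "nat \<Rightarrow> nat set \<Rightarrow> nat set \<Rightarrow> (nat \<Rightarrow> nat) set" where
  "block_perms n D B = {\<pi> \<in> fixing n (D - B). \<forall>b\<in>B. \<pi> b \<in> B}"

text \<open>By injectivity, a permutation that fixes \<open>D - B\<close> and sends \<open>B\<close>
  off \<open>B\<close> sends it off all of \<open>D\<close>; the permutations on the right are
  sorted by the image \<open>A\<close> of \<open>B\<close>.\<close>

lemma sum_targets:
  assumes D: "D \<subseteq> {1..n}" "B \<subseteq> D"
  shows "(\<Sum>A | A \<subseteq> {1..n} - D \<and> card A = card B. \<Sum>\<pi> | \<pi> \<in> fixing n (D - B) \<and> (\<forall>b\<in>B. \<pi> b \<in> A). h \<pi>)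
    = (\<Sum>\<pi> | \<pi> \<in> fixing n (D - B) \<and> (\<forall>b\<in>B. \<pi> b \<notin> B). h \<pi> :: real)"
proof -
  let ?U = "{\<pi> \<in> fixing n (D - B). \<forall>b\<in>B. \<pi> b \<notin> B}"
  let ?A = "{A. A \<subseteq> {1..n} - D \<and> card A = card B}"
  have fB: "finite B" using D finite_subset by (metis finite_atLeastAtMost order_trans)
  have inj: "inj \<pi>" if "\<pi> \<in> fixing n E" for \<pi> E using that by (simp add: fixing_def permutes_inj)
  have notD: "\<pi> b \<notin> D" if "\<pi> \<in> ?U" "b \<in> B" for \<pi> b
  proof
    assume a: "\<pi> b \<in> D"
    then have "\<pi> b \<in> D - B" using that by auto
    then have "\<pi> (\<pi> b) = \<pi> b" using that by (auto simp: fixing_iff)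
    then have "\<pi> b = b" using inj[of \<pi> "D - B"] that by (auto dest: injD)
    then show False using that by auto
  qed
  have im: "\<pi> ` B \<subseteq> {1..n}" if "\<pi> \<in> fixing n E" for \<pi> E
    using fixing_Sym[OF that] D by (auto simp: Sym_iff permutes_in_image simp del: atLeastAtMost_iff)
  have "(\<Sum>\<pi>\<in>?U. h \<pi>) = (\<Sum>A\<in>?A. \<Sum>\<pi> | \<pi> \<in> ?U \<and> \<pi> ` B = A. h \<pi>)"
  proof (rule sum.group[symmetric])
    show "(\<lambda>\<pi>. \<pi> ` B) ` ?U \<subseteq> ?A"
    proof (rule image_subsetI)
      fix \<pi> assume p: "\<pi> \<in> ?U"
      have "\<pi> ` B \<subseteq> {1..n} - D" using im[of \<pi> "D - B"] notD[OF p] p by auto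
      moreover have "card (\<pi> ` B) = card B" using inj[of \<pi> "D - B"] p by (intro card_image) (auto intro: inj_on_subset)
      ultimately show "\<pi> ` B \<in> ?A" by simp
    qed
  qed auto
  also have "\<dots> = (\<Sum>A\<in>?A. \<Sum>\<pi> | \<pi> \<in> fixing n (D - B) \<and> (\<forall>b\<in>B. \<pi> b \<in> A). h \<pi>)"
  proof (rule sum.cong[OF refl])
    fix A assume A: "A \<in> ?A"
    have fA: "finite A" using A finite_subset by blast
    have "\<pi> ` B = A" if "\<pi> \<in> fixing n (D - B)" "\<forall>b\<in>B. \<pi> b \<in> A" for \<pi>
    proof (rule card_subset_eq[OF fA])
      show "card (\<pi> ` B) = card A" using A inj[OF that(1)] card_image inj_on_subset[of \<pi> UNIV B] by auto
    qed (use that in auto)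
    then have "{\<pi> \<in> ?U. \<pi> ` B = A} = {\<pi> \<in> fixing n (D - B). \<forall>b\<in>B. \<pi> b \<in> A}"
      using A D by auto
    then show "(\<Sum>\<pi> | \<pi> \<in> ?U \<and> \<pi> ` B = A. h \<pi>) = (\<Sum>\<pi> | \<pi> \<in> fixing n (D - B) \<and> (\<forall>b\<in>B. \<pi> b \<in> A). h \<pi>)"
      by (simp only:)
  qed
  finally show ?thesis by simp
qed

lemma exchange_bij:
  fixes n :: nat
  assumes D: "D \<subseteq> {1..n}" "card D = d"
  shows "bij_betw (\<lambda>(B, A). (D - B) \<union> A) (Sigma (Pow D) (\<lambda>B. {A. A \<subseteq> {1..n} - D \<and> card A = card B}))
    {I. I \<subseteq> {1..n} \<and> card I = d}"
proof (rule bij_betw_byWitness[where f' = "\<lambda>I. (D - I, I - D)"])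
  have fin: "finite X" if "X \<subseteq> {1..n}" for X by (rule finite_subset[OF that]) simp
  show "(\<lambda>(B, A). (D - B) \<union> A) ` (Sigma (Pow D) (\<lambda>B. {A. A \<subseteq> {1..n} - D \<and> card A = card B})) \<subseteq> {I. I \<subseteq> {1..n} \<and> card I = d}"
  proof clarify
    fix B A assume a: "B \<subseteq> D" "A \<subseteq> {1..n} - D" "card A = card B"
    have f: "finite D" "finite B" "finite A"
      using fin[OF D(1)] finite_subset[OF a(1)] finite_subset[OF a(2)] by auto
    have "card ((D - B) \<union> A) = card (D - B) + card A"
      using a f by (intro card_Un_disjoint) auto
    also have "\<dots> = d"
      using card_Diff_subset[OF f(2) a(1)] card_mono[OF f(1) a(1)] a(3) D(2) by simp
    finally have "card ((D - B) \<union> A) = d" .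
    moreover have "D - B \<union> A \<subseteq> {1..n}" using a(2) D(1) by blast
    ultimately show "D - B \<union> A \<subseteq> {1..n} \<and> card (D - B \<union> A) = d" by blast
  qed
  show "(\<lambda>I. (D - I, I - D)) ` {I. I \<subseteq> {1..n} \<and> card I = d} \<subseteq> Sigma (Pow D) (\<lambda>B. {A. A \<subseteq> {1..n} - D \<and> card A = card B})"
  proof (rule image_subsetI)
    fix I assume "I \<in> {I. I \<subseteq> {1..n} \<and> card I = d}"
    then have a: "I \<subseteq> {1..n}" "card I = d" by auto
    have "card (I - D) = card (D - I)"
      using card_Int_Diff[OF fin[OF a(1)], of D] card_Int_Diff[OF fin[OF D(1)], of I] a(2) D(2)
      by (simp add: Int_commute)
    moreover have "I - D \<subseteq> {1..n} - D" "D - I \<subseteq> D" using a(1) by blast+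
    ultimately show "(D - I, I - D) \<in> Sigma (Pow D) (\<lambda>B. {A. A \<subseteq> {1..n} - D \<and> card A = card B})"
      by blast
  qed
  show "\<forall>p\<in>Sigma (Pow D) (\<lambda>B. {A. A \<subseteq> {1..n} - D \<and> card A = card B}).
      (D - (case p of (B, A) \<Rightarrow> D - B \<union> A), (case p of (B, A) \<Rightarrow> D - B \<union> A) - D) = p"
  proof clarify
    fix B A assume "B \<subseteq> D" "A \<subseteq> {1..n} - D"
    then have "D - (D - B \<union> A) = B" "(D - B \<union> A) - D = A" by blast+
    then show "D - (D - B \<union> A) = B \<and> D - B \<union> A - D = A" by blast
  qed
  show "\<forall>I\<in>{I. I \<subseteq> {1..n} \<and> card I = d}. (case (D - I, I - D) of (B, A) \<Rightarrow> D - B \<union> A) = I"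
    by (simp only: prod.case) blast
qed

lemma sum_group_nonneg:
  assumes H: "perm_group n H"
  shows "ip n g (\<lambda>\<sigma>. \<Sum>\<pi>\<in>H. g (\<sigma> \<circ> \<pi>)) \<ge> 0"
proof -
  have "0 \<le> ip n g (group_avg H g)" using ip_ge_0[of n "group_avg H g"] by (simp add: ip_group_avg[OF H])
  then show ?thesis
    using perm_groupD(2)[OF H] by (simp add: group_avg_def[abs_def] ip_divide_right zero_le_divide_iff)
qed

lemma perm_group_block:
  assumes B: "finite B" shows "perm_group n (block_perms n D B)"
proof -
  have "inv \<pi> \<in> block_perms n D B" if p: "\<pi> \<in> block_perms n D B" for \<pi>
  proof -
    have inj: "inj \<pi>" using p by (auto simp: block_perms_def fixing_def permutes_inj)
    have "\<pi> ` B = B" using p B inj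
      by (intro endo_inj_surj) (auto simp: block_perms_def intro: inj_on_subset)
    then have "inv \<pi> b \<in> B" if "b \<in> B" for b
      using inj that by (metis imageE inv_f_f)
    then show ?thesis using p by (simp add: block_perms_def fixing_inv)
  qed
  then show ?thesis by (auto simp: perm_group_def block_perms_def fixing_Sym fixing_comp)
qed

text \<open>\<open>ip n M M\<close> is the sum of all \<open>ip n g (cond n I (cond n D g))\<close>.
  For fixed \<open>D\<close>, let \<open>I\<close> arise from \<open>D\<close> by exchanging a
  subset \<open>B\<close> for \<open>A\<close>. Composing the two expectations gives a sign
  \<open>(- 1) ^ card B\<close>; after the sum over \<open>A\<close> the set \<open>B\<close> is
  only required to be moved off itself, and a second flip gives the same sign again. So each
  \<open>B\<close> contributes a nonnegative sum over a subgroup, and the terms with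
  \<open>B = {}\<close> alone add up to \<open>ip n g M\<close>.\<close>

lemma level_operator_square:
  assumes kill: "\<And>E \<sigma>. E \<subseteq> {1..n} \<Longrightarrow> card E < d \<Longrightarrow> \<sigma> \<in> Sym n \<Longrightarrow> cond n E g \<sigma> = 0"
  defines "M \<equiv> (\<lambda>\<sigma>. \<Sum>I | I \<subseteq> {1..n} \<and> card I = d. cond n I g \<sigma>)"
  shows "ip n g M \<le> ip n M M"
proof -
  let ?S = "{I. I \<subseteq> {1..n} \<and> card I = d}"
  have fS: "finite ?S" by simp
  define c where "c = (\<lambda>B :: nat set. fact (n - (d + card B)) / (fact (n - d))\<^sup>2 :: real)"
  define K where "K = (\<lambda>D B. ip n g (\<lambda>\<sigma>. \<Sum>\<pi>\<in>block_perms n D B. g (\<sigma> \<circ> \<pi>)))"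
  have D: "(\<Sum>I\<in>?S. ip n g (cond n I (cond n D g))) = (\<Sum>B\<in>Pow D. c B * K D B)" if D: "D \<in> ?S" for D
  proof -
    have D1: "D \<subseteq> {1..n}" "card D = d" using that by auto
    have fD: "finite D" using D1 finite_subset by blast
    define F where "F = (\<lambda>B A. ip n g (\<lambda>\<sigma>. c B * (- 1) ^ card B * (\<Sum>\<pi> | \<pi> \<in> fixing n (D - B) \<and> (\<forall>b\<in>B. \<pi> b \<in> A). g (\<sigma> \<circ> \<pi>))))"
    have "(\<Sum>I\<in>?S. ip n g (cond n I (cond n D g)))
      = (\<Sum>(B, A)\<in>Sigma (Pow D) (\<lambda>B. {A. A \<subseteq> {1..n} - D \<and> card A = card B}). ip n g (cond n ((D - B) \<union> A) (cond n D g)))"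
      using sum.reindex_bij_betw[OF exchange_bij[OF D1], of "\<lambda>I. ip n g (cond n I (cond n D g))"]
      by (simp add: case_prod_unfold)
    also have "\<dots> = (\<Sum>(B, A)\<in>Sigma (Pow D) (\<lambda>B. {A. A \<subseteq> {1..n} - D \<and> card A = card B}). F B A)"
    proof (intro sum.cong refl, clarify)
      fix B A assume a: "B \<subseteq> D" "A \<subseteq> {1..n} - D" "card A = card B"
      let ?I = "(D - B) \<union> A"
      have mem: "(B, A) \<in> Sigma (Pow D) (\<lambda>B. {A. A \<subseteq> {1..n} - D \<and> card A = card B})" using a by auto
      have I: "?I \<subseteq> {1..n}" "card ?I = d"
        using bij_betw_apply[OF exchange_bij[OF D1] mem] by (simp_all only: prod.case mem_Collect_eq)
      have e: "?I \<inter> D = D - B" "D - ?I = B" "?I - D = A" "?I \<union> D = D \<union> A" using a by auto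
      have cu: "card (D \<union> A) = d + card B"
        using a fD D1 by (subst card_Un_disjoint) (auto intro: finite_subset)
      show "ip n g (cond n ?I (cond n D g)) = F B A"
        unfolding F_def by (intro ip_cong refl) (simp only: cond_cond[OF I D1 kill] e cu c_def)
    qed
    also have "\<dots> = (\<Sum>B\<in>Pow D. \<Sum>A | A \<subseteq> {1..n} - D \<and> card A = card B. F B A)"
      using fD by (subst sum.Sigma) auto
    also have "\<dots> = (\<Sum>B\<in>Pow D. c B * K D B)"
    proof (intro sum.cong refl)
      fix B assume "B \<in> Pow D"
      then have B: "B \<subseteq> D" by simp
      have "(\<Sum>A | A \<subseteq> {1..n} - D \<and> card A = card B. F B A)
        = ip n g (\<lambda>\<sigma>. c B * (- 1) ^ card B * (\<Sum>A | A \<subseteq> {1..n} - D \<and> card A = card B. \<Sum>\<pi> | \<pi> \<in> fixing n (D - B) \<and> (\<forall>b\<in>B. \<pi> b \<in> A). g (\<sigma> \<circ> \<pi>)))"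
        by (simp add: F_def sum_distrib_left ip_sum_right)
      also have "\<dots> = ip n g (\<lambda>\<sigma>. c B * (- 1) ^ card B * (\<Sum>\<pi> | \<pi> \<in> fixing n (D - B) \<and> (\<forall>b\<in>B. \<pi> b \<notin> B). g (\<sigma> \<circ> \<pi>)))"
        by (simp only: sum_targets[OF D1(1) B])
      also have "\<dots> = ip n g (\<lambda>\<sigma>. c B * (\<Sum>\<pi>\<in>block_perms n D B. g (\<sigma> \<circ> \<pi>)))"
      proof (intro ip_cong refl)
        fix \<sigma> assume s: "\<sigma> \<in> Sym n"
        have "(\<Sum>\<pi> | \<pi> \<in> fixing n (D - B) \<and> (\<forall>b\<in>B. \<pi> b \<in> B) \<and> (\<forall>b\<in>B - B. \<pi> b \<notin> B). g (\<sigma> \<circ> \<pi>))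
          = (- 1) ^ card B * (\<Sum>\<pi> | \<pi> \<in> fixing n (D - B) \<and> (\<forall>b\<in>B. \<pi> b \<notin> B). g (\<sigma> \<circ> \<pi>))"
        proof (rule avoid_flip[OF _ _ order_refl _ s])
          fix E \<sigma> assume E: "E \<subset> D - B \<union> B" "\<sigma> \<in> Sym n"
          then have "E \<subset> D" using B by auto
          then have "card E < d" using fD D1 by (metis psubset_card_mono)
          then show "cond n E g \<sigma> = 0" using E D1 B by (intro kill) auto
        qed (use D1 B in auto)
        then show "c B * (- 1) ^ card B * (\<Sum>\<pi> | \<pi> \<in> fixing n (D - B) \<and> (\<forall>b\<in>B. \<pi> b \<notin> B). g (\<sigma> \<circ> \<pi>))
          = c B * (\<Sum>\<pi>\<in>block_perms n D B. g (\<sigma> \<circ> \<pi>))"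
          by (simp add: block_perms_def)
      qed
      also have "\<dots> = c B * K D B" by (simp add: K_def ip_cmult_right)
      finally show "(\<Sum>A | A \<subseteq> {1..n} - D \<and> card A = card B. F B A) = c B * K D B" .
    qed
    finally show ?thesis .
  qed
  have K0: "K D B \<ge> 0" if "B \<subseteq> D" "D \<in> ?S" for D B
  proof -
    have "finite B" using that finite_subset[of D "{1..n}"] finite_subset[of B D] by auto
    then show ?thesis unfolding K_def by (intro sum_group_nonneg perm_group_block)
  qed
  have K1: "c {} * K D {} = ip n g (cond n D g)" if "D \<in> ?S" for D
  proof -
    have "block_perms n D {} = fixing n D" by (simp add: block_perms_def)
    then have "K D {} = fact (n - d) * ip n g (cond n D g)"
      using that by (simp add: K_def group_avg_def[abs_def] ip_divide_right card_fixing)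
    then show ?thesis by (simp add: c_def power2_eq_square)
  qed
  have "ip n g M = (\<Sum>D\<in>?S. ip n g (cond n D g))" by (simp add: M_def ip_sum_right)
  also have "\<dots> \<le> (\<Sum>D\<in>?S. \<Sum>B\<in>Pow D. c B * K D B)"
  proof (rule sum_mono)
    fix D assume d: "D \<in> ?S"
    have "(\<Sum>B\<in>{{}}. c B * K D B) \<le> (\<Sum>B\<in>Pow D. c B * K D B)"
    proof (rule sum_mono2)
      show "finite (Pow D)" using d finite_subset[of D "{1..n}"] by auto
      show "0 \<le> c B * K D B" if "B \<in> Pow D - {{}}" for B
        using K0[of B D] d that by (intro mult_nonneg_nonneg) (auto simp: c_def)
    qed simp
    then show "ip n g (cond n D g) \<le> (\<Sum>B\<in>Pow D. c B * K D B)" using K1[OF d] by simp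
  qed
  also have "\<dots> = (\<Sum>D\<in>?S. \<Sum>I\<in>?S. ip n g (cond n I (cond n D g)))"
    using D by simp
  also have "\<dots> = (\<Sum>D\<in>?S. \<Sum>I\<in>?S. ip n (cond n I g) (cond n D g))"
    by (simp add: cond_selfadjoint)
  also have "\<dots> = ip n M M" 
    unfolding M_def ip_sum_left ip_sum_right by (rule sum.swap)
  finally show ?thesis .
qed

section \<open>Polynomials of bounded degree and their projections\<close>

definition mono_fun :: "(nat \<times> nat) multiset \<Rightarrow> (nat \<Rightarrow> nat) \<Rightarrow> real" where
  "mono_fun m \<sigma> = (\<Prod>(i, j)\<in>#m. x_var i j \<sigma>)"

text \<open>Membership in \<open>V_le\<close> for functions with arbitrary values outside
  \<open>Sym n\<close>, so that sums and translates need no \<open>restrict\<close>.\<close>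

definition deg_le :: "nat \<Rightarrow> int \<Rightarrow> ((nat \<Rightarrow> nat) \<Rightarrow> real) \<Rightarrow> bool" where
  "deg_le n k h \<longleftrightarrow> (\<exists>c. \<forall>\<sigma>\<in>Sym n. h \<sigma> = (\<Sum>m\<in>monomials n k. c m * mono_fun m \<sigma>))"

lemma deg_le_iff: "deg_le n k h \<longleftrightarrow> restrict h (Sym n) \<in> V_le n k"
proof
  assume "deg_le n k h"
  then obtain c where c: "\<And>\<sigma>. \<sigma> \<in> Sym n \<Longrightarrow> h \<sigma> = (\<Sum>m\<in>monomials n k. c m * mono_fun m \<sigma>)"
    by (auto simp: deg_le_def)
  have "restrict h (Sym n) = restrict (\<lambda>\<sigma>. \<Sum>m\<in>monomials n k. c m * (\<Prod>(i, j)\<in>#m. x_var i j \<sigma>)) (Sym n)"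
    by (rule restrict_ext) (simp add: c mono_fun_def)
  then show "restrict h (Sym n) \<in> V_le n k" unfolding V_le_def by blast
next
  assume "restrict h (Sym n) \<in> V_le n k"
  then obtain c where c: "restrict h (Sym n) = restrict (\<lambda>\<sigma>. \<Sum>m\<in>monomials n k. c m * (\<Prod>(i, j)\<in>#m. x_var i j \<sigma>)) (Sym n)"
    unfolding V_le_def by blast
  have "h \<sigma> = (\<Sum>m\<in>monomials n k. c m * mono_fun m \<sigma>)" if "\<sigma> \<in> Sym n" for \<sigma>
    using fun_cong[OF c, of \<sigma>] that by (simp add: mono_fun_def)
  then show "deg_le n k h" unfolding deg_le_def by blast
qed

lemma V_le_restrict: "g \<in> V_le n k \<Longrightarrow> restrict g (Sym n) = g"
  by (auto simp: V_le_def)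

lemma V_le_deg_le: "g \<in> V_le n k \<Longrightarrow> deg_le n k g"
  by (simp add: deg_le_iff V_le_restrict)

lemma deg_le_cong: "(\<And>\<sigma>. \<sigma> \<in> Sym n \<Longrightarrow> h \<sigma> = h' \<sigma>) \<Longrightarrow> deg_le n k h \<Longrightarrow> deg_le n k h'"
  unfolding deg_le_def by metis

lemma deg_le_mono_fun: "m \<in> monomials n k \<Longrightarrow> deg_le n k (mono_fun m)"
  unfolding deg_le_def
  by (rule exI[of _ "\<lambda>m'. if m' = m then 1 else 0"]) (simp add: finite_monomials if_distrib[of "\<lambda>c. c * _"] cong: if_cong)

lemma deg_le_add: "deg_le n k f \<Longrightarrow> deg_le n k g \<Longrightarrow> deg_le n k (\<lambda>\<sigma>. f \<sigma> + g \<sigma>)"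
proof -
  assume "deg_le n k f" "deg_le n k g"
  then obtain c d where "\<And>\<sigma>. \<sigma> \<in> Sym n \<Longrightarrow> f \<sigma> = (\<Sum>m\<in>monomials n k. c m * mono_fun m \<sigma>)"
    "\<And>\<sigma>. \<sigma> \<in> Sym n \<Longrightarrow> g \<sigma> = (\<Sum>m\<in>monomials n k. d m * mono_fun m \<sigma>)"
    by (auto simp: deg_le_def)
  then show ?thesis unfolding deg_le_def
    by (intro exI[of _ "\<lambda>m. c m + d m"]) (simp add: distrib_right sum.distrib)
qed

lemma deg_le_cmult: "deg_le n k f \<Longrightarrow> deg_le n k (\<lambda>\<sigma>. c * f \<sigma>)"
proof -
  assume "deg_le n k f"
  then obtain d where "\<And>\<sigma>. \<sigma> \<in> Sym n \<Longrightarrow> f \<sigma> = (\<Sum>m\<in>monomials n k. d m * mono_fun m \<sigma>)"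
    by (auto simp: deg_le_def)
  then show ?thesis unfolding deg_le_def
    by (intro exI[of _ "\<lambda>m. c * d m"]) (simp add: sum_distrib_left mult.assoc)
qed

lemma deg_le_zero: "deg_le n k (\<lambda>\<sigma>. 0)"
  unfolding deg_le_def by (rule exI[of _ "\<lambda>m. 0"]) simp

lemma deg_le_diff: "deg_le n k f \<Longrightarrow> deg_le n k g \<Longrightarrow> deg_le n k (\<lambda>\<sigma>. f \<sigma> - g \<sigma>)"
  using deg_le_add[OF _ deg_le_cmult[of n k g "-1"], of f] by simp

lemma deg_le_sum: "(\<And>t. t \<in> T \<Longrightarrow> deg_le n k (f t)) \<Longrightarrow> deg_le n k (\<lambda>\<sigma>. \<Sum>t\<in>T. f t \<sigma>)"
  by (induction T rule: infinite_finite_induct) (auto simp: deg_le_zero deg_le_add)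

lemma deg_le_increasing:
  assumes "k \<le> l" "deg_le n k f" shows "deg_le n l f"
proof -
  obtain c where c: "\<And>\<sigma>. \<sigma> \<in> Sym n \<Longrightarrow> f \<sigma> = (\<Sum>m\<in>monomials n k. c m * mono_fun m \<sigma>)"
    using assms by (auto simp: deg_le_def)
  have "monomials n k \<subseteq> monomials n l" using assms by (auto simp: monomials_def)
  then have "deg_le n l (\<lambda>\<sigma>. \<Sum>m\<in>monomials n k. c m * mono_fun m \<sigma>)"
    by (intro deg_le_sum deg_le_cmult deg_le_mono_fun) auto
  then show ?thesis by (rule deg_le_cong[rotated]) (simp add: c)
qed

text \<open>Right translation permutes the variables: \<open>x_var i j (\<sigma> \<circ> \<rho>) =
  x_var (\<rho> i) j \<sigma>\<close>.\<close>

lemma deg_le_translate: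
  assumes "\<rho> \<in> Sym n" "deg_le n k h" shows "deg_le n k (\<lambda>\<sigma>. h (\<sigma> \<circ> \<rho>))"
proof -
  obtain c where c: "\<And>\<sigma>. \<sigma> \<in> Sym n \<Longrightarrow> h \<sigma> = (\<Sum>m\<in>monomials n k. c m * mono_fun m \<sigma>)"
    using assms by (auto simp: deg_le_def)
  let ?t = "\<lambda>m. image_mset (\<lambda>(i, j). (\<rho> i, j)) m"
  have t: "mono_fun m (\<sigma> \<circ> \<rho>) = mono_fun (?t m) \<sigma>" for m \<sigma>
    by (simp add: mono_fun_def image_mset.compositionality comp_def case_prod_unfold x_var_def)
  have "\<rho> i \<in> {1..n}" if "i \<in> {1..n}" for i
    using assms(1) that by (simp add: Sym_iff permutes_in_image del: atLeastAtMost_iff)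
  then have m: "?t m \<in> monomials n k" if "m \<in> monomials n k" for m
    using that unfolding monomials_def by fastforce
  have "deg_le n k (\<lambda>\<sigma>. \<Sum>m\<in>monomials n k. c m * mono_fun (?t m) \<sigma>)"
    by (intro deg_le_sum deg_le_cmult deg_le_mono_fun m)
  then show ?thesis
    by (rule deg_le_cong[rotated]) (simp add: c[OF Sym_comp] assms(1) t)
qed

lemma deg_le_cond: "deg_le n k h \<Longrightarrow> deg_le n k (cond n I h)"
proof -
  assume "deg_le n k h"
  then have "deg_le n k (\<lambda>\<sigma>. (1 / card (fixing n I)) * (\<Sum>\<phi>\<in>fixing n I. h (\<sigma> \<circ> \<phi>)))"
    by (intro deg_le_cmult deg_le_sum deg_le_translate) (auto simp: fixing_Sym)
  then show ?thesis by (simp add: group_avg_def[abs_def])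
qed

text \<open>It is the product of the variables \<open>x_var i (x i)\<close> over \<open>E\<close>.
  If \<open>x\<close> takes a value outside \<open>{1..n}\<close> on \<open>E\<close>, such a
  variable is missing, but then no permutation agrees with \<open>x\<close> either.\<close>

lemma deg_le_indicator:
  assumes E: "E \<subseteq> {1..n}" "int (card E) \<le> k"
  shows "deg_le n k (\<lambda>\<sigma>. if \<forall>i\<in>E. \<sigma> i = x i then 1 else 0)"
proof (cases "\<forall>i\<in>E. x i \<in> {1..n}")
  case True
  have fE: "finite E" using E(1) by (rule finite_subset) simp
  define m where "m = image_mset (\<lambda>i. (i, x i)) (mset_set E)"
  have "m \<in> monomials n k" using E True fE by (auto simp: m_def monomials_def)
  then have "deg_le n k (mono_fun m)" by (rule deg_le_mono_fun)
  moreover have "mono_fun m \<sigma> = (if \<forall>i\<in>E. \<sigma> i = x i then 1 else 0)" for \<sigma>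
  proof -
    have "mono_fun m \<sigma> = (\<Prod>i\<in>E. x_var i (x i) \<sigma>)"
      by (simp add: mono_fun_def m_def image_mset.compositionality comp_def prod_unfold_prod_mset)
    also have "\<dots> = (if \<forall>i\<in>E. \<sigma> i = x i then 1 else 0)"
      using fE by (auto simp: x_var_def prod_zero_iff intro!: prod.neutral)
    finally show ?thesis .
  qed
  ultimately show ?thesis by (rule deg_le_cong[rotated])
next
  case False
  then obtain i where i: "i \<in> E" "x i \<notin> {1..n}" by auto
  have "\<sigma> i \<in> {1..n}" if "\<sigma> \<in> Sym n" for \<sigma>
    using that i E(1) by (auto simp: Sym_iff permutes_in_image simp del: atLeastAtMost_iff)
  then have "\<not> (\<forall>i\<in>E. \<sigma> i = x i)" if "\<sigma> \<in> Sym n" for \<sigma> using i that by metis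
  then show ?thesis by (intro deg_le_cong[OF _ deg_le_zero]) auto
qed

text \<open>Resolves the definite description. Existence is Gram-Schmidt on the monomials; the
  difference of two candidates lies in the space and is orthogonal to itself, and restriction to
  \<open>Sym n\<close> makes them equal as functions.\<close>

lemma proj_le_properties:
  "deg_le n k (proj_le n k f)"
  "deg_le n k h \<Longrightarrow> ip n (\<lambda>\<sigma>. f \<sigma> - proj_le n k f \<sigma>) h = 0"
proof -
  let ?P = "\<lambda>g. g \<in> V_le n k \<and> (\<forall>h\<in>V_le n k. ip n (\<lambda>\<sigma>. f \<sigma> - g \<sigma>) h = 0)"
  obtain c where c: "\<And>a. a \<in> monomials n k \<Longrightarrow> ip n (\<lambda>\<sigma>. f \<sigma> - (\<Sum>m\<in>monomials n k. c m * mono_fun m \<sigma>)) (mono_fun a) = 0"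
    using ip_orth_exists[OF finite_monomials, of n k n f mono_fun] by auto
  define p where "p = (\<lambda>\<sigma>. \<Sum>m\<in>monomials n k. c m * mono_fun m \<sigma>)"
  have orth: "ip n (\<lambda>\<sigma>. f \<sigma> - p \<sigma>) h = 0" if h: "deg_le n k h" for h
  proof -
    obtain d where d: "\<And>\<sigma>. \<sigma> \<in> Sym n \<Longrightarrow> h \<sigma> = (\<Sum>m\<in>monomials n k. d m * mono_fun m \<sigma>)"
      using h by (auto simp: deg_le_def)
    have "ip n (\<lambda>\<sigma>. f \<sigma> - p \<sigma>) h = ip n (\<lambda>\<sigma>. f \<sigma> - p \<sigma>) (\<lambda>\<sigma>. \<Sum>m\<in>monomials n k. d m * mono_fun m \<sigma>)"
      by (intro ip_cong refl) (simp add: d)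
    then show ?thesis using c by (simp add: ip_sum_right ip_cmult_right p_def)
  qed
  have p: "deg_le n k p" unfolding deg_le_def p_def by blast
  have ex: "?P (restrict p (Sym n))"
  proof (intro conjI ballI)
    show "restrict p (Sym n) \<in> V_le n k" using p by (simp add: deg_le_iff)
    fix h assume "h \<in> V_le n k"
    then have "ip n (\<lambda>\<sigma>. f \<sigma> - p \<sigma>) h = 0" by (intro orth V_le_deg_le)
    moreover have "ip n (\<lambda>\<sigma>. f \<sigma> - restrict p (Sym n) \<sigma>) h = ip n (\<lambda>\<sigma>. f \<sigma> - p \<sigma>) h"
      by (rule ip_cong) auto
    ultimately show "ip n (\<lambda>\<sigma>. f \<sigma> - restrict p (Sym n) \<sigma>) h = 0" by simp
  qed
  have un: "g = restrict p (Sym n)" if g: "?P g" for g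
  proof -
    let ?e = "\<lambda>\<sigma>. g \<sigma> - p \<sigma>"
    have d: "deg_le n k ?e" using deg_le_diff[OF V_le_deg_le p] g by blast
    have "ip n (\<lambda>\<sigma>. f \<sigma> - g \<sigma>) ?e = ip n (\<lambda>\<sigma>. f \<sigma> - g \<sigma>) (restrict ?e (Sym n))"
      by (rule ip_cong) auto
    then have "ip n (\<lambda>\<sigma>. f \<sigma> - g \<sigma>) ?e = 0" using g d by (simp add: deg_le_iff)
    then have "ip n ?e ?e = 0"
      using orth[OF d] by (simp add: ip_diff_left)
    then have "\<forall>\<sigma>\<in>Sym n. g \<sigma> = p \<sigma>" by (simp add: ip_eq_0_iff)
    then have "restrict g (Sym n) = restrict p (Sym n)" by (intro restrict_ext) auto
    then show ?thesis using g V_le_restrict by metis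
  qed
  have "?P (proj_le n k f)" unfolding proj_le_def by (rule theI[of ?P, OF ex un])
  then have P: "proj_le n k f = restrict p (Sym n)" by (rule un)
  show "deg_le n k (proj_le n k f)"
    unfolding P by (rule deg_le_cong[OF _ p]) simp
  show "ip n (\<lambda>\<sigma>. f \<sigma> - proj_le n k f \<sigma>) h = 0" if "deg_le n k h"
    using orth[OF that] unfolding P by (subst ip_cong[of n _ "\<lambda>\<sigma>. f \<sigma> - p \<sigma>" h h]) auto
qed

text \<open>The functions of level exactly \<open>d\<close>, up to values outside
  \<open>Sym n\<close>. For \<open>d = 0\<close> the degree bound is -1 and the second condition is
  orthogonality to functions that vanish on \<open>Sym n\<close>.\<close>

definition pure :: "nat \<Rightarrow> nat \<Rightarrow> ((nat \<Rightarrow> nat) \<Rightarrow> real) \<Rightarrow> bool" where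
  "pure n d g \<longleftrightarrow> deg_le n (int d) g \<and> (\<forall>h. deg_le n (int d - 1) h \<longrightarrow> ip n g h = 0)"

lemma pure_deg_part: "pure n d (deg_part n d f)"
  unfolding pure_def deg_part_def
proof (intro conjI allI impI)
  show "deg_le n (int d) (\<lambda>\<sigma>. proj_le n (int d) f \<sigma> - proj_le n (int d - 1) f \<sigma>)"
    using proj_le_properties(1)[of n "int d - 1" f] by (intro deg_le_diff proj_le_properties(1)) (rule deg_le_increasing[rotated], auto)
  fix h assume h: "deg_le n (int d - 1) h"
  have "ip n (\<lambda>\<sigma>. f \<sigma> - proj_le n (int d) f \<sigma>) h = 0"
    by (rule proj_le_properties(2)) (rule deg_le_increasing[OF _ h], simp)
  moreover have "ip n (\<lambda>\<sigma>. f \<sigma> - proj_le n (int d - 1) f \<sigma>) h = 0"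
    by (rule proj_le_properties(2)[OF h])
  ultimately show "ip n (\<lambda>\<sigma>. proj_le n (int d) f \<sigma> - proj_le n (int d - 1) f \<sigma>) h = 0"
    by (simp add: ip_diff_left)
qed

text \<open>Both \<open>f\<close> minus its projection to degree \<open>d\<close> and the projection
  to degree \<open>d - 1\<close> are orthogonal to \<open>h\<close>.\<close>

lemma ip_deg_part:
  assumes "pure n d h" shows "ip n (deg_part n d f) h = ip n f h"
proof -
  have "ip n (\<lambda>\<sigma>. f \<sigma> - proj_le n (int d) f \<sigma>) h = 0"
    by (rule proj_le_properties(2)) (use assms in \<open>simp add: pure_def\<close>)
  moreover have "ip n (proj_le n (int d - 1) f) h = 0"
    using assms proj_le_properties(1)[of n "int d - 1" f] by (simp add: pure_def ip_commute[of n _ h])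
  ultimately show ?thesis by (simp add: deg_part_def ip_diff_left)
qed

lemma deg_part_norm_le: "ip n (deg_part n d f) (deg_part n d f) \<le> ip n f f"
proof -
  let ?g = "deg_part n d f"
  have e: "ip n ?g ?g = ip n f ?g" by (rule ip_deg_part[OF pure_deg_part])
  have "0 \<le> ip n (\<lambda>\<sigma>. f \<sigma> - ?g \<sigma>) (\<lambda>\<sigma>. f \<sigma> - ?g \<sigma>)" by (rule ip_ge_0)
  also have "\<dots> = ip n f f - ip n ?g ?g"
    using e by (simp add: ip_diff_left ip_diff_right ip_commute[of n ?g f])
  finally show ?thesis by simp
qed

lemma pure_translate:
  assumes "\<rho> \<in> Sym n" "pure n d g" shows "pure n d (\<lambda>\<sigma>. g (\<sigma> \<circ> \<rho>))"
  unfolding pure_def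
proof (intro conjI allI impI)
  show "deg_le n (int d) (\<lambda>\<sigma>. g (\<sigma> \<circ> \<rho>))" using assms by (intro deg_le_translate) (auto simp: pure_def)
  fix h assume "deg_le n (int d - 1) h"
  then have "deg_le n (int d - 1) (\<lambda>\<sigma>. h (\<sigma> \<circ> inv \<rho>))" using assms by (intro deg_le_translate Sym_inv)
  then have "ip n g (\<lambda>\<sigma>. h (\<sigma> \<circ> inv \<rho>)) = 0" using assms by (simp add: pure_def)
  moreover have "ip n (\<lambda>\<sigma>. g (\<sigma> \<circ> \<rho>)) (\<lambda>\<sigma>. h (\<sigma> \<circ> \<rho> \<circ> inv \<rho>)) = ip n g (\<lambda>\<sigma>. h (\<sigma> \<circ> inv \<rho>))"
    using ip_translate[OF assms(1), of g "\<lambda>\<sigma>. h (\<sigma> \<circ> inv \<rho>)"] by simp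
  ultimately show "ip n (\<lambda>\<sigma>. g (\<sigma> \<circ> \<rho>)) h = 0" using assms(1) by (simp add: comp_assoc)
qed

lemma pure_sum: "(\<And>t. t \<in> T \<Longrightarrow> pure n d (f t)) \<Longrightarrow> pure n d (\<lambda>\<sigma>. \<Sum>t\<in>T. f t \<sigma>)"
  unfolding pure_def by (auto intro: deg_le_sum simp: ip_sum_left)

lemma pure_cmult: "pure n d g \<Longrightarrow> pure n d (\<lambda>\<sigma>. c * g \<sigma>)"
  unfolding pure_def by (auto intro: deg_le_cmult simp: ip_cmult_left)

lemma pure_divide: "pure n d g \<Longrightarrow> pure n d (\<lambda>\<sigma>. g \<sigma> / c)"
  using pure_cmult[of n d g "1 / c"] by simp

lemma pure_group_avg: "perm_group n H \<Longrightarrow> pure n d g \<Longrightarrow> pure n d (group_avg H g)"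
  unfolding group_avg_def[abs_def] by (intro pure_divide pure_sum pure_translate) (auto dest: perm_groupD(3))

lemmas pure_cond = pure_group_avg[OF perm_group_fixing]

text \<open>The value at \<open>x\<close> of the conditional expectation of \<open>g\<close> on the coordinates in \<open>I\<close>, for points \<open>x\<close>
  of the product space that need not be permutations; it is 0 if \<open>x\<close> is not injective on \<open>I\<close>.\<close>

definition cond_ext :: "nat \<Rightarrow> nat set \<Rightarrow> ((nat \<Rightarrow> nat) \<Rightarrow> real) \<Rightarrow> (nat \<Rightarrow> nat) \<Rightarrow> real" where
  "cond_ext n I g x = (\<Sum>\<sigma> | \<sigma> \<in> Sym n \<and> (\<forall>i\<in>I. \<sigma> i = x i). g \<sigma>) / card (fixing n I)"

lemma agreeing_bij:
  assumes "\<sigma> \<in> Sym n"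
  shows "bij_betw (\<lambda>\<phi>. \<sigma> \<circ> \<phi>) (fixing n I) {\<tau>. \<tau> \<in> Sym n \<and> (\<forall>i\<in>I. \<tau> i = \<sigma> i)}"
proof (rule bij_betw_byWitness[where f' = "\<lambda>\<tau>. inv \<sigma> \<circ> \<tau>"])
  show "(\<lambda>\<tau>. inv \<sigma> \<circ> \<tau>) ` {\<tau> \<in> Sym n. \<forall>i\<in>I. \<tau> i = \<sigma> i} \<subseteq> fixing n I"
  proof (rule image_subsetI)
    fix \<tau> assume "\<tau> \<in> {\<tau> \<in> Sym n. \<forall>i\<in>I. \<tau> i = \<sigma> i}"
    then show "inv \<sigma> \<circ> \<tau> \<in> fixing n I"
      using assms by (auto simp: fixing_iff Sym_comp Sym_inv) (simp add: Sym_iff permutes_inverses(2))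
  qed
qed (use assms in \<open>auto simp: comp_assoc[symmetric] fixing_iff Sym_comp\<close>)

lemma cond_ext_eq:
  assumes "\<sigma> \<in> Sym n" "\<And>i. i \<in> I \<Longrightarrow> x i = \<sigma> i"
  shows "cond_ext n I g x = cond n I g \<sigma>"
proof -
  have "{\<tau>. \<tau> \<in> Sym n \<and> (\<forall>i\<in>I. \<tau> i = x i)} = {\<tau>. \<tau> \<in> Sym n \<and> (\<forall>i\<in>I. \<tau> i = \<sigma> i)}"
    using assms(2) by auto
  then show ?thesis
    using sum.reindex_bij_betw[OF agreeing_bij[OF assms(1), of I], of g]
    by (simp add: cond_ext_def group_avg_def)
qed

lemma cond_ext_noninj: "\<not> inj_on x I \<Longrightarrow> cond_ext n I g x = 0"
proof -
  assume x: "\<not> inj_on x I"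
  have "inj_on x I" if s: "\<sigma> \<in> Sym n" and e: "\<forall>i\<in>I. \<sigma> i = x i" for \<sigma>
  proof -
    have "inj \<sigma>" using s by (simp add: Sym_iff permutes_inj)
    then have "inj_on \<sigma> I" by (rule inj_on_subset) simp
    then show ?thesis using e by (simp add: inj_on_def)
  qed
  then have "{\<sigma>. \<sigma> \<in> Sym n \<and> (\<forall>i\<in>I. \<sigma> i = x i)} = {}" using x by blast
  then show ?thesis unfolding cond_ext_def by (simp only: sum.empty div_0)
qed

text \<open>The indicator of agreeing with \<open>x\<close> on \<open>E\<close> has degree at most
  \<open>card E\<close>, which is below \<open>d\<close>.\<close>

lemma pure_sum_agreeing:
  assumes g: "pure n d g" and E: "E \<subseteq> {1..n}" "card E < d"
  shows "(\<Sum>\<sigma> | \<sigma> \<in> Sym n \<and> (\<forall>i\<in>E. \<sigma> i = x i). g \<sigma>) = 0"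
proof -
  have "ip n g (\<lambda>\<sigma>. if \<forall>i\<in>E. \<sigma> i = x i then 1 else 0) = 0"
    using g E deg_le_indicator[of E n "int d - 1" x] by (auto simp: pure_def)
  then have "(\<Sum>\<sigma>\<in>Sym n. if \<forall>i\<in>E. \<sigma> i = x i then g \<sigma> else 0) = 0"
    by (simp add: ip_eq card_Sym if_distrib[of "\<lambda>c. _ * c"] cong: if_cong)
  then show ?thesis by (simp add: sum.inter_filter[symmetric])
qed

lemma pure_cond_eq_0:
  assumes "pure n d g" "E \<subseteq> {1..n}" "card E < d" "\<sigma> \<in> Sym n"
  shows "cond n E g \<sigma> = 0"
  using cond_ext_eq[OF assms(4), of E \<sigma> g] pure_sum_agreeing[OF assms(1-3), of \<sigma>] by (simp add: cond_ext_def)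

lemma mono_fun_cond:
  assumes m: "m \<in> monomials n k" and I: "fst ` set_mset m \<subseteq> I"
  shows "cond n I (mono_fun m) = mono_fun m"
proof
  fix \<sigma>
  show "cond n I (mono_fun m) \<sigma> = mono_fun m \<sigma>"
  proof (rule group_avg_invariant[OF perm_group_fixing])
    fix \<phi> assume p: "\<phi> \<in> fixing n I"
    show "mono_fun m (\<sigma> \<circ> \<phi>) = mono_fun m \<sigma>"
      unfolding mono_fun_def
    proof (rule arg_cong[of _ _ prod_mset], rule image_mset_cong)
      fix q assume "q \<in># m"
      then have "\<phi> (fst q) = fst q" using I p by (auto simp: fixing_iff)
      then show "(case q of (i, j) \<Rightarrow> x_var i j (\<sigma> \<circ> \<phi>)) = (case q of (i, j) \<Rightarrow> x_var i j \<sigma>)"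
        by (simp add: case_prod_unfold x_var_def)
    qed
  qed
qed

text \<open>A monomial of degree at most \<open>d\<close> involves at most \<open>d\<close>
  coordinates, so it is fixed by \<open>cond n I\<close> for some \<open>I\<close> of size exactly
  \<open>d\<close>, available since \<open>d \<le> n\<close>. By self-adjointness \<open>e\<close>
  is orthogonal to it.\<close>

lemma deg_le_cond_zero:
  assumes d: "d \<le> n" and e: "deg_le n (int d) e"
    and z: "\<And>I \<sigma>. I \<subseteq> {1..n} \<Longrightarrow> card I = d \<Longrightarrow> \<sigma> \<in> Sym n \<Longrightarrow> cond n I e \<sigma> = 0"
  shows "\<forall>\<sigma>\<in>Sym n. e \<sigma> = 0"
proof -
  obtain c where c: "\<And>\<sigma>. \<sigma> \<in> Sym n \<Longrightarrow> e \<sigma> = (\<Sum>m\<in>monomials n (int d). c m * mono_fun m \<sigma>)"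
    using e by (auto simp: deg_le_def)
  have "ip n e (mono_fun m) = 0" if m: "m \<in> monomials n (int d)" for m
  proof -
    let ?E = "fst ` set_mset m"
    have E: "?E \<subseteq> {1..n}" using m by (auto simp: monomials_def)
    have "card ?E \<le> card (set_mset m)" by (rule card_image_le) simp
    also have "\<dots> \<le> size m" unfolding size_multiset_overloaded_eq
      by (subst card_eq_sum) (intro sum_mono, simp add: Suc_le_eq)
    also have "\<dots> \<le> d" using m by (simp add: monomials_def)
    finally obtain I where I: "?E \<subseteq> I" "I \<subseteq> {1..n}" "card I = d"
      using exists_subset_between[of ?E d "{1..n}"] E d by auto
    have "ip n e (mono_fun m) = ip n e (cond n I (mono_fun m))" by (simp only: mono_fun_cond[OF m I(1)])
    also have "\<dots> = ip n (cond n I e) (mono_fun m)" by (rule cond_selfadjoint[symmetric])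
    also have "\<dots> = ip n (mono_fun m) (\<lambda>\<sigma>. 0)" unfolding ip_commute[of n _ "mono_fun m"]
      by (intro ip_cong refl z I)
    finally show ?thesis by simp
  qed
  then have "ip n e (\<lambda>\<sigma>. \<Sum>m\<in>monomials n (int d). c m * mono_fun m \<sigma>) = 0"
    by (simp add: ip_sum_right ip_cmult_right)
  moreover have "ip n e e = ip n e (\<lambda>\<sigma>. \<Sum>m\<in>monomials n (int d). c m * mono_fun m \<sigma>)"
    by (intro ip_cong refl c)
  ultimately show ?thesis by (simp add: ip_eq_0_iff)
qed

section \<open>The level operator and its lower bound on level d\<close>

definition level_op :: "nat \<Rightarrow> nat \<Rightarrow> ((nat \<Rightarrow> nat) \<Rightarrow> real) \<Rightarrow> (nat \<Rightarrow> nat) \<Rightarrow> real" where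
  "level_op n d g \<sigma> = (\<Sum>I | I \<subseteq> {1..n} \<and> card I = d. cond n I g \<sigma>)"

lemma ip_level_op: "ip n f (level_op n d g) = (\<Sum>I | I \<subseteq> {1..n} \<and> card I = d. ip n (cond n I f) (cond n I g))"
  by (simp add: level_op_def[abs_def] ip_sum_right ip_cond)

lemma level_op_linear:
  "level_op n d (\<lambda>\<sigma>. \<Sum>t\<in>T. c t * g t \<sigma>) \<sigma> = (\<Sum>t\<in>T. c t * level_op n d (g t) \<sigma>)"
  "level_op n d (\<lambda>\<sigma>. f \<sigma> - h \<sigma>) \<sigma> = level_op n d f \<sigma> - level_op n d h \<sigma>"
proof -
  have "cond n I (\<lambda>\<sigma>. \<Sum>t\<in>T. c t * g t \<sigma>) \<sigma> = (\<Sum>t\<in>T. c t * cond n I (g t) \<sigma>)" for I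
    unfolding group_avg_def by (subst sum.swap) (simp add: sum_divide_distrib sum_distrib_left)
  then show "level_op n d (\<lambda>\<sigma>. \<Sum>t\<in>T. c t * g t \<sigma>) \<sigma> = (\<Sum>t\<in>T. c t * level_op n d (g t) \<sigma>)"
    unfolding level_op_def by (simp add: sum_distrib_left) (rule sum.swap)
  show "level_op n d (\<lambda>\<sigma>. f \<sigma> - h \<sigma>) \<sigma> = level_op n d f \<sigma> - level_op n d h \<sigma>"
    by (simp add: level_op_def group_avg_def sum_subtractf diff_divide_distrib)
qed

lemma level_op_deg_le: "deg_le n k g \<Longrightarrow> deg_le n k (level_op n d g)"
  unfolding level_op_def[abs_def] by (intro deg_le_sum deg_le_cond)

lemma level_op_pure: "pure n d g \<Longrightarrow> pure n d (level_op n e g)"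
  unfolding level_op_def[abs_def] by (intro pure_sum pure_cond)

text \<open>On functions of degree at most \<open>d\<close> the operator defines a positive form
  with trivial kernel. The residue \<open>e\<close> of \<open>g\<close> after projection to the
  range satisfies \<open>ip n e (level_op n d e) = 0\<close>, hence vanishes. A preimage of a pure
  function can be chosen pure because the operator preserves both purity and lower degrees.\<close>

lemma level_op_surj:
  assumes d: "d \<le> n" and g: "pure n d g"
  shows "\<exists>h. pure n d h \<and> (\<forall>\<sigma>\<in>Sym n. g \<sigma> = level_op n d h \<sigma>)"
proof -
  let ?M = "level_op n d"
  have gd: "deg_le n (int d) g" using g by (simp add: pure_def)
  obtain c where c: "\<And>a. a \<in> monomials n (int d) \<Longrightarrow> ip n (\<lambda>\<sigma>. g \<sigma> - (\<Sum>m\<in>monomials n (int d). c m * ?M (mono_fun m) \<sigma>)) (?M (mono_fun a)) = 0"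
    using ip_orth_exists[OF finite_monomials, of n "int d" n g "\<lambda>m. ?M (mono_fun m)"] by auto
  define h where "h = (\<lambda>\<sigma>. \<Sum>m\<in>monomials n (int d). c m * mono_fun m \<sigma>)"
  have hd: "deg_le n (int d) h" unfolding deg_le_def h_def by blast
  define e where "e = (\<lambda>\<sigma>. g \<sigma> - ?M h \<sigma>)"
  have ed: "deg_le n (int d) e" unfolding e_def by (intro deg_le_diff gd level_op_deg_le hd)
  have orth: "ip n e (?M (mono_fun a)) = 0" if "a \<in> monomials n (int d)" for a
    using c[OF that] by (simp add: e_def h_def level_op_linear)
  obtain b where b: "\<And>\<sigma>. \<sigma> \<in> Sym n \<Longrightarrow> e \<sigma> = (\<Sum>m\<in>monomials n (int d). b m * mono_fun m \<sigma>)"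
    using ed by (auto simp: deg_le_def)
  have "ip n e (?M e) = ip n e (?M (\<lambda>\<sigma>. \<Sum>m\<in>monomials n (int d). b m * mono_fun m \<sigma>))"
  proof (intro ip_cong refl)
    fix \<sigma> assume s: "\<sigma> \<in> Sym n"
    have "e (\<sigma> \<circ> \<phi>) = (\<Sum>m\<in>monomials n (int d). b m * mono_fun m (\<sigma> \<circ> \<phi>))" if "\<phi> \<in> fixing n I" for \<phi> I
      by (rule b[OF Sym_comp[OF s fixing_Sym[OF that]]])
    then show "?M e \<sigma> = ?M (\<lambda>\<sigma>. \<Sum>m\<in>monomials n (int d). b m * mono_fun m \<sigma>) \<sigma>"
      by (simp add: level_op_def group_avg_def cong: sum.cong)
  qed
  also have "?M (\<lambda>\<sigma>. \<Sum>m\<in>monomials n (int d). b m * mono_fun m \<sigma>) = (\<lambda>\<sigma>. \<Sum>m\<in>monomials n (int d). b m * ?M (mono_fun m) \<sigma>)"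
    by (rule ext) (rule level_op_linear(1))
  also have "ip n e \<dots> = 0" by (simp add: ip_sum_right ip_cmult_right orth)
  finally have "(\<Sum>I | I \<subseteq> {1..n} \<and> card I = d. ip n (cond n I e) (cond n I e)) = 0"
    by (simp add: ip_level_op)
  then have "ip n (cond n I e) (cond n I e) = 0" if "I \<subseteq> {1..n}" "card I = d" for I
    using that by (subst (asm) sum_nonneg_eq_0_iff) (auto intro: ip_ge_0)
  then have "\<forall>\<sigma>\<in>Sym n. e \<sigma> = 0"
    by (intro deg_le_cond_zero[OF d ed]) (simp add: ip_eq_0_iff)
  then have gM: "g \<sigma> = ?M h \<sigma>" if "\<sigma> \<in> Sym n" for \<sigma> using that by (simp add: e_def)
  \<comment> \<open>\<open>?M p\<close> has degree below \<open>d\<close> and equals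
    \<open>g - ?M h'\<close> on \<open>Sym n\<close>, a difference of functions orthogonal to lower
    degrees; so it is 0, and \<open>h'\<close> is a pure preimage.\<close>
  define p where "p = proj_le n (int d - 1) h"
  have pd: "deg_le n (int d - 1) p" unfolding p_def by (rule proj_le_properties)
  define h' where "h' = (\<lambda>\<sigma>. h \<sigma> - p \<sigma>)"
  have h'p: "pure n d h'"
    unfolding pure_def h'_def p_def
    using hd pd[unfolded p_def] deg_le_increasing[of "int d - 1" "int d" n]
    by (auto intro!: deg_le_diff proj_le_properties(2))
  have Mp: "deg_le n (int d - 1) (?M p)" by (intro level_op_deg_le pd)
  have "ip n (?M p) (?M p) = ip n (\<lambda>\<sigma>. g \<sigma> - ?M h' \<sigma>) (?M p)"
    by (intro ip_cong refl) (simp add: gM h'_def level_op_linear)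
  also have "\<dots> = 0"
    using g level_op_pure[OF h'p] Mp by (simp add: ip_diff_left pure_def)
  finally have "\<forall>\<sigma>\<in>Sym n. ?M p \<sigma> = 0" by (simp add: ip_eq_0_iff)
  then have "g \<sigma> = ?M h' \<sigma>" if "\<sigma> \<in> Sym n" for \<sigma>
    using that by (simp add: gM h'_def level_op_linear)
  then show ?thesis using h'p by blast
qed

lemma ip_cauchy_schwarz_sum:
  assumes "finite T"
  shows "(\<Sum>t\<in>T. ip n (f t) (g t))\<^sup>2 \<le> (\<Sum>t\<in>T. ip n (f t) (f t)) * (\<Sum>t\<in>T. ip n (g t) (g t))"
proof -
  have e: "(\<Sum>t\<in>T. ip n (f t) (g t)) = (\<Sum>p\<in>T \<times> Sym n. (1 / card (Sym n)) * (f (fst p) (snd p) * g (fst p) (snd p)))" for f g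
    by (simp add: ip_eq sum.cartesian_product' sum_divide_distrib)
  show ?thesis unfolding e
    using weighted_cauchy_schwarz[of "T \<times> Sym n" "\<lambda>_. 1 / card (Sym n)" "\<lambda>p. f (fst p) (snd p)" "\<lambda>p. g (fst p) (snd p)"]
    by (simp add: power2_eq_square)
qed

text \<open>With \<open>g\<close> the image of \<open>h\<close>, Cauchy-Schwarz bounds
  \<open>(ip n g g)\<^sup>2\<close> by the form of \<open>g\<close> times the form of
  \<open>h\<close>, and the latter is at most \<open>ip n g g\<close> by
  \<open>level_operator_square\<close>. This takes the place of diagonalising the operator, whose
  eigenvalues on this level are at least 1.\<close>

theorem pure_norm_le:
  assumes d: "d \<le> n" and g: "pure n d g"
  shows "ip n g g \<le> (\<Sum>I | I \<subseteq> {1..n} \<and> card I = d. ip n (cond n I g) (cond n I g))"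
proof -
  let ?S = "{I. I \<subseteq> {1..n} \<and> card I = d}"
  define N where "N = (\<lambda>g. \<Sum>I\<in>?S. ip n (cond n I g) (cond n I g))"
  obtain h where h: "pure n d h" "\<And>\<sigma>. \<sigma> \<in> Sym n \<Longrightarrow> g \<sigma> = level_op n d h \<sigma>"
    using level_op_surj[OF d g] by blast
  have gg: "ip n g g = ip n g (level_op n d h)" by (intro ip_cong refl h(2))
  have MM: "ip n g g = ip n (level_op n d h) (level_op n d h)" by (intro ip_cong h(2))
  have "N h = ip n h (level_op n d h)" by (simp add: N_def ip_level_op)
  also have "\<dots> \<le> ip n (level_op n d h) (level_op n d h)"
    using level_operator_square[of n d h, OF pure_cond_eq_0[OF h(1)]] by (simp add: level_op_def[abs_def])
  finally have Nh: "N h \<le> ip n g g" using MM by simp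
  have "(ip n g g)\<^sup>2 = (\<Sum>I\<in>?S. ip n (cond n I g) (cond n I h))\<^sup>2" by (simp add: gg ip_level_op)
  also have "\<dots> \<le> N g * N h" unfolding N_def by (rule ip_cauchy_schwarz_sum) simp
  also have "\<dots> \<le> N g * ip n g g" using Nh by (intro mult_left_mono) (auto simp: N_def intro: sum_nonneg ip_ge_0)
  finally have *: "ip n g g * ip n g g \<le> N g * ip n g g" by (simp add: power2_eq_square)
  show ?thesis
  proof (cases "ip n g g = 0")
    case True
    then show ?thesis by (simp add: sum_nonneg ip_ge_0)
  next
    case False
    then have "ip n g g > 0" using ip_ge_0[of n g] by simp
    then show ?thesis using * by (simp add: N_def)
  qed
qed

section \<open>Coupling the symmetric group with a product space\<close>

declare One_nat_def [simp del]

lemma E_unif_sum: "finite U \<Longrightarrow> U \<noteq> {} \<Longrightarrow> E_unif U h = sum h U / card U"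
  unfolding E_unif_def by (rule integral_pmf_of_set)

lemma Sym_inverse [simp]:
  "\<sigma> \<in> Sym n \<Longrightarrow> inv \<sigma> (\<sigma> i) = i" "\<sigma> \<in> Sym n \<Longrightarrow> \<sigma> (inv \<sigma> i) = i"
  by (simp_all add: Sym_iff permutes_inverses)

lemma Sym_in: "\<sigma> \<in> Sym n \<Longrightarrow> \<sigma> i \<in> {1..n} \<longleftrightarrow> i \<in> {1..n}"
  by (simp only: Sym_iff permutes_in_image)

text \<open>The permutations coupled to a point \<open>x\<close> of the product space: a permutation must take each
  value of \<open>x\<close> at some coordinate where \<open>x\<close> takes it.\<close>

definition coupled :: "nat \<Rightarrow> (nat \<Rightarrow> nat) \<Rightarrow> (nat \<Rightarrow> nat) set" where
  "coupled n x = {\<sigma> \<in> Sym n. \<forall>i\<in>{1..n}. x (inv \<sigma> (x i)) = x i}"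

text \<open>The conditional expectation of \<open>f\<close> given \<open>x\<close> under the
  coupling. The default 0 concerns points with values outside \<open>{1..n}\<close>, which enter
  averages through coordinates that are not resampled.\<close>

definition lift :: "nat \<Rightarrow> ((nat \<Rightarrow> nat) \<Rightarrow> real) \<Rightarrow> (nat \<Rightarrow> nat) \<Rightarrow> real" where
  "lift n f x = (if x ` {1..n} \<subseteq> {1..n} then (\<Sum>\<sigma>\<in>coupled n x. f \<sigma>) / card (coupled n x) else 0)"

lemma finite_coupled [simp]: "finite (coupled n x)"
  by (rule finite_subset[of _ "Sym n"]) (auto simp: coupled_def)

lemma coupled_Sym: "\<sigma> \<in> coupled n x \<Longrightarrow> \<sigma> \<in> Sym n" by (simp add: coupled_def)

text \<open>A section of \<open>x\<close> over its image, extended to a permutation, is the inverse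
  of a coupled one.\<close>

lemma coupled_nonempty:
  assumes "x ` {1..n} \<subseteq> {1..n}" shows "coupled n x \<noteq> {}"
proof -
  define h where "h = (\<lambda>v. SOME s. s \<in> {1..n} \<and> x s = v)"
  have h: "h (x i) \<in> {1..n}" "x (h (x i)) = x i" if "i \<in> {1..n}" for i
    using someI[of "\<lambda>s. s \<in> {1..n} \<and> x s = x i" i] that by (auto simp: h_def)
  have "inj_on h (x ` {1..n})" by (rule inj_on_inverseI[of _ x]) (use h in auto)
  moreover have "h ` (x ` {1..n}) \<subseteq> {1..n}" using h by blast
  ultimately obtain \<tau> where t: "\<tau> permutes {1..n}" "\<forall>a\<in>x ` {1..n}. \<tau> a = h a"
    using extend_to_permutation[of "{1..n}" "x ` {1..n}" h] assms by auto
  then have "inv \<tau> \<in> coupled n x"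
    using h by (auto simp: coupled_def Sym_iff permutes_inv permutes_inv_inv)
  then show ?thesis by auto
qed

lemma card_coupled_pos: "x ` {1..n} \<subseteq> {1..n} \<Longrightarrow> card (coupled n x) > 0"
  using coupled_nonempty by (simp add: card_gt_0_iff)

lemma coupled_cong:
  assumes x: "x ` {1..n} \<subseteq> {1..n}" and e: "\<And>i. i \<in> {1..n} \<Longrightarrow> x i = x' i"
  shows "coupled n x = coupled n x'"
proof -
  have "x (inv \<sigma> (x i)) = x' (inv \<sigma> (x' i))" if "\<sigma> \<in> Sym n" "i \<in> {1..n}" for \<sigma> i
  proof -
    have "x i \<in> {1..n}" using x that by blast
    then have "inv \<sigma> (x i) \<in> {1..n}" using Sym_in[OF Sym_inv[OF that(1)]] by blast
    then show ?thesis using e that by simp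
  qed
  then show ?thesis using e by (auto simp: coupled_def)
qed

lemma lift_cong:
  assumes "\<And>i. i \<in> {1..n} \<Longrightarrow> x i = x' i" shows "lift n f x = lift n f x'"
proof -
  have im: "x ` {1..n} = x' ` {1..n}" using assms by (rule image_cong[OF refl])
  show ?thesis
  proof (cases "x ` {1..n} \<subseteq> {1..n}")
    case True
    have "coupled n x = coupled n x'" by (rule coupled_cong[OF True assms])
    then show ?thesis using im by (simp only: lift_def)
  next
    case False
    then show ?thesis using im by (simp only: lift_def if_False)
  qed
qed

lemma coupled_equivariant:
  assumes "\<pi> \<in> Sym n" shows "bij_betw (\<lambda>\<sigma>. \<pi> \<circ> \<sigma>) (coupled n x) (coupled n (\<pi> \<circ> x))"
proof (rule bij_betw_byWitness[where f' = "\<lambda>\<sigma>. inv \<pi> \<circ> \<sigma>"])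
  have o: "inv (\<pi> \<circ> \<sigma>) = inv \<sigma> \<circ> inv \<pi>" "inv (inv \<pi> \<circ> \<sigma>) = inv \<sigma> \<circ> \<pi>" if "\<sigma> \<in> Sym n" for \<sigma>
    using assms that by (simp_all add: Sym_iff o_inv_distrib permutes_bij permutes_inv permutes_inv_inv bij_imp_bij_inv)
  show "(\<lambda>\<sigma>. \<pi> \<circ> \<sigma>) ` coupled n x \<subseteq> coupled n (\<pi> \<circ> x)"
    using assms by (auto simp: coupled_def Sym_comp o)
  show "(\<lambda>\<sigma>. inv \<pi> \<circ> \<sigma>) ` coupled n (\<pi> \<circ> x) \<subseteq> coupled n x"
  proof (rule image_subsetI)
    fix \<sigma> assume s: "\<sigma> \<in> coupled n (\<pi> \<circ> x)"
    then have S: "\<sigma> \<in> Sym n" by (simp add: coupled_def)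
    have "x (inv \<sigma> (\<pi> (x i))) = x i" if "i \<in> {1..n}" for i
    proof -
      have "\<pi> (x (inv \<sigma> (\<pi> (x i)))) = \<pi> (x i)" using s that by (simp add: coupled_def)
      then show ?thesis using Sym_inverse(1)[OF assms] by metis
    qed
    then show "inv \<pi> \<circ> \<sigma> \<in> coupled n x"
      using S assms by (simp add: coupled_def Sym_comp Sym_inv o)
  qed
qed (use assms in \<open>auto simp: comp_assoc[symmetric]\<close>)

lemma lift_equivariant:
  assumes "\<pi> \<in> Sym n" shows "lift n f (\<pi> \<circ> x) = lift n (\<lambda>\<sigma>. f (\<pi> \<circ> \<sigma>)) x"
proof -
  have "(\<pi> \<circ> x) ` {1..n} \<subseteq> {1..n} \<longleftrightarrow> x ` {1..n} \<subseteq> {1..n}"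
    using Sym_in[OF assms] by (auto simp del: atLeastAtMost_iff)
  then show ?thesis
    using sum.reindex_bij_betw[OF coupled_equivariant[OF assms, of x], of f] bij_betw_same_card[OF coupled_equivariant[OF assms, of x]]
    by (simp add: lift_def)
qed

lemma lift_sum: "lift n (\<lambda>\<sigma>. \<Sum>t\<in>T. f t \<sigma>) x = (\<Sum>t\<in>T. lift n (f t) x)"
proof -
  have "(\<Sum>\<sigma>\<in>coupled n x. \<Sum>t\<in>T. f t \<sigma>) = (\<Sum>t\<in>T. \<Sum>\<sigma>\<in>coupled n x. f t \<sigma>)" by (rule sum.swap)
  then show ?thesis by (simp add: lift_def sum_divide_distrib)
qed

lemma lift_le_const:
  assumes "\<And>\<sigma>. \<sigma> \<in> Sym n \<Longrightarrow> f \<sigma> \<le> c" "c \<ge> 0" shows "lift n f x \<le> c"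
proof (cases "x ` {1..n} \<subseteq> {1..n}")
  case True
  have "(\<Sum>\<sigma>\<in>coupled n x. f \<sigma>) \<le> card (coupled n x) * c"
    by (rule sum_bounded_above) (rule assms(1)[OF coupled_Sym])
  then show ?thesis using card_coupled_pos[OF True] True by (simp add: lift_def field_simps)
qed (use assms in \<open>simp add: lift_def\<close>)

lemma lift_abs: "\<bar>lift n f x\<bar> \<le> lift n (\<lambda>\<sigma>. \<bar>f \<sigma>\<bar>) x"
  by (simp add: lift_def divide_right_mono sum_abs)

lemma lift_square: "(lift n f x)\<^sup>2 \<le> lift n (\<lambda>\<sigma>. (f \<sigma>)\<^sup>2) x"
proof (cases "x ` {1..n} \<subseteq> {1..n}")
  case True
  let ?c = "real (card (coupled n x))"
  have c: "?c > 0" using card_coupled_pos[OF True] by simp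
  have "(\<Sum>\<sigma>\<in>coupled n x. f \<sigma>)\<^sup>2 \<le> (\<Sum>\<sigma>\<in>coupled n x. (f \<sigma>)\<^sup>2) * ?c"
    using Cauchy_Schwarz_ineq_sum[of f "\<lambda>_. 1" "coupled n x"] by simp
  then have "(\<Sum>\<sigma>\<in>coupled n x. f \<sigma>)\<^sup>2 / ?c\<^sup>2 \<le> (\<Sum>\<sigma>\<in>coupled n x. (f \<sigma>)\<^sup>2) * ?c / ?c\<^sup>2"
    by (intro divide_right_mono) auto
  then show ?thesis using True c coupled_nonempty[OF True] by (simp add: lift_def power_divide power2_eq_square)
qed (simp add: lift_def)

text \<open>The permutations \<open>\<pi> \<circ> \<sigma>\<close> with \<open>\<pi>\<close> fixing
  \<open>V\<close> are exactly those sending \<open>inv \<sigma> v\<close> to \<open>v\<close> for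
  each \<open>v\<close> in \<open>V\<close>: an umvirate with \<open>card V\<close>
  constraints.\<close>

lemma sum_left_umvirate:
  fixes h :: "(nat \<Rightarrow> nat) \<Rightarrow> real" and b :: real
  assumes s: "\<sigma> \<in> Sym n" and V: "V \<subseteq> {1..n}"
    and b: "\<And>I J. I \<in> tuples n (card V) \<Longrightarrow> J \<in> tuples n (card V) \<Longrightarrow> E_unif (umvirate n I J) h \<le> b"
  shows "(\<Sum>\<pi>\<in>fixing n V. h (\<pi> \<circ> \<sigma>)) \<le> card (fixing n V) * b"
proof -
  have fV: "finite V" using V by (rule finite_subset) simp
  define J where "J = sorted_list_of_set V"
  define I where "I = map (inv \<sigma>) J"
  have J: "set J = V" "distinct J" "length J = card V" using fV by (simp_all add: J_def)
  have inj: "inj (inv \<sigma>)" using Sym_inv[OF s] by (simp add: Sym_iff permutes_inj)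
  have "J \<in> tuples n (card V)" using J V by (simp add: tuples_def)
  moreover have "I \<in> tuples n (card V)"
    using J V inj Sym_in[OF Sym_inv[OF s]]
    by (auto simp: tuples_def I_def distinct_map simp del: atLeastAtMost_iff intro: inj_on_subset)
  ultimately have bound: "E_unif (umvirate n I J) h \<le> b" by (intro b)
  have U: "umvirate n I J = {\<tau> \<in> Sym n. \<forall>v\<in>V. \<tau> (inv \<sigma> v) = v}"
    unfolding umvirate_def J(1)[symmetric] by (auto simp: I_def all_set_conv_all_nth)
  have bij: "bij_betw (\<lambda>\<pi>. \<pi> \<circ> \<sigma>) (fixing n V) (umvirate n I J)"
    unfolding U
  proof (rule bij_betw_byWitness[where f' = "\<lambda>\<tau>. \<tau> \<circ> inv \<sigma>"])
    show "(\<lambda>\<pi>. \<pi> \<circ> \<sigma>) ` fixing n V \<subseteq> {\<tau> \<in> Sym n. \<forall>v\<in>V. \<tau> (inv \<sigma> v) = v}"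
      using s by (auto simp: fixing_iff Sym_comp)
    show "(\<lambda>\<tau>. \<tau> \<circ> inv \<sigma>) ` {\<tau> \<in> Sym n. \<forall>v\<in>V. \<tau> (inv \<sigma> v) = v} \<subseteq> fixing n V"
      using s by (auto simp: fixing_iff Sym_comp Sym_inv)
  qed (use s in \<open>auto simp: comp_assoc\<close>)
  have fin: "finite (umvirate n I J)" unfolding U by simp
  have card: "card (umvirate n I J) = card (fixing n V)" using bij_betw_same_card[OF bij] by simp
  then have ne: "umvirate n I J \<noteq> {}" using card_fixing_pos[of n V] by auto
  have "(\<Sum>\<pi>\<in>fixing n V. h (\<pi> \<circ> \<sigma>)) = (\<Sum>\<tau>\<in>umvirate n I J. h \<tau>)"
    using sum.reindex_bij_betw[OF bij, of h] by simp
  also have "\<dots> = card (fixing n V) * E_unif (umvirate n I J) h"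
    using card_fixing_pos[of n V] by (simp add: E_unif_sum[OF fin ne] card)
  also have "\<dots> \<le> card (fixing n V) * b" using bound by (intro mult_left_mono) auto
  finally show ?thesis .
qed

section \<open>Biglobalness of the lifted function\<close>

locale sym_coupling =
  fixes n :: nat
  assumes n_pos: "n > 0"

sublocale sym_coupling \<subseteq> finite_avg "{1..n}"
  by unfold_locales (use n_pos in auto)

context sym_coupling begin

lemma AV_values_permute:
  fixes H :: "(nat \<Rightarrow> nat) \<Rightarrow> real"
  assumes "\<pi> \<in> Sym n"
  shows "AV A H x = AV A (\<lambda>z. H (\<lambda>i. if i \<in> A then \<pi> (z i) else z i)) x"
proof -
  have i: "\<pi> j \<in> {1..n} \<longleftrightarrow> j \<in> {1..n}" "inv \<pi> j \<in> {1..n} \<longleftrightarrow> j \<in> {1..n}" for j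
    using Sym_in[OF assms] Sym_in[OF Sym_inv[OF assms]] by blast+
  have "(\<Sum>y\<in>A \<rightarrow>\<^sub>E {1..n}. H (override_on x y A)) = (\<Sum>y\<in>A \<rightarrow>\<^sub>E {1..n}. H (override_on x (restrict (\<pi> \<circ> y) A) A))"
    by (rule sum.reindex_bij_witness[of _ "\<lambda>y. restrict (\<pi> \<circ> y) A" "\<lambda>y. restrict (inv \<pi> \<circ> y) A"])
       (use assms i in \<open>auto simp: PiE_iff fun_eq_iff extensional_def restrict_def override_on_def
          intro!: arg_cong[of _ _ H] simp del: atLeastAtMost_iff\<close>)
  also have "\<dots> = (\<Sum>y\<in>A \<rightarrow>\<^sub>E {1..n}. H (\<lambda>i. if i \<in> A then \<pi> (override_on x y A i) else override_on x y A i))"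
    by (intro sum.cong refl arg_cong[of _ _ H]) (auto simp: override_on_def fun_eq_iff)
  finally show ?thesis by (simp add: AV_def)
qed

text \<open>Relabelling values by a permutation that fixes the values of \<open>x\<close> on
  \<open>S\<close> preserves the resampling and acts on \<open>h\<close> by left translation;
  averaging over all such permutations leaves averages over umvirates. As \<open>x\<close> may
  repeat values on \<open>S\<close>, fewer than \<open>card S\<close> constraints can occur, hence
  the assumption for all \<open>t \<le> card S\<close>.\<close>

lemma AV_lift_bound:
  assumes S: "S \<subseteq> {1..n}" and b0: "b \<ge> 0"
    and b: "\<And>t I J. t \<le> card S \<Longrightarrow> I \<in> tuples n t \<Longrightarrow> J \<in> tuples n t \<Longrightarrow> E_unif (umvirate n I J) h \<le> b"
  shows "AV ({1..n} - S) (lift n h) x \<le> b"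
proof (cases "x ` S \<subseteq> {1..n}")
  case False
  have "lift n h y = 0" if "\<And>i. i \<notin> {1..n} - S \<Longrightarrow> y i = x i" for y
  proof -
    have "\<not> y ` {1..n} \<subseteq> {1..n}" using False that S by (auto simp del: atLeastAtMost_iff) (metis image_eqI subsetD)
    then show ?thesis by (simp add: lift_def)
  qed
  then have "AV ({1..n} - S) (lift n h) x \<le> AV ({1..n} - S) (\<lambda>x. 0) x" by (intro AV_mono_on) auto
  then show ?thesis using b0 by simp
next
  case True
  define V where "V = x ` S"
  have V: "V \<subseteq> {1..n}" "card V \<le> card S"
    using True S by (auto simp: V_def intro: card_image_le finite_subset[OF S] simp del: atLeastAtMost_iff)
  let ?c = "real (card (fixing n V))"
  have c: "?c > 0" using card_fixing_pos[of n V] by simp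
  have inv: "AV ({1..n} - S) (lift n h) x = AV ({1..n} - S) (lift n (\<lambda>\<sigma>. h (\<pi> \<circ> \<sigma>))) x" if p: "\<pi> \<in> fixing n V" for \<pi>
  proof -
    have S': "\<pi> \<in> Sym n" using p by (rule fixing_Sym)
    have "AV ({1..n} - S) (lift n h) x = AV ({1..n} - S) (\<lambda>z. lift n h (\<lambda>i. if i \<in> {1..n} - S then \<pi> (z i) else z i)) x"
      by (rule AV_values_permute[OF S'])
    also have "\<dots> = AV ({1..n} - S) (lift n (\<lambda>\<sigma>. h (\<pi> \<circ> \<sigma>))) x"
    proof -
      have "lift n h (\<lambda>i. if i \<in> {1..n} - S then \<pi> (z i) else z i) = lift n (\<lambda>\<sigma>. h (\<pi> \<circ> \<sigma>)) z"
        if z: "\<And>i. i \<notin> {1..n} - S \<Longrightarrow> z i = x i" for z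
      proof -
        have "lift n h (\<lambda>i. if i \<in> {1..n} - S then \<pi> (z i) else z i) = lift n h (\<pi> \<circ> z)"
        proof (rule lift_cong)
          fix i assume "i \<in> {1..n}"
          show "(if i \<in> {1..n} - S then \<pi> (z i) else z i) = (\<pi> \<circ> z) i"
          proof (cases "i \<in> S")
            case True
            then have "z i \<in> V" using z by (auto simp: V_def)
            then have "\<pi> (z i) = z i" using p by (auto simp: fixing_iff)
            then show ?thesis using True by simp
          qed (use \<open>i \<in> {1..n}\<close> in simp)
        qed
        then show ?thesis by (simp only: lift_equivariant[OF S'])
      qed
      then show ?thesis by (intro antisym AV_mono_on) auto
    qed
    finally show ?thesis .
  qed
  have "?c * AV ({1..n} - S) (lift n h) x = (\<Sum>\<pi>\<in>fixing n V. AV ({1..n} - S) (lift n h) x)" by simp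
  also have "\<dots> = (\<Sum>\<pi>\<in>fixing n V. AV ({1..n} - S) (lift n (\<lambda>\<sigma>. h (\<pi> \<circ> \<sigma>))) x)"
    by (intro sum.cong refl inv)
  also have "\<dots> = AV ({1..n} - S) (\<lambda>z. lift n (\<lambda>\<sigma>. \<Sum>\<pi>\<in>fixing n V. h (\<pi> \<circ> \<sigma>)) z) x"
    by (simp add: lift_sum AV_sum)
  also have "\<dots> \<le> AV ({1..n} - S) (\<lambda>z. ?c * b) x"
    using b0 by (intro AV_mono lift_le_const sum_left_umvirate[OF _ V(1) b[OF V(2)]]) auto
  also have "\<dots> = ?c * b" by simp
  finally show ?thesis using c by simp
qed

lemma lift_product_biglobal:
  assumes glob: "biglobal n r \<gamma>1 \<gamma>2 d f" and r: "r \<ge> 1" and \<gamma>: "\<gamma>1 \<ge> 0" "\<gamma>2 \<ge> 0"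
  shows "product_biglobal {1..n} r \<gamma>1 \<gamma>2 d (lift n f)"
  unfolding product_biglobal_def
proof (intro allI impI)
  fix S x assume S: "S \<subseteq> {1..n}" "card S \<le> d"
  \<comment> \<open>\<open>r \<ge> 1\<close> lets umvirates with fewer than \<open>card S\<close>
    constraints satisfy the bound for \<open>card S\<close>.\<close>
  have mono: "r ^ t \<le> r ^ card S" if "t \<le> card S" for t using that r by (intro power_increasing) auto
  have one: "E_unif (umvirate n I J) (\<lambda>\<sigma>. \<bar>f \<sigma>\<bar>) \<le> r ^ card S * \<gamma>1"
    if t: "t \<le> card S" and IJ: "I \<in> tuples n t" "J \<in> tuples n t" for t I J
  proof -
    have "Lp_norm (umvirate n I J) 1 f \<le> r ^ t * \<gamma>1" using glob t S IJ unfolding biglobal_def by auto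
    also have "\<dots> \<le> r ^ card S * \<gamma>1" using mono[OF t] \<gamma> by (intro mult_right_mono) auto
    finally have "E_unif (umvirate n I J) (\<lambda>\<sigma>. \<bar>f \<sigma>\<bar>) powr 1 \<le> r ^ card S * \<gamma>1"
      by (simp add: Lp_norm_def)
    moreover have "E_unif (umvirate n I J) (\<lambda>\<sigma>. \<bar>f \<sigma>\<bar>) \<ge> 0"
      unfolding E_unif_def by (rule integral_nonneg_AE) simp
    ultimately show ?thesis by simp
  qed
  have two: "E_unif (umvirate n I J) (\<lambda>\<sigma>. (f \<sigma>)\<^sup>2) \<le> (r ^ card S * \<gamma>2)\<^sup>2"
    if t: "t \<le> card S" and IJ: "I \<in> tuples n t" "J \<in> tuples n t" for t I J
  proof -
    have "Lp_norm (umvirate n I J) 2 f \<le> r ^ t * \<gamma>2" using glob t S IJ unfolding biglobal_def by auto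
    also have "\<dots> \<le> r ^ card S * \<gamma>2" using mono[OF t] \<gamma> by (intro mult_right_mono) auto
    finally have "E_unif (umvirate n I J) (\<lambda>\<sigma>. (f \<sigma>)\<^sup>2) powr (1/2) \<le> r ^ card S * \<gamma>2"
      by (simp add: Lp_norm_def)
    moreover have "E_unif (umvirate n I J) (\<lambda>\<sigma>. (f \<sigma>)\<^sup>2) \<ge> 0"
      unfolding E_unif_def by (rule integral_nonneg_AE) simp
    ultimately have "sqrt (E_unif (umvirate n I J) (\<lambda>\<sigma>. (f \<sigma>)\<^sup>2)) \<le> r ^ card S * \<gamma>2"
      by (simp add: powr_half_sqrt)
    then show ?thesis by (rule sqrt_le_D)
  qed
  have "AV ({1..n} - S) (\<lambda>z. \<bar>lift n f z\<bar>) x \<le> AV ({1..n} - S) (lift n (\<lambda>\<sigma>. \<bar>f \<sigma>\<bar>)) x"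
    by (intro AV_mono lift_abs)
  also have "\<dots> \<le> r ^ card S * \<gamma>1"
    using r \<gamma> by (intro AV_lift_bound[OF S(1)] one) auto
  finally have 1: "AV ({1..n} - S) (\<lambda>z. \<bar>lift n f z\<bar>) x \<le> r ^ card S * \<gamma>1" .
  have "AV ({1..n} - S) (\<lambda>z. (lift n f z)\<^sup>2) x \<le> AV ({1..n} - S) (lift n (\<lambda>\<sigma>. (f \<sigma>)\<^sup>2)) x"
    by (intro AV_mono lift_square)
  also have "\<dots> \<le> (r ^ card S * \<gamma>2)\<^sup>2"
    by (intro AV_lift_bound[OF S(1)] two) auto
  finally show "AV ({1..n} - S) (\<lambda>z. \<bar>lift n f z\<bar>) x \<le> r ^ card S * \<gamma>1 \<and>
     AV ({1..n} - S) (\<lambda>z. (lift n f z)\<^sup>2) x \<le> (r ^ card S * \<gamma>2)\<^sup>2" using 1 by simp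
qed

section \<open>Extensions of conditional expectations to the product space\<close>

lemma av_cond_ext_out:
  assumes "i \<notin> I" shows "av i (cond_ext n I g) = cond_ext n I g"
proof
  fix x
  have "cond_ext n I g (x(i := j)) = cond_ext n I g x" for j
  proof -
    have "(\<forall>k\<in>I. \<sigma> k = (x(i := j)) k) \<longleftrightarrow> (\<forall>k\<in>I. \<sigma> k = x k)" for \<sigma> using assms by auto
    then show ?thesis by (simp add: cond_ext_def)
  qed
  then show "av i (cond_ext n I g) x = cond_ext n I g x" using n_pos by (simp add: av_def)
qed

text \<open>Summing over the value at \<open>i\<close> drops the constraint there, and the sum over
  agreement on the remaining \<open>d - 1\<close> points is 0 by purity. The extension therefore
  lies in the Efron-Stein component of \<open>I\<close>.\<close>

lemma av_cond_ext_in: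
  assumes g: "pure n d g" and I: "I \<subseteq> {1..n}" "card I = d" and i: "i \<in> I"
  shows "av i (cond_ext n I g) x = 0"
proof -
  let ?E = "I - {i}"
  have fI: "finite I" using I(1) by (rule finite_subset) simp
  have E: "?E \<subseteq> {1..n}" "card ?E < d" using I i card_Diff1_less[OF fI i] by blast+
  have "(\<Sum>\<sigma> | \<sigma> \<in> Sym n \<and> (\<forall>k\<in>?E. \<sigma> k = x k). g \<sigma>)
     = (\<Sum>j\<in>{1..n}. \<Sum>\<sigma> | \<sigma> \<in> {\<sigma>. \<sigma> \<in> Sym n \<and> (\<forall>k\<in>?E. \<sigma> k = x k)} \<and> \<sigma> i = j. g \<sigma>)"
  proof (rule sum.group[symmetric])
    show "(\<lambda>\<sigma>. \<sigma> i) ` {\<sigma>. \<sigma> \<in> Sym n \<and> (\<forall>k\<in>?E. \<sigma> k = x k)} \<subseteq> {1..n}"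
    proof (rule image_subsetI)
      fix \<sigma> assume "\<sigma> \<in> {\<sigma>. \<sigma> \<in> Sym n \<and> (\<forall>k\<in>?E. \<sigma> k = x k)}"
      then show "\<sigma> i \<in> {1..n}" using Sym_in[of \<sigma> n i] i I(1) by blast
    qed
  qed auto
  also have "\<dots> = (\<Sum>j\<in>{1..n}. \<Sum>\<sigma> | \<sigma> \<in> Sym n \<and> (\<forall>k\<in>I. \<sigma> k = (x(i := j)) k). g \<sigma>)"
    using i by (intro sum.cong refl) auto
  finally have "(\<Sum>j\<in>{1..n}. \<Sum>\<sigma> | \<sigma> \<in> Sym n \<and> (\<forall>k\<in>I. \<sigma> k = (x(i := j)) k). g \<sigma>) = 0"
    using pure_sum_agreeing[OF g E, of x] by simp
  then show ?thesis by (simp add: av_def cond_ext_def sum_divide_distrib[symmetric])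
qed

text \<open>An injective pattern on \<open>I\<close> has probability \<open>1 / n ^ d\<close> in the
  product space and the no smaller \<open>fact (n - d) / fact n\<close> on the symmetric group; the
  other patterns contribute 0.\<close>

lemma AV_cond_ext_square:
  assumes I: "I \<subseteq> {1..n}" "card I = d"
  shows "AV {1..n} (\<lambda>x. (cond_ext n I g x)\<^sup>2) x \<le> ip n (cond n I g) (cond n I g)"
proof -
  have fI: "finite I" using I(1) by (rule finite_subset) simp
  have dn: "d \<le> n" using I card_mono[of "{1..n}" I] by simp
  let ?H = "\<lambda>x. (cond_ext n I g x)\<^sup>2"
  let ?Z = "I \<rightarrow>\<^sub>E {1..n}"
  have loc: "cond_ext n I g y = cond_ext n I g z" if "\<And>i. i \<in> I \<Longrightarrow> y i = z i" for y z
  proof -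
    have "(\<forall>k\<in>I. \<sigma> k = y k) \<longleftrightarrow> (\<forall>k\<in>I. \<sigma> k = z k)" for \<sigma> using that by auto
    then show ?thesis by (simp add: cond_ext_def)
  qed
  have "AV {1..n} ?H = AV I (AV ({1..n} - I) ?H)"
    using AV_Un[of I "{1..n} - I" ?H] fI I(1) by (simp add: Un_absorb1)
  also have "AV ({1..n} - I) ?H = ?H"
    by (intro AV_indep_const av_indep_fun[where \<phi> = "\<lambda>y. y\<^sup>2"] av_cond_ext_out) auto
  finally have "AV {1..n} ?H x = AV I ?H x" by simp
  also have "\<dots> = (\<Sum>z\<in>?Z. ?H z) / n ^ d"
  proof -
    have "cond_ext n I g (override_on x z I) = cond_ext n I g z" for z
      by (rule loc) (simp add: override_on_def)
    then show ?thesis using I by (simp add: AV_def)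
  qed
  finally have "AV {1..n} ?H x = (\<Sum>z\<in>?Z. ?H z) / n ^ d" .
  moreover have "(\<Sum>\<sigma>\<in>Sym n. (cond n I g \<sigma>)\<^sup>2) = fact (n - d) * (\<Sum>z\<in>?Z. ?H z)"
  proof -
    have "(\<Sum>\<sigma>\<in>Sym n. (cond n I g \<sigma>)\<^sup>2) = (\<Sum>z\<in>?Z. \<Sum>\<sigma> | \<sigma> \<in> Sym n \<and> restrict \<sigma> I = z. (cond n I g \<sigma>)\<^sup>2)"
    proof (rule sum.group[symmetric])
      show "(\<lambda>\<sigma>. restrict \<sigma> I) ` Sym n \<subseteq> ?Z"
      proof (rule image_subsetI)
        fix \<sigma> assume "\<sigma> \<in> Sym n"
        then have "\<sigma> i \<in> {1..n}" if "i \<in> I" for i using Sym_in[of \<sigma> n i] that I(1) by blast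
        then show "restrict \<sigma> I \<in> ?Z" by auto
      qed
      show "finite ?Z" using fI by (intro finite_PiE) auto
    qed simp
    also have "\<dots> = (\<Sum>z\<in>?Z. fact (n - d) * ?H z)"
    proof (rule sum.cong[OF refl])
      fix z assume z: "z \<in> ?Z"
      let ?T = "{\<sigma>. \<sigma> \<in> Sym n \<and> (\<forall>i\<in>I. \<sigma> i = z i)}"
      have "restrict \<sigma> I = z \<longleftrightarrow> (\<forall>i\<in>I. \<sigma> i = z i)" for \<sigma>
        using z by (auto simp: PiE_iff extensional_def restrict_def fun_eq_iff)
      then have "(\<Sum>\<sigma> | \<sigma> \<in> Sym n \<and> restrict \<sigma> I = z. (cond n I g \<sigma>)\<^sup>2) = (\<Sum>\<sigma>\<in>?T. (cond n I g \<sigma>)\<^sup>2)" by simp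
      also have "\<dots> = (\<Sum>\<sigma>\<in>?T. ?H z)"
      proof (rule sum.cong[OF refl])
        fix \<sigma> assume "\<sigma> \<in> ?T"
        then have "cond_ext n I g z = cond n I g \<sigma>" by (intro cond_ext_eq) auto
        then show "(cond n I g \<sigma>)\<^sup>2 = ?H z" by simp
      qed
      also have "\<dots> = fact (n - d) * ?H z"
      proof (cases "?T = {}")
        case True
        then have "cond_ext n I g z = 0" unfolding cond_ext_def by (simp only: sum.empty div_0)
        then show ?thesis by simp
      next
        case False
        then obtain \<tau> where t: "\<tau> \<in> Sym n" "\<And>i. i \<in> I \<Longrightarrow> \<tau> i = z i" by auto
        have "?T = {\<sigma>. \<sigma> \<in> Sym n \<and> (\<forall>i\<in>I. \<sigma> i = \<tau> i)}" using t(2) by auto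
        then have "card ?T = card (fixing n I)"
          using bij_betw_same_card[OF agreeing_bij[OF t(1), of I]] by simp
        then show ?thesis using I by (simp add: card_fixing)
      qed
      finally show "(\<Sum>\<sigma> | \<sigma> \<in> Sym n \<and> restrict \<sigma> I = z. (cond n I g \<sigma>)\<^sup>2) = fact (n - d) * ?H z" .
    qed
    finally show ?thesis by (simp add: sum_distrib_left)
  qed
  then have "ip n (cond n I g) (cond n I g) = fact (n - d) / fact n * (\<Sum>z\<in>?Z. ?H z)"
    by (simp add: ip_eq card_Sym power2_eq_square)
  moreover have "1 / real n ^ d \<le> fact (n - d) / fact n"
  proof -
    have "fact n div fact (n - d) \<le> n ^ d" using fact_div_fact_le_pow[OF dn] by simp
    moreover have "fact (n - d) dvd (fact n :: nat)" by (rule fact_dvd) simp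
    ultimately have "fact n \<le> n ^ d * (fact (n - d) :: nat)"
      by (metis dvd_div_mult_self mult_le_mono1)
    then have "(fact n :: real) \<le> real n ^ d * fact (n - d)"
      by (metis of_nat_fact of_nat_le_iff of_nat_mult of_nat_power)
    then show ?thesis using n_pos by (simp add: field_simps)
  qed
  then have "1 / real n ^ d * (\<Sum>z\<in>?Z. ?H z) \<le> fact (n - d) / fact n * (\<Sum>z\<in>?Z. ?H z)"
    by (intro mult_right_mono sum_nonneg) auto
  ultimately show ?thesis by simp
qed

end

section \<open>Fibre stabilisers and the reparametrised coupling\<close>

definition stab :: "nat \<Rightarrow> (nat \<Rightarrow> nat) \<Rightarrow> (nat \<Rightarrow> nat) set" where
  "stab n y = {\<rho> \<in> Sym n. \<forall>i\<in>{1..n}. y (\<rho> i) = y i}"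

abbreviation stab_avg :: "nat \<Rightarrow> (nat \<Rightarrow> nat) \<Rightarrow> ((nat \<Rightarrow> nat) \<Rightarrow> real) \<Rightarrow> (nat \<Rightarrow> nat) \<Rightarrow> real" where
  "stab_avg n y \<equiv> group_avg (stab n y)"

definition singles :: "nat \<Rightarrow> (nat \<Rightarrow> nat) \<Rightarrow> nat set" where
  "singles n y = {s \<in> {1..n}. \<forall>s'\<in>{1..n}. y s' = y s \<longrightarrow> s' = s}"

text \<open>For a coupled pair, \<open>y = inv \<sigma> \<circ> x\<close> sends each coordinate to
  the one in its fibre at which \<open>\<sigma>\<close> takes the value of the fibre. In terms of
  \<open>y\<close> the coupling condition is idempotence.\<close>

definition idempotents :: "nat \<Rightarrow> (nat \<Rightarrow> nat) set" where
  "idempotents n = {y \<in> {1..n} \<rightarrow>\<^sub>E {1..n}. \<forall>i\<in>{1..n}. y (y i) = y i}"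

lemma stab_Sym: "\<rho> \<in> stab n y \<Longrightarrow> \<rho> \<in> Sym n" by (simp add: stab_def)
lemma stab_comp: "\<rho> \<in> stab n y \<Longrightarrow> \<psi> \<in> stab n y \<Longrightarrow> \<rho> \<circ> \<psi> \<in> stab n y"
  unfolding stab_def using Sym_in[of \<psi> n] by (simp add: Sym_comp del: atLeastAtMost_iff)
lemma stab_inv:
  assumes "\<rho> \<in> stab n y" shows "inv \<rho> \<in> stab n y"
proof -
  have S: "\<rho> \<in> Sym n" using assms by (rule stab_Sym)
  have "y (inv \<rho> i) = y i" if "i \<in> {1..n}" for i
  proof -
    have "inv \<rho> i \<in> {1..n}" using that Sym_in[OF Sym_inv[OF S]] by blast
    then have "y (\<rho> (inv \<rho> i)) = y (inv \<rho> i)" using assms by (simp add: stab_def del: atLeastAtMost_iff)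
    then show ?thesis using S by simp
  qed
  then show ?thesis using S by (simp add: stab_def Sym_inv)
qed

lemma perm_group_stab: "perm_group n (stab n y)"
  by (auto simp: perm_group_def stab_comp stab_inv stab_Sym) (simp add: stab_def)

lemmas stab_avg_translate = group_avg_translate[OF perm_group_stab]
lemmas stab_avg_selfadjoint = group_avg_selfadjoint[OF perm_group_stab]

lemma cond_conjugate:
  assumes r: "\<rho> \<in> Sym n"
  shows "cond n I u (\<sigma> \<circ> \<rho>) = cond n (\<rho> ` I) (\<lambda>\<sigma>. u (\<sigma> \<circ> \<rho>)) \<sigma>"
proof -
  have bij: "bij_betw (\<lambda>\<phi>. \<rho> \<circ> \<phi> \<circ> inv \<rho>) (fixing n I) (fixing n (\<rho> ` I))"
  proof (rule bij_betw_byWitness[where f' = "\<lambda>\<phi>. inv \<rho> \<circ> \<phi> \<circ> \<rho>"])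
    show "(\<lambda>\<phi>. \<rho> \<circ> \<phi> \<circ> inv \<rho>) ` fixing n I \<subseteq> fixing n (\<rho> ` I)"
      using r by (auto simp: fixing_iff Sym_comp Sym_inv)
    show "(\<lambda>\<phi>. inv \<rho> \<circ> \<phi> \<circ> \<rho>) ` fixing n (\<rho> ` I) \<subseteq> fixing n I"
      using r by (auto simp: fixing_iff Sym_comp Sym_inv)
  qed (use r in \<open>auto simp: fun_eq_iff\<close>)
  have "(\<Sum>\<phi>\<in>fixing n I. u (\<sigma> \<circ> \<rho> \<circ> \<phi>)) = (\<Sum>\<phi>\<in>fixing n I. u (\<sigma> \<circ> (\<rho> \<circ> \<phi> \<circ> inv \<rho>) \<circ> \<rho>))"
    using r by (simp add: comp_assoc)
  also have "\<dots> = (\<Sum>\<phi>\<in>fixing n (\<rho> ` I). u (\<sigma> \<circ> \<phi> \<circ> \<rho>))"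
    by (rule sum.reindex_bij_betw[OF bij, of "\<lambda>\<phi>. u (\<sigma> \<circ> \<phi> \<circ> \<rho>)"])
  finally show ?thesis using bij_betw_same_card[OF bij] by (simp add: group_avg_def)
qed

text \<open>Sets \<open>I\<close> meeting every fibre of \<open>y\<close> at most once are permuted by the stabiliser of \<open>y\<close>, so
  the sum of their conditional expectations commutes with averaging over the stabiliser; hence the sum
  on the right is a sum of squares.\<close>

lemma stab_pairing:
  assumes g: "pure n d g" and f: "\<And>h. pure n d h \<Longrightarrow> ip n f h = ip n g h"
  shows "(\<Sum>I | I \<subseteq> singles n y \<and> card I = d. ip n (cond n I g) (cond n I g))
    \<le> (\<Sum>I | I \<subseteq> {1..n} \<and> card I = d \<and> inj_on y I. ip n (stab_avg n y f) (cond n I g))"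
proof -
  let ?T = "{I. I \<subseteq> {1..n} \<and> card I = d \<and> inj_on y I}"
  let ?A = "{I. I \<subseteq> singles n y \<and> card I = d}"
  define u where "u = stab_avg n y g"
  define Q where "Q = (\<lambda>\<sigma>. \<Sum>I\<in>?T. cond n I u \<sigma>)"
  have fT: "finite ?T" by simp
  have sub: "?A \<subseteq> ?T"
  proof
    fix I assume I: "I \<in> ?A"
    have "inj_on y I"
    proof (rule inj_onI)
      fix a b assume "a \<in> I" "b \<in> I" "y a = y b"
      then show "a = b" using I unfolding singles_def by blast
    qed
    then show "I \<in> ?T" using I unfolding singles_def by blast
  qed
  have Q: "Q (\<sigma> \<circ> \<rho>) = Q \<sigma>" if r: "\<rho> \<in> stab n y" for \<sigma> \<rho>
  proof -
    have S: "\<rho> \<in> Sym n" using r by (rule stab_Sym)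
    have im: "\<psi> ` I \<in> ?T" if I: "I \<in> ?T" and p: "\<psi> \<in> stab n y" for \<psi> I
    proof -
      have P: "\<psi> \<in> Sym n" using p by (rule stab_Sym)
      have "\<psi> ` I \<subseteq> {1..n}" using I Sym_in[OF P] by blast
      moreover have "card (\<psi> ` I) = d"
        using I P by (subst card_image) (auto simp: Sym_iff intro: permutes_inj_on)
      moreover have "inj_on y (\<psi> ` I)"
      proof (rule inj_onI)
        fix a b assume "a \<in> \<psi> ` I" "b \<in> \<psi> ` I" "y a = y b"
        then obtain i j where "i \<in> I" "j \<in> I" "a = \<psi> i" "b = \<psi> j" by auto
        moreover have "y (\<psi> k) = y k" if "k \<in> I" for k using p I that by (auto simp: stab_def)
        ultimately have "i = j" using I \<open>y a = y b\<close> by (auto dest: inj_onD)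
        then show "a = b" using \<open>a = \<psi> i\<close> \<open>b = \<psi> j\<close> by simp
      qed
      ultimately show ?thesis by blast
    qed
    have "Q (\<sigma> \<circ> \<rho>) = (\<Sum>I\<in>?T. cond n (\<rho> ` I) u \<sigma>)"
      unfolding Q_def by (simp add: cond_conjugate[OF S] u_def stab_avg_translate[OF r])
    also have "\<dots> = (\<Sum>I\<in>?T. cond n I u \<sigma>)"
      by (rule sum.reindex_bij_witness[of _ "\<lambda>I. inv \<rho> ` I" "\<lambda>I. \<rho> ` I"])
         (use im r stab_inv[OF r] S in \<open>auto simp only: image_comp Sym_inv_comp image_id id_apply\<close>)
    finally show ?thesis by (simp add: Q_def)
  qed
  have "(\<Sum>I\<in>?T. ip n (stab_avg n y f) (cond n I g)) = (\<Sum>I\<in>?T. ip n u (cond n I g))"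
  proof (intro sum.cong refl)
    fix I
    have "ip n (stab_avg n y f) (cond n I g) = ip n f (stab_avg n y (cond n I g))" by (rule stab_avg_selfadjoint)
    \<comment> \<open>The averaged expectation is still of level \<open>d\<close>, so
      \<open>f\<close> may be replaced by \<open>g\<close>.\<close>
    also have "\<dots> = ip n g (stab_avg n y (cond n I g))" by (intro f pure_group_avg[OF perm_group_stab] pure_cond g)
    also have "\<dots> = ip n u (cond n I g)" unfolding u_def by (rule stab_avg_selfadjoint[symmetric])
    finally show "ip n (stab_avg n y f) (cond n I g) = ip n u (cond n I g)" .
  qed
  also have "\<dots> = ip n Q g" by (simp add: Q_def ip_sum_left cond_selfadjoint)
  also have "\<dots> = ip n (stab_avg n y Q) g"
    by (intro ip_cong refl) (simp add: group_avg_invariant[OF perm_group_stab] Q)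
  also have "\<dots> = ip n Q u" unfolding u_def by (rule stab_avg_selfadjoint)
  also have "\<dots> = (\<Sum>I\<in>?T. ip n (cond n I u) (cond n I u))"
    by (simp add: Q_def ip_sum_left ip_cond ip_commute[of n "cond n _ u" u])
  finally have eq: "(\<Sum>I\<in>?T. ip n (stab_avg n y f) (cond n I g)) = (\<Sum>I\<in>?T. ip n (cond n I u) (cond n I u))" .
  \<comment> \<open>The stabiliser fixes every singleton fibre, so it is contained in
    \<open>fixing n I\<close> and its average is absorbed.\<close>
  have "cond n I u = cond n I g" if I: "I \<subseteq> singles n y" for I
    unfolding u_def
  proof (rule group_avg_absorb[OF perm_group_fixing perm_group_stab], rule subsetI)
    fix \<psi> assume p: "\<psi> \<in> stab n y"
    have P: "\<psi> \<in> Sym n" using p by (rule stab_Sym)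
    have "\<psi> i = i" if i: "i \<in> I" for i
    proof -
      have i': "i \<in> {1..n}" "\<forall>s'\<in>{1..n}. y s' = y i \<longrightarrow> s' = i" using i I by (auto simp: singles_def)
      then have "y (\<psi> i) = y i" using p by (simp add: stab_def)
      then show ?thesis using Sym_in[OF P] i' by blast
    qed
    then show "\<psi> \<in> fixing n I" using P by (simp add: fixing_iff)
  qed
  then have "(\<Sum>I\<in>?A. ip n (cond n I g) (cond n I g)) = (\<Sum>I\<in>?A. ip n (cond n I u) (cond n I u))" by simp
  also have "\<dots> \<le> (\<Sum>I\<in>?T. ip n (cond n I u) (cond n I u))"
    using fT sub by (intro sum_mono2) (auto intro: ip_ge_0)
  finally show ?thesis unfolding eq .
qed

text \<open>Take the involution exchanging \<open>i\<close> and \<open>y i\<close> for each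
  \<open>i\<close> in \<open>I\<close>. It is well defined since a value \<open>y i\<close> lying in
  \<open>I\<close> equals \<open>i\<close>, and it preserves fibres since \<open>i\<close> and
  \<open>y i\<close> belong to the same one.\<close>

lemma swap_into_idempotent:
  assumes y: "y \<in> idempotents n" and I: "I \<subseteq> {1..n}" "inj_on y I"
  shows "\<exists>\<rho>\<in>stab n y. \<forall>i\<in>I. \<rho> i = y i"
proof -
  define \<rho> where "\<rho> = (\<lambda>s. if s \<in> I then y s else if s \<in> y ` I then (THE i. i \<in> I \<and> y i = s) else s)"
  have yN: "y i \<in> {1..n}" "y (y i) = y i" if "i \<in> {1..n}" for i
    using y that by (auto simp: idempotents_def PiE_iff simp del: atLeastAtMost_iff)
  have r1: "\<rho> i = y i" if "i \<in> I" for i using that by (simp add: \<rho>_def)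
  have r2: "\<rho> (y i) = i" if "i \<in> I" for i
  proof (cases "y i \<in> I")
    case True
    have "y (y i) = y i" using yN that I by blast
    then have "y i = i" using I(2) True that by (auto dest: inj_onD)
    then show ?thesis using that by (simp add: \<rho>_def)
  next
    case False
    have "(THE k. k \<in> I \<and> y k = y i) = i"
      using that I(2) by (intro the_equality) (auto dest: inj_onD)
    then show ?thesis using False that by (simp add: \<rho>_def)
  qed
  have r3: "\<rho> s = s" if "s \<notin> I" "s \<notin> y ` I" for s using that by (simp add: \<rho>_def)
  have invol: "\<rho> (\<rho> s) = s" for s
    using r1 r2 r3 by (cases "s \<in> I"; cases "s \<in> y ` I") auto
  have out: "\<rho> s = s" if "s \<notin> {1..n}" for s using that I(1) yN by (intro r3) auto
  have ins: "\<rho> s \<in> {1..n}" if "s \<in> {1..n}" for s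
    using r1 r2 r3 I(1) yN that by (cases "s \<in> I"; cases "s \<in> y ` I") (auto simp del: atLeastAtMost_iff)
  have "bij_betw \<rho> {1..n} {1..n}"
    by (rule bij_betw_byWitness[where f' = \<rho>]) (use invol ins in auto)
  then have "\<rho> permutes {1..n}" by (rule bij_imp_permutes) (rule out)
  then have S: "\<rho> \<in> Sym n" by (simp add: Sym_iff)
  have "y (\<rho> s) = y s" if "s \<in> {1..n}" for s
  proof (cases "s \<in> I \<or> s \<notin> y ` I")
    case True
    then show ?thesis using r1 r3 yN that by (cases "s \<in> I") auto
  next
    case False
    then obtain i where "i \<in> I" "s = y i" by auto
    then show ?thesis using r2 yN I(1) by auto
  qed
  then have "\<rho> \<in> stab n y" using S by (simp add: stab_def)
  then show ?thesis using r1 by blast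
qed

text \<open>The substitution
  \<open>(x, \<sigma>) \<mapsto> (inv \<sigma> \<circ> x, \<sigma>)\<close> turns the coupled pairs
  into a full product, in which \<open>\<sigma>\<close> ranges over all permutations whatever
  \<open>y\<close> is.\<close>

lemma sum_coupled_reindex:
  "(\<Sum>x\<in>{1..n} \<rightarrow>\<^sub>E {1..n}. \<Sum>\<sigma>\<in>coupled n x. \<Phi> x \<sigma>)
    = (\<Sum>y\<in>idempotents n. \<Sum>\<sigma>\<in>Sym n. \<Phi> (restrict (\<sigma> \<circ> y) {1..n}) \<sigma> :: real)"
proof -
  let ?N = "{1..n}" let ?X = "?N \<rightarrow>\<^sub>E ?N"
  have fin: "finite ?X" by (intro finite_PiE) auto
  have fI: "finite (idempotents n)" by (rule finite_subset[OF _ fin]) (auto simp: idempotents_def)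
  have "(\<Sum>(x, \<sigma>)\<in>Sigma ?X (coupled n). \<Phi> x \<sigma>) = (\<Sum>(y, \<sigma>)\<in>idempotents n \<times> Sym n. \<Phi> (restrict (\<sigma> \<circ> y) ?N) \<sigma>)"
  proof (rule sum.reindex_bij_witness[of _ "\<lambda>(y, \<sigma>). (restrict (\<sigma> \<circ> y) ?N, \<sigma>)" "\<lambda>(x, \<sigma>). (restrict (inv \<sigma> \<circ> x) ?N, \<sigma>)"])
    fix p assume p: "p \<in> Sigma ?X (coupled n)"
    obtain x \<sigma> where q: "p = (x, \<sigma>)" by (cases p)
    have x: "x \<in> ?X" and s: "\<sigma> \<in> coupled n x" using p q by auto
    have S: "\<sigma> \<in> Sym n" using s by (rule coupled_Sym)
    have xN: "x i \<in> ?N" if "i \<in> ?N" for i using x that by blast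
    have e: "restrict (\<sigma> \<circ> restrict (inv \<sigma> \<circ> x) ?N) ?N = x"
    proof
      fix i show "restrict (\<sigma> \<circ> restrict (inv \<sigma> \<circ> x) ?N) ?N i = x i"
        using x S by (cases "i \<in> ?N") (auto simp: PiE_iff extensional_def)
    qed
    show "(case (case p of (x, \<sigma>) \<Rightarrow> (restrict (inv \<sigma> \<circ> x) ?N, \<sigma>)) of (y, \<sigma>) \<Rightarrow> (restrict (\<sigma> \<circ> y) ?N, \<sigma>)) = p"
      by (simp only: q prod.case e)
    have "inv \<sigma> (x i) \<in> ?N" if "i \<in> ?N" for i using xN[OF that] Sym_in[OF Sym_inv[OF S]] by blast
    then have "restrict (inv \<sigma> \<circ> x) ?N \<in> idempotents n"
      using s by (auto simp: idempotents_def coupled_def simp del: atLeastAtMost_iff)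
    then show "(case p of (x, \<sigma>) \<Rightarrow> (restrict (inv \<sigma> \<circ> x) ?N, \<sigma>)) \<in> idempotents n \<times> Sym n"
      using S q by auto
    show "(case (case p of (x, \<sigma>) \<Rightarrow> (restrict (inv \<sigma> \<circ> x) ?N, \<sigma>)) of (y, \<sigma>) \<Rightarrow> \<Phi> (restrict (\<sigma> \<circ> y) ?N) \<sigma>) = (case p of (x, \<sigma>) \<Rightarrow> \<Phi> x \<sigma>)"
      by (simp only: q prod.case e)
  next
    fix p assume p: "p \<in> idempotents n \<times> Sym n"
    obtain y \<sigma> where q: "p = (y, \<sigma>)" by (cases p)
    have y: "y \<in> idempotents n" and S: "\<sigma> \<in> Sym n" using p q by auto
    have yN: "y i \<in> ?N" "y (y i) = y i" if "i \<in> ?N" for i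
      using y that by (auto simp: idempotents_def PiE_iff simp del: atLeastAtMost_iff)
    have e: "restrict (inv \<sigma> \<circ> restrict (\<sigma> \<circ> y) ?N) ?N = y"
    proof
      fix i show "restrict (inv \<sigma> \<circ> restrict (\<sigma> \<circ> y) ?N) ?N i = y i"
        using y S by (cases "i \<in> ?N") (auto simp: idempotents_def PiE_iff extensional_def)
    qed
    show "(case (case p of (y, \<sigma>) \<Rightarrow> (restrict (\<sigma> \<circ> y) ?N, \<sigma>)) of (x, \<sigma>) \<Rightarrow> (restrict (inv \<sigma> \<circ> x) ?N, \<sigma>)) = p"
      by (simp only: q prod.case e)
    have "\<sigma> (y i) \<in> ?N" if "i \<in> ?N" for i using yN[OF that] Sym_in[OF S] by blast
    then have "restrict (\<sigma> \<circ> y) ?N \<in> ?X" by auto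
    moreover have "\<sigma> \<in> coupled n (restrict (\<sigma> \<circ> y) ?N)"
      using S yN by (simp add: coupled_def del: atLeastAtMost_iff)
    ultimately show "(case p of (y, \<sigma>) \<Rightarrow> (restrict (\<sigma> \<circ> y) ?N, \<sigma>)) \<in> Sigma ?X (coupled n)"
      using q by auto
  qed
  then show ?thesis using fin fI by (simp add: sum.Sigma)
qed

text \<open>Choose distinct values on \<open>I\<close>, in at least \<open>(n - d) ^ d\<close> ways,
  and let the other \<open>n - d\<close> coordinates avoid these \<open>d\<close> values.\<close>

lemma card_singles_ge:
  assumes I: "I \<subseteq> {1..n}" "card I = d"
  shows "(n - d) ^ n \<le> card {x \<in> {1..n} \<rightarrow>\<^sub>E {1..n}. I \<subseteq> singles n x}"
proof -
  let ?N = "{1..n}"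
  let ?Z = "{z \<in> I \<rightarrow>\<^sub>E ?N. inj_on z I}"
  let ?W = "\<lambda>z. (?N - I) \<rightarrow>\<^sub>E (?N - z ` I)"
  let ?R = "{x \<in> ?N \<rightarrow>\<^sub>E ?N. I \<subseteq> singles n x}"
  define j where "j = (\<lambda>(z, w) i. if i \<in> I then z i else (w i :: nat))"
  have fI: "finite I" using I(1) by (rule finite_subset) simp
  have dn: "d \<le> n" using I card_mono[of ?N I] by simp
  have fZ: "finite ?Z" using fI by (intro finite_subset[OF _ finite_PiE[OF fI, of "\<lambda>_. ?N"]]) auto
  have inj: "inj_on j (Sigma ?Z ?W)"
  proof (rule inj_onI)
    fix p q assume p: "p \<in> Sigma ?Z ?W" and q: "q \<in> Sigma ?Z ?W" and e: "j p = j q"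
    obtain z w z' w' where pq: "p = (z, w)" "q = (z', w')" by (cases p, cases q)
    have e': "(if i \<in> I then z i else w i) = (if i \<in> I then z' i else w' i)" for i
      using fun_cong[OF e, of i] by (simp add: j_def pq)
    have "z i = z' i" for i
    proof (cases "i \<in> I")
      case False
      then show ?thesis using p q pq by (auto simp: PiE_iff extensional_def)
    qed (use e'[of i] in simp)
    moreover have "w i = w' i" for i
    proof (cases "i \<in> ?N - I")
      case False
      have "w \<in> ?W z" "w' \<in> ?W z'" using p q pq by auto
      then show ?thesis using PiE_arb[OF _ False] by metis
    qed (use e'[of i] in simp)
    ultimately show "p = q" by (simp add: pq fun_eq_iff)
  qed
  have sub: "j ` Sigma ?Z ?W \<subseteq> ?R"
  proof (rule image_subsetI)
    fix p assume p: "p \<in> Sigma ?Z ?W"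
    obtain z w where q: "p = (z, w)" by (cases p)
    have z: "z \<in> I \<rightarrow>\<^sub>E ?N" "inj_on z I" and w: "w \<in> ?W z" using p q by auto
    have zi: "z i \<in> ?N" if "i \<in> I" for i using z that by blast
    have wi: "w i \<in> ?N" "w i \<notin> z ` I" if "i \<in> ?N" "i \<notin> I" for i using w that by blast+
    have wout: "w i = undefined" if "i \<notin> ?N" for i using w that by (auto simp: PiE_iff extensional_def)
    have "j p \<in> ?N \<rightarrow>\<^sub>E ?N"
      using zi wi wout I(1) by (auto simp: j_def q PiE_iff extensional_def simp del: atLeastAtMost_iff)
    moreover have "i \<in> singles n (j p)" if i: "i \<in> I" for i
    proof -
      have "s' = i" if s: "s' \<in> ?N" "j p s' = j p i" for s'
      proof (cases "s' \<in> I")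
        case True
        then show ?thesis using s i z(2) by (auto simp: j_def q dest: inj_onD)
      next
        case False
        then have "w s' = z i" using s i by (simp add: j_def q)
        then show ?thesis using wi(2)[OF s(1) False] i by auto
      qed
      then show ?thesis using i I(1) by (auto simp: singles_def)
    qed
    ultimately show "j p \<in> ?R" by blast
  qed
  have "card ?Z = prod ((-) n) {0..<d}"
    using card_inj_on_subset_funcset[OF fI, of ?N I] I by simp
  moreover have "(n - d) ^ d \<le> prod ((-) n) {0..<d}"
    using prod_mono[of "{0..<d}" "\<lambda>_. n - d" "(-) n"] by simp
  ultimately have cZ: "(n - d) ^ d \<le> card ?Z" by simp
  have cW: "card (?W z) = (n - d) ^ (n - d)" if z: "z \<in> ?Z" for z
  proof -
    have "card (?N - I) = n - d" using I by (simp add: card_Diff_subset fI)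
    moreover have "z ` I \<subseteq> ?N" "card (z ` I) = d" using z I by (auto simp: card_image simp del: atLeastAtMost_iff)
    then have "card (?N - z ` I) = n - d" using fI by (simp add: card_Diff_subset)
    ultimately show ?thesis by (simp add: card_PiE)
  qed
  have "(n - d) ^ n = (n - d) ^ d * (n - d) ^ (n - d)" using dn by (simp add: power_add[symmetric])
  also have "\<dots> \<le> card ?Z * (n - d) ^ (n - d)" using cZ by simp
  also have "\<dots> = (\<Sum>z\<in>?Z. card (?W z))" using cW by simp
  also have "\<dots> = card (Sigma ?Z ?W)" using fZ by (subst card_SigmaI) (auto intro!: finite_PiE)
  also have "\<dots> = card (j ` Sigma ?Z ?W)" by (rule card_image[OF inj, symmetric])
  also have "\<dots> \<le> card ?R"
    by (rule card_mono[OF _ sub]) (auto intro: finite_subset[OF _ finite_PiE[of ?N "\<lambda>_. ?N"]])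
  finally show ?thesis .
qed

section \<open>The level-d inequality on the symmetric group\<close>

text \<open>Coupling to \<open>x\<close> only prescribes the fibre in which \<open>\<sigma>\<close>
  takes each value of \<open>x\<close>, so it is preserved when coordinates are permuted within
  fibres.\<close>

lemma sum_coupled_stab_avg:
  assumes x: "x ` {1..n} \<subseteq> {1..n}"
  shows "(\<Sum>\<sigma>\<in>coupled n x. f \<sigma>) = (\<Sum>\<sigma>\<in>coupled n x. stab_avg n x f \<sigma>)"
proof -
  have inv: "\<sigma> \<circ> \<rho> \<in> coupled n x" if s: "\<sigma> \<in> coupled n x" and r: "\<rho> \<in> stab n x" for \<sigma> \<rho>
  proof -
    have S: "\<sigma> \<in> Sym n" "\<rho> \<in> Sym n" using s r by (auto simp: coupled_Sym stab_Sym)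
    have "x (inv (\<sigma> \<circ> \<rho>) (x i)) = x i" if i: "i \<in> {1..n}" for i
    proof -
      have "x i \<in> {1..n}" using x i by blast
      then have "inv \<sigma> (x i) \<in> {1..n}" using Sym_in[OF Sym_inv[OF S(1)]] by blast
      then have "x (inv \<rho> (inv \<sigma> (x i))) = x (inv \<sigma> (x i))" using stab_inv[OF r] by (simp add: stab_def del: atLeastAtMost_iff)
      also have "\<dots> = x i" using s i by (simp add: coupled_def del: atLeastAtMost_iff)
      finally show ?thesis using S by (simp add: Sym_iff o_inv_distrib permutes_bij)
    qed
    then show ?thesis using S by (simp add: coupled_def Sym_comp)
  qed
  have "(\<Sum>\<sigma>\<in>coupled n x. f (\<sigma> \<circ> \<rho>)) = (\<Sum>\<sigma>\<in>coupled n x. f \<sigma>)" if r: "\<rho> \<in> stab n x" for \<rho>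
    by (rule sum_right_translate[of _ _ n]) (use inv r stab_inv[OF r] stab_Sym[OF r] in auto)
  then have "(\<Sum>\<sigma>\<in>coupled n x. \<Sum>\<rho>\<in>stab n x. f (\<sigma> \<circ> \<rho>)) = card (stab n x) * (\<Sum>\<sigma>\<in>coupled n x. f \<sigma>)"
    by (subst sum.swap) simp
  then show ?thesis using perm_groupD(2)[OF perm_group_stab[of n x]]
    by (simp add: group_avg_def sum_divide_distrib[symmetric] card_gt_0_iff)
qed

lemma translate_idempotent:
  assumes y: "y \<in> idempotents n" and s: "\<sigma> \<in> Sym n"
  shows "stab n (restrict (\<sigma> \<circ> y) {1..n}) = stab n y"
    and "singles n (restrict (\<sigma> \<circ> y) {1..n}) = singles n y"
    and "card (coupled n (restrict (\<sigma> \<circ> y) {1..n})) = card (coupled n y)"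
proof -
  have inj: "\<sigma> a = \<sigma> b \<longleftrightarrow> a = b" for a b using s by (metis Sym_inverse(1))
  show "stab n (restrict (\<sigma> \<circ> y) {1..n}) = stab n y"
  proof (rule set_eqI)
    fix \<rho>
    have "\<rho> i \<in> {1..n}" if "\<rho> \<in> Sym n" "i \<in> {1..n}" for i using Sym_in[OF that(1)] that(2) by blast
    then show "\<rho> \<in> stab n (restrict (\<sigma> \<circ> y) {1..n}) \<longleftrightarrow> \<rho> \<in> stab n y"
      by (auto simp: stab_def inj simp del: atLeastAtMost_iff)
  qed
  show "singles n (restrict (\<sigma> \<circ> y) {1..n}) = singles n y"
    by (auto simp: singles_def inj simp del: atLeastAtMost_iff)
  have yN: "y i \<in> {1..n}" if "i \<in> {1..n}" for i using y that by (auto simp: idempotents_def)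
  have "restrict (\<sigma> \<circ> y) {1..n} ` {1..n} \<subseteq> {1..n}"
  proof (rule image_subsetI)
    fix i assume "i \<in> {1..n}"
    then show "restrict (\<sigma> \<circ> y) {1..n} i \<in> {1..n}" using Sym_in[OF s] yN by (simp del: atLeastAtMost_iff)
  qed
  then have "coupled n (restrict (\<sigma> \<circ> y) {1..n}) = coupled n (\<sigma> \<circ> y)"
    by (rule coupled_cong) simp
  then show "card (coupled n (restrict (\<sigma> \<circ> y) {1..n})) = card (coupled n y)"
    using bij_betw_same_card[OF coupled_equivariant[OF s, of y]] by simp
qed

lemma cond_ext_cong: "(\<And>i. i \<in> I \<Longrightarrow> y i = z i) \<Longrightarrow> cond_ext n I g y = cond_ext n I g z"
proof -
  assume "\<And>i. i \<in> I \<Longrightarrow> y i = z i"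
  then have "(\<forall>k\<in>I. \<sigma> k = y k) \<longleftrightarrow> (\<forall>k\<in>I. \<sigma> k = z k)" for \<sigma> by auto
  then show ?thesis by (simp add: cond_ext_def)
qed

text \<open>On \<open>I\<close> the map \<open>y\<close> agrees with a permutation
  \<open>\<rho>\<close> of the stabiliser, so the extension at \<open>\<sigma> \<circ> y\<close> is
  the expectation at \<open>\<sigma> \<circ> \<rho>\<close>; the averaged \<open>f\<close> does not
  see \<open>\<rho>\<close>, and a translation removes it. If \<open>y\<close> is not injective on
  \<open>I\<close>, neither is \<open>\<sigma> \<circ> y\<close>, and the extension is 0.\<close>

lemma sum_stab_avg_cond_ext:
  assumes y: "y \<in> idempotents n" and I: "I \<subseteq> {1..n}"
  shows "(\<Sum>\<sigma>\<in>Sym n. stab_avg n y f \<sigma> * cond_ext n I g (\<sigma> \<circ> y))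
    = (if inj_on y I then fact n * ip n (stab_avg n y f) (cond n I g) else 0)"
proof (cases "inj_on y I")
  case True
  obtain \<rho> where r: "\<rho> \<in> stab n y" "\<And>i. i \<in> I \<Longrightarrow> \<rho> i = y i"
    using swap_into_idempotent[OF y I True] by blast
  have S: "\<rho> \<in> Sym n" using r(1) by (rule stab_Sym)
  have "stab_avg n y f \<sigma> * cond_ext n I g (\<sigma> \<circ> y) = stab_avg n y f (\<sigma> \<circ> \<rho>) * cond n I g (\<sigma> \<circ> \<rho>)" if "\<sigma> \<in> Sym n" for \<sigma>
    using cond_ext_eq[of "\<sigma> \<circ> \<rho>" n I "\<sigma> \<circ> y" g] r(2) that S
    by (simp add: Sym_comp stab_avg_translate[OF r(1)])
  then have "(\<Sum>\<sigma>\<in>Sym n. stab_avg n y f \<sigma> * cond_ext n I g (\<sigma> \<circ> y)) = (\<Sum>\<sigma>\<in>Sym n. stab_avg n y f (\<sigma> \<circ> \<rho>) * cond n I g (\<sigma> \<circ> \<rho>))"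
    by (intro sum.cong refl)
  also have "\<dots> = (\<Sum>\<sigma>\<in>Sym n. stab_avg n y f \<sigma> * cond n I g \<sigma>)"
    by (rule sum_Sym_right[OF S])
  finally show ?thesis using True by (simp add: ip_eq card_Sym)
next
  case False
  have "cond_ext n I g (\<sigma> \<circ> y) = 0" for \<sigma>
    using False inj_on_imageI2 by (intro cond_ext_noninj) blast
  then show ?thesis using False by simp
qed

context sym_coupling begin

text \<open>In the variables \<open>(y, \<sigma>)\<close> the pairing is bounded below for each
  \<open>y\<close> by \<open>stab_pairing\<close>. Back in the variable \<open>x\<close>, each
  \<open>I\<close> is counted once for every \<open>x\<close> in which it consists of singleton
  fibres, an event of probability at least \<open>((n - d) / n) ^ n\<close>.\<close>

lemma lift_pairing_lower:
  assumes g: "pure n d g" and f: "\<And>h. pure n d h \<Longrightarrow> ip n f h = ip n g h"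
  shows "(real (n - d) / n) ^ n * (\<Sum>I | I \<subseteq> {1..n} \<and> card I = d. ip n (cond n I g) (cond n I g))
    \<le> AV {1..n} (\<lambda>x. lift n f x * (\<Sum>I | I \<subseteq> {1..n} \<and> card I = d. cond_ext n I g x)) x0"
proof -
  let ?N = "{1..n}"
  let ?S = "{I. I \<subseteq> ?N \<and> card I = d}"
  let ?X = "?N \<rightarrow>\<^sub>E ?N"
  define c where "c = (\<lambda>x. real (card (coupled n x)))"
  define G where "G = (\<lambda>x. \<Sum>I\<in>?S. cond_ext n I g x)"
  define K where "K = (\<lambda>I. ip n (cond n I g) (cond n I g))"
  have K0: "K I \<ge> 0" for I by (simp add: K_def ip_ge_0)
  have fX: "finite ?X" by (intro finite_PiE) auto
  have XN: "x ` ?N \<subseteq> ?N" if "x \<in> ?X" for x using that by blast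
  have Gc: "G y = G z" if "\<And>i. i \<in> ?N \<Longrightarrow> y i = z i" for y z
    unfolding G_def by (intro sum.cong refl cond_ext_cong that) auto
  have fI: "idempotents n \<subseteq> ?X" by (auto simp: idempotents_def)
  have A: "AV ?N (\<lambda>x. lift n f x * G x) x0 = (\<Sum>x\<in>?X. lift n f x * G x) / n ^ n"
  proof -
    have "lift n f (override_on x0 x ?N) * G (override_on x0 x ?N) = lift n f x * G x" for x
      by (intro arg_cong2[of _ _ _ _ "(*)"] lift_cong Gc) auto
    then show ?thesis by (simp add: AV_def)
  qed
  have "(\<Sum>x\<in>?X. lift n f x * G x) = (\<Sum>x\<in>?X. \<Sum>\<sigma>\<in>coupled n x. stab_avg n x f \<sigma> * G x / c x)"
  proof (intro sum.cong refl)
    fix x assume "x \<in> ?X"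
    from XN[OF this] show "lift n f x * G x = (\<Sum>\<sigma>\<in>coupled n x. stab_avg n x f \<sigma> * G x / c x)"
      by (simp add: lift_def sum_coupled_stab_avg[of x n f] c_def sum_divide_distrib[symmetric] sum_distrib_right[symmetric])
  qed
  also have "\<dots> = (\<Sum>y\<in>idempotents n. \<Sum>\<sigma>\<in>Sym n. stab_avg n y f \<sigma> * G (\<sigma> \<circ> y) / c y)"
    unfolding sum_coupled_reindex
  proof (intro sum.cong refl)
    fix y \<sigma> assume y: "y \<in> idempotents n" "\<sigma> \<in> Sym n"
    have "G (restrict (\<sigma> \<circ> y) ?N) = G (\<sigma> \<circ> y)" by (rule Gc) simp
    then show "stab_avg n (restrict (\<sigma> \<circ> y) ?N) f \<sigma> * G (restrict (\<sigma> \<circ> y) ?N) / c (restrict (\<sigma> \<circ> y) ?N)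
      = stab_avg n y f \<sigma> * G (\<sigma> \<circ> y) / c y"
      by (simp only: translate_idempotent[OF y] c_def)
  qed
  finally have B: "(\<Sum>x\<in>?X. lift n f x * G x) = (\<Sum>y\<in>idempotents n. \<Sum>\<sigma>\<in>Sym n. stab_avg n y f \<sigma> * G (\<sigma> \<circ> y) / c y)" .
  have C: "(\<Sum>y\<in>idempotents n. fact n / c y * (\<Sum>I | I \<subseteq> singles n y \<and> card I = d. K I))
    \<le> (\<Sum>y\<in>idempotents n. \<Sum>\<sigma>\<in>Sym n. stab_avg n y f \<sigma> * G (\<sigma> \<circ> y) / c y)"
  proof (rule sum_mono)
    fix y assume y: "y \<in> idempotents n"
    have "(\<Sum>\<sigma>\<in>Sym n. stab_avg n y f \<sigma> * G (\<sigma> \<circ> y)) = (\<Sum>I\<in>?S. \<Sum>\<sigma>\<in>Sym n. stab_avg n y f \<sigma> * cond_ext n I g (\<sigma> \<circ> y))"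
      unfolding G_def sum_distrib_left by (rule sum.swap)
    also have "\<dots> = (\<Sum>I\<in>?S. if inj_on y I then fact n * ip n (stab_avg n y f) (cond n I g) else 0)"
      by (intro sum.cong refl sum_stab_avg_cond_ext[OF y]) auto
    also have "\<dots> = fact n * (\<Sum>I | I \<subseteq> ?N \<and> card I = d \<and> inj_on y I. ip n (stab_avg n y f) (cond n I g))"
      unfolding sum_distrib_left by (intro sum.mono_neutral_cong_right) auto
    finally have eq: "(\<Sum>\<sigma>\<in>Sym n. stab_avg n y f \<sigma> * G (\<sigma> \<circ> y) / c y)
       = fact n / c y * (\<Sum>I | I \<subseteq> ?N \<and> card I = d \<and> inj_on y I. ip n (stab_avg n y f) (cond n I g))"
      by (simp add: sum_divide_distrib[symmetric])
    show "fact n / c y * (\<Sum>I | I \<subseteq> singles n y \<and> card I = d. K I) \<le> (\<Sum>\<sigma>\<in>Sym n. stab_avg n y f \<sigma> * G (\<sigma> \<circ> y) / c y)"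
      unfolding eq K_def by (intro mult_left_mono stab_pairing[OF g f]) (auto simp: c_def)
  qed
  have "(\<Sum>y\<in>idempotents n. fact n / c y * (\<Sum>I | I \<subseteq> singles n y \<and> card I = d. K I))
    = (\<Sum>y\<in>idempotents n. \<Sum>\<sigma>\<in>Sym n. \<Sum>I\<in>?S. (if I \<subseteq> singles n y then K I / c y else 0))"
  proof (intro sum.cong refl)
    fix y
    have "(\<Sum>I | I \<subseteq> singles n y \<and> card I = d. K I / c y) = (\<Sum>I\<in>?S. (if I \<subseteq> singles n y then K I / c y else 0))"
      by (rule sum.mono_neutral_cong_left) (auto simp: singles_def)
    moreover have "fact n / c y * (\<Sum>I | I \<subseteq> singles n y \<and> card I = d. K I) = fact n * (\<Sum>I | I \<subseteq> singles n y \<and> card I = d. K I / c y)"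
      unfolding sum_divide_distrib[symmetric] by simp
    ultimately show "fact n / c y * (\<Sum>I | I \<subseteq> singles n y \<and> card I = d. K I) = (\<Sum>\<sigma>\<in>Sym n. \<Sum>I\<in>?S. (if I \<subseteq> singles n y then K I / c y else 0))"
      by (simp only: sum_constant card_Sym of_nat_fact)
  qed
  \<comment> \<open>The same substitution in reverse; the weight \<open>1 / c x\<close> will cancel
    the number of coupled permutations.\<close>
  also have "\<dots> = (\<Sum>x\<in>?X. \<Sum>\<sigma>\<in>coupled n x. \<Sum>I\<in>?S. (if I \<subseteq> singles n x then K I / c x else 0))"
    unfolding sum_coupled_reindex
    by (intro sum.cong refl) (simp only: translate_idempotent c_def)
  also have "\<dots> = (\<Sum>x\<in>?X. \<Sum>I\<in>?S. if I \<subseteq> singles n x then K I else 0)"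
  proof (intro sum.cong refl)
    fix x assume "x \<in> ?X"
    from card_coupled_pos[OF XN[OF this]] have "c x > 0" by (simp add: c_def)
    then have "c x * (if I \<subseteq> singles n x then K I / c x else 0) = (if I \<subseteq> singles n x then K I else 0)" for I
      by simp
    moreover have "real (card (coupled n x)) = c x" by (simp add: c_def)
    ultimately show "(\<Sum>\<sigma>\<in>coupled n x. \<Sum>I\<in>?S. (if I \<subseteq> singles n x then K I / c x else 0)) = (\<Sum>I\<in>?S. if I \<subseteq> singles n x then K I else 0)"
      by (simp only: sum_constant sum_distrib_left)
  qed
  also have "\<dots> = (\<Sum>I\<in>?S. \<Sum>x\<in>?X. if I \<subseteq> singles n x then K I else 0)" by (rule sum.swap)
  also have "\<dots> = (\<Sum>I\<in>?S. card {x \<in> ?X. I \<subseteq> singles n x} * K I)"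
    using fX by (intro sum.cong refl) (simp add: sum.inter_filter[symmetric])
  finally have D: "(\<Sum>y\<in>idempotents n. fact n / c y * (\<Sum>I | I \<subseteq> singles n y \<and> card I = d. K I))
    = (\<Sum>I\<in>?S. card {x \<in> ?X. I \<subseteq> singles n x} * K I)" .
  have low: "(\<Sum>I\<in>?S. card {x \<in> ?X. I \<subseteq> singles n x} * K I) / n ^ n \<le> AV ?N (\<lambda>x. lift n f x * G x) x0"
    unfolding A B D[symmetric] by (intro divide_right_mono C) simp
  have "(\<Sum>I\<in>?S. real ((n - d) ^ n) * K I) \<le> (\<Sum>I\<in>?S. card {x \<in> ?X. I \<subseteq> singles n x} * K I)"
  proof (intro sum_mono mult_right_mono K0)
    fix I assume "I \<in> ?S"
    then show "real ((n - d) ^ n) \<le> real (card {x \<in> ?X. I \<subseteq> singles n x})"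
      using card_singles_ge[of I n d] of_nat_le_iff by blast
  qed
  then have "(\<Sum>I\<in>?S. real ((n - d) ^ n) * K I) / n ^ n \<le> AV ?N (\<lambda>x. lift n f x * G x) x0"
    by (rule order_trans[OF divide_right_mono low]) simp
  moreover have "(real (n - d) / n) ^ n * (\<Sum>I\<in>?S. K I) = (\<Sum>I\<in>?S. real ((n - d) ^ n) * K I) / n ^ n"
    by (simp add: power_divide sum_distrib_left[symmetric])
  ultimately show ?thesis by (simp add: G_def K_def)
qed

text \<open>The lower bound for the pairing and Cauchy-Schwarz give
  \<open>(p * N2)\<^sup>2 \<le> W * N2\<close>, hence \<open>p\<^sup>2 * N2 \<le> W\<close>, and
  \<open>N2\<close> dominates \<open>ip n g g\<close> by \<open>pure_norm_le\<close>. Squaring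
  \<open>p\<close> doubles the exponent \<open>2 * d\<close> to \<open>4 * d\<close>.\<close>

lemma level_norm_le_product_weight:
  assumes g: "pure n d g" and f: "\<And>h. pure n d h \<Longrightarrow> ip n f h = ip n g h" and dn: "2 * d \<le> n"
  shows "ip n g g \<le> exp (4 * real d) * level_weight {1..n} d (lift n f) x0"
proof -
  let ?N = "{1..n}"
  let ?S = "{I. I \<subseteq> ?N \<and> card I = d}"
  define W where "W = level_weight ?N d (lift n f) x0"
  define N2 where "N2 = (\<Sum>I\<in>?S. ip n (cond n I g) (cond n I g))"
  define p where "p = (real (n - d) / n) ^ n"
  have N20: "N2 \<ge> 0" unfolding N2_def by (intro sum_nonneg ip_ge_0)
  have W0: "W \<ge> 0" unfolding W_def level_weight_def by (intro sum_nonneg AV_nonneg) auto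
  have p: "exp (- 2 * real d) \<le> p"
  proof -
    define \<delta> where "\<delta> = real d / n"
    have d: "\<delta> \<ge> 0" "\<delta> \<le> 1 / 2" using dn n_pos by (simp_all add: \<delta>_def field_simps)
    have e: "real (n - d) / n = 1 - \<delta>" using dn n_pos by (simp add: \<delta>_def of_nat_diff field_simps)
    \<comment> \<open>\<open>(1 - \<delta>) * (1 + 2 * \<delta>) = 1 + \<delta> * (1 - 2 *
      \<delta>)\<close> is at least 1 because \<open>\<delta> \<le> 1 / 2\<close>.\<close>
    have "1 + 2 * \<delta> \<le> exp (2 * \<delta>)" by (rule exp_ge_add_one_self)
    then have "(1 - \<delta>) * (1 + 2 * \<delta>) \<le> (1 - \<delta>) * exp (2 * \<delta>)" using d by (intro mult_left_mono) auto
    moreover have "\<delta> * (1 - 2 * \<delta>) \<ge> 0" using d by (intro mult_nonneg_nonneg) auto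
    ultimately have "1 \<le> (1 - \<delta>) * exp (2 * \<delta>)" by (simp add: algebra_simps)
    then have "exp (- (2 * \<delta>)) \<le> 1 - \<delta>" by (simp add: exp_minus field_simps)
    then have "exp (- (2 * \<delta>)) ^ n \<le> p" unfolding p_def e by (intro power_mono) auto
    moreover have "exp (- (2 * \<delta>)) ^ n = exp (- 2 * real d)"
      using n_pos by (simp add: exp_of_nat_mult[symmetric] \<delta>_def)
    ultimately show ?thesis by simp
  qed
  have "p * N2 \<le> AV ?N (\<lambda>x. lift n f x * (\<Sum>I\<in>?S. cond_ext n I g x)) x0"
    unfolding p_def N2_def by (rule lift_pairing_lower[OF g f])
  also have "\<dots> = (\<Sum>I\<in>?S. AV ?N (\<lambda>x. lift n f x * cond_ext n I g x) x0)"
    by (simp add: sum_distrib_left AV_sum)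
  also have "\<dots> = (\<Sum>I\<in>?S. 1 * AV ?N (\<lambda>x. escomp ?N I (lift n f) x * cond_ext n I g x) x0)"
  proof (intro sum.cong refl)
    fix I assume "I \<in> ?S"
    then show "AV ?N (\<lambda>x. lift n f x * cond_ext n I g x) x0 = 1 * AV ?N (\<lambda>x. escomp ?N I (lift n f) x * cond_ext n I g x) x0"
      using AV_mult_pure[of ?N I "cond_ext n I g" "lift n f" x0] av_cond_ext_out av_cond_ext_in[OF g] by auto
  qed
  finally have "(p * N2)\<^sup>2 \<le> (\<Sum>I\<in>?S. 1 * AV ?N (\<lambda>x. escomp ?N I (lift n f) x * cond_ext n I g x) x0)\<^sup>2"
    using N20 by (intro power_mono) (auto simp: p_def)
  also have "\<dots> \<le> (\<Sum>I\<in>?S. 1 * AV ?N (\<lambda>x. (escomp ?N I (lift n f) x)\<^sup>2) x0) * (\<Sum>I\<in>?S. 1 * AV ?N (\<lambda>x. (cond_ext n I g x)\<^sup>2) x0)"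
    by (rule AV_cauchy_schwarz) simp
  also have "\<dots> = W * (\<Sum>I\<in>?S. AV ?N (\<lambda>x. (cond_ext n I g x)\<^sup>2) x0)"
    by (simp add: W_def level_weight_def)
  also have "\<dots> \<le> W * N2"
    unfolding N2_def using W0 AV_cond_ext_square by (intro mult_left_mono sum_mono) auto
  finally have *: "p\<^sup>2 * N2 * N2 \<le> W * N2" by (simp add: power_mult_distrib power2_eq_square mult_ac)
  have "p\<^sup>2 * N2 \<le> W"
  proof (cases "N2 = 0")
    case False
    then show ?thesis using * N20 by simp
  qed (use W0 in simp)
  moreover have "exp (- 4 * real d) \<le> p\<^sup>2"
  proof -
    have "exp (- 2 * real d) ^ 2 \<le> p\<^sup>2" using p by (intro power_mono) auto
    then show ?thesis by (simp add: exp_double[symmetric])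
  qed
  ultimately have "exp (- 4 * real d) * N2 \<le> W" using N20 by (meson mult_right_mono order_trans)
  then have "exp (4 * real d) * (exp (- 4 * real d) * N2) \<le> exp (4 * real d) * W" by (intro mult_left_mono) auto
  then have "N2 \<le> exp (4 * real d) * W" by (simp add: mult.assoc[symmetric] exp_add[symmetric])
  moreover have "ip n g g \<le> N2" unfolding N2_def using dn by (intro pure_norm_le g) simp
  ultimately show ?thesis by (simp add: W_def)
qed

end

text \<open>The common core of both statements. Its inequalities are weak because under
  \<open>r_biglobal\<close> only \<open>r \<ge> 1\<close> can be derived, and the two norms of
  \<open>f\<close> may coincide.\<close>

lemma level_inequality:
  assumes n: "n > 0" and r: "r \<ge> 1" and \<gamma>: "\<gamma>2 \<ge> \<gamma>1" "\<gamma>1 > 0"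
    and d: "4 * real d \<le> ln (\<gamma>2 / \<gamma>1)" "2 * d \<le> n" and glob: "biglobal n r \<gamma>1 \<gamma>2 d f"
  shows "ip n (deg_part n d f) (deg_part n d f) \<le> \<gamma>1\<^sup>2 * (10 ^ 6 * r\<^sup>2 * ln (\<gamma>2 / \<gamma>1) / d) ^ d"
proof -
  interpret sym_coupling n by unfold_locales (rule n)
  define L where "L = ln (\<gamma>2 / \<gamma>1)"
  let ?g = "deg_part n d f"
  have L0: "L \<ge> 0" using \<gamma> by (simp add: L_def)
  have \<gamma>2: "\<gamma>2 = \<gamma>1 * exp L" using \<gamma> by (simp add: L_def)
  have pb: "product_biglobal {1..n} r \<gamma>1 \<gamma>2 d (lift n f)"
    by (rule lift_product_biglobal[OF glob r]) (use \<gamma> in simp_all)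
  have "finite {1..n}" "4 * real d \<le> L" using d by (simp_all add: L_def)
  then have W: "level_weight {1..n} d (lift n f) id \<le> \<gamma>1\<^sup>2 * (10 ^ 4 * r\<^sup>2 * L / d) ^ d"
    by (rule product_level_inequality[OF _ r \<gamma>(2) \<gamma>2 _ pb])
  have "ip n ?g ?g \<le> exp (4 * real d) * level_weight {1..n} d (lift n f) id"
    by (rule level_norm_le_product_weight[OF pure_deg_part _ d(2)]) (rule ip_deg_part[symmetric])
  also have "\<dots> \<le> 100 ^ d * (\<gamma>1\<^sup>2 * (10 ^ 4 * r\<^sup>2 * L / d) ^ d)"
  proof (rule mult_mono)
    have "exp (4::real) = exp 2 * exp 2" by (simp add: exp_add[symmetric])
    also have "\<dots> \<le> 8 * 8" using exp_two_le by (intro mult_mono) auto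
    finally have "exp (4::real) ^ d \<le> 100 ^ d" by (intro power_mono) auto
    then show "exp (4 * real d) \<le> 100 ^ d" by (simp add: exp_of_nat_mult[symmetric] mult.commute)
  qed (use W in \<open>auto simp: level_weight_def intro!: sum_nonneg AV_nonneg\<close>)
  also have "\<dots> = \<gamma>1\<^sup>2 * (100 * (10 ^ 4 * r\<^sup>2 * L / d)) ^ d"
    unfolding power_mult_distrib[of 100] by (rule mult.left_commute)
  also have "100 * (10 ^ 4 * r\<^sup>2 * L / d) = 10 ^ 6 * r\<^sup>2 * L / d" by simp
  finally show ?thesis by (simp add: L_def)
qed

section \<open>Norms and the deduction of the two statements\<close>

lemma Lp_norm_2: "(Lp_norm (Sym n) 2 g)\<^sup>2 = ip n g g"
proof -
  have "E_unif (Sym n) (\<lambda>\<sigma>. \<bar>g \<sigma>\<bar> powr 2) = ip n g g"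
    by (simp add: E_unif_sum ip_eq power2_eq_square)
  then show ?thesis using ip_ge_0[of n g] by (simp add: Lp_norm_def powr_half_sqrt)
qed

lemma Lp_norm_1:
  assumes "finite U" "U \<noteq> {}"
  shows "Lp_norm U 1 g = (\<Sum>\<sigma>\<in>U. \<bar>g \<sigma>\<bar>) / card U"
  using assms by (simp add: Lp_norm_def E_unif_sum sum_nonneg)

lemma Lp_norm_nonneg: "Lp_norm U p g \<ge> 0" by (simp add: Lp_norm_def)

lemma Lp_norm_1_le_2: "Lp_norm (Sym n) 1 f \<le> Lp_norm (Sym n) 2 f"
proof (rule power2_le_imp_le)
  let ?c = "real (card (Sym n))"
  have c: "?c > 0" by (simp add: card_Sym)
  have "(\<Sum>\<sigma>\<in>Sym n. \<bar>f \<sigma>\<bar> * 1)\<^sup>2 \<le> (\<Sum>\<sigma>\<in>Sym n. \<bar>f \<sigma>\<bar>\<^sup>2) * (\<Sum>\<sigma>\<in>Sym n. 1\<^sup>2)"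
    by (rule Cauchy_Schwarz_ineq_sum)
  then have "(\<Sum>\<sigma>\<in>Sym n. \<bar>f \<sigma>\<bar>)\<^sup>2 / ?c\<^sup>2 \<le> (\<Sum>\<sigma>\<in>Sym n. (f \<sigma>)\<^sup>2) * ?c / ?c\<^sup>2"
    by (intro divide_right_mono) auto
  then show "(Lp_norm (Sym n) 1 f)\<^sup>2 \<le> (Lp_norm (Sym n) 2 f)\<^sup>2"
    unfolding Lp_norm_2 using c by (simp add: Lp_norm_1 ip_eq power_divide power2_eq_square)
qed (rule Lp_norm_nonneg)

text \<open>Restrictions of size \<open>n\<close> are single points, so each
  \<open>\<bar>f \<sigma>\<bar>\<close> is at most \<open>r ^ n\<close> times the 1-norm; averaging
  gives \<open>1 \<le> r ^ n\<close>. Restrictions of size 1 first exclude negative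
  \<open>r\<close>.\<close>

lemma r_biglobal_ge_1:
  assumes n: "n > 0" and f: "Lp_norm (Sym n) 1 f > 0" and glob: "r_biglobal n r f"
  shows "r \<ge> 1"
proof (rule ccontr)
  assume r1: "\<not> r \<ge> 1"
  let ?a = "Lp_norm (Sym n) 1 f"
  have B: "Lp_norm (umvirate n I J) 1 f \<le> r ^ t * ?a" if "t \<le> n" "I \<in> tuples n t" "J \<in> tuples n t" for t I J
    using glob that by (auto simp: r_biglobal_def biglobal_def)
  have "[1] \<in> tuples n 1" using n by (simp add: tuples_def)
  then have "0 \<le> r ^ 1 * ?a" using B[of 1 "[1]" "[1]"] n Lp_norm_nonneg[of "umvirate n [1] [1]" 1 f] by simp
  then have r0: "r \<ge> 0" using f by (simp add: zero_le_mult_iff)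
  have "\<bar>f \<sigma>\<bar> \<le> r ^ n * ?a" if s: "\<sigma> \<in> Sym n" for \<sigma>
  proof -
    let ?I = "[1..<Suc n]" let ?J = "map \<sigma> ?I"
    have I: "?I \<in> tuples n n" by (auto simp: tuples_def)
    have "inj_on \<sigma> (set ?I)" using s by (intro permutes_inj_on) (simp add: Sym_iff)
    moreover have "set ?J \<subseteq> {1..n}" using Sym_in[OF s] by auto
    ultimately have J: "?J \<in> tuples n n" by (simp add: tuples_def distinct_map del: upt_Suc)
    have "umvirate n ?I ?J = {\<sigma>}"
    proof (intro equalityI subsetI)
      fix \<tau> assume t: "\<tau> \<in> umvirate n ?I ?J"
      then have S: "\<tau> \<in> Sym n" by (simp add: umvirate_def)
      have "\<tau> i = \<sigma> i" for i
      proof (cases "i \<in> {1..n}")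
        case True
        then have "?I ! (i - 1) = i" "i - 1 < length ?I" by (auto simp del: upt_Suc)
        moreover have "\<forall>k<length ?I. \<tau> (?I ! k) = ?J ! k" using t by (simp add: umvirate_def)
        ultimately show ?thesis by (metis nth_map)
      next
        case False
        then show ?thesis using s S by (simp add: Sym_iff permutes_not_in)
      qed
      then show "\<tau> \<in> {\<sigma>}" by auto
    qed (use s in \<open>auto simp: umvirate_def\<close>)
    then have "Lp_norm (umvirate n ?I ?J) 1 f = \<bar>f \<sigma>\<bar>" by (simp add: Lp_norm_1)
    then show ?thesis using B[OF _ I J] by simp
  qed
  then have "(\<Sum>\<sigma>\<in>Sym n. \<bar>f \<sigma>\<bar>) \<le> card (Sym n) * (r ^ n * ?a)" by (rule sum_bounded_above)
  then have "?a \<le> r ^ n * ?a" by (simp add: Lp_norm_1 card_Sym field_simps)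
  then have "1 \<le> r ^ n" using f by simp
  moreover have "r ^ n < 1" using r0 r1 n by (simp add: power_less_one_iff)
  ultimately show False by simp
qed

theorem theorem4p1:
  "(\<forall>(n::nat) (d::nat) (f :: (nat \<Rightarrow> nat) \<Rightarrow> real) (r::real) (\<gamma>1::real) (\<gamma>2::real).
      n > 0 \<longrightarrow> r > 1 \<longrightarrow> \<gamma>2 > \<gamma>1 \<longrightarrow> \<gamma>1 > 0 \<longrightarrow>
      real d \<le> min (1 / 4 * ln (\<gamma>2 / \<gamma>1)) (real n / 10 ^ 5) \<longrightarrow>
      biglobal n r \<gamma>1 \<gamma>2 d f \<longrightarrow>
      (Lp_norm (Sym n) 2 (deg_part n d f))\<^sup>2
        \<le> \<gamma>1\<^sup>2 * (if d = 0 then 1 else (10 ^ 6 * r\<^sup>2 * (1 / real d) * ln (\<gamma>2 / \<gamma>1)) ^ d)) \<and>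
   (\<exists>C::real. C > 0 \<and>
      (\<forall>(n::nat) (f :: (nat \<Rightarrow> nat) \<Rightarrow> real) (r::real).
        n > 0 \<longrightarrow> (\<exists>\<sigma> \<in> Sym n. f \<sigma> \<noteq> 0) \<longrightarrow> r_biglobal n r f \<longrightarrow>
        ln (Lp_norm (Sym n) 2 f / Lp_norm (Sym n) 1 f) < real n / 10 ^ 6 \<longrightarrow>
        (\<forall>d::nat. (Lp_norm (Sym n) 2 (deg_part n d f))\<^sup>2
           \<le> (Lp_norm (Sym n) 1 f)\<^sup>2 *
              (C * r\<^sup>2 * ln (exp 1 * Lp_norm (Sym n) 2 f / Lp_norm (Sym n) 1 f)) ^ d)))"
proof (intro conjI allI impI exI[of _ "10 ^ 6 :: real"])
  fix n d :: nat and f :: "(nat \<Rightarrow> nat) \<Rightarrow> real" and r \<gamma>1 \<gamma>2 :: real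
  assume n: "n > 0" and r: "r > 1" and \<gamma>: "\<gamma>2 > \<gamma>1" "\<gamma>1 > 0"
    and d: "real d \<le> min (1 / 4 * ln (\<gamma>2 / \<gamma>1)) (real n / 10 ^ 5)" and glob: "biglobal n r \<gamma>1 \<gamma>2 d f"
  have "ip n (deg_part n d f) (deg_part n d f) \<le> \<gamma>1\<^sup>2 * (10 ^ 6 * r\<^sup>2 * ln (\<gamma>2 / \<gamma>1) / d) ^ d"
    using n r \<gamma> d glob by (intro level_inequality) auto
  then show "(Lp_norm (Sym n) 2 (deg_part n d f))\<^sup>2
        \<le> \<gamma>1\<^sup>2 * (if d = 0 then 1 else (10 ^ 6 * r\<^sup>2 * (1 / real d) * ln (\<gamma>2 / \<gamma>1)) ^ d)"
    by (cases "d = 0") (simp_all add: Lp_norm_2)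
next
  show "(10 ^ 6 :: real) > 0" by simp
next
  fix n :: nat and f :: "(nat \<Rightarrow> nat) \<Rightarrow> real" and r :: real and d :: nat
  define a where "a = Lp_norm (Sym n) 1 f"
  define b where "b = Lp_norm (Sym n) 2 f"
  define L where "L = ln (b / a)"
  assume n: "n > 0" and f: "\<exists>\<sigma>\<in>Sym n. f \<sigma> \<noteq> 0" and glob: "r_biglobal n r f"
    and "ln (Lp_norm (Sym n) 2 f / Lp_norm (Sym n) 1 f) < real n / 10 ^ 6"
  then have L: "L < real n / 10 ^ 6" by (simp add: L_def a_def b_def)
  have a: "a > 0"
  proof -
    obtain \<sigma> where "\<sigma> \<in> Sym n" "f \<sigma> \<noteq> 0" using f by auto
    then have "(\<Sum>\<sigma>\<in>Sym n. \<bar>f \<sigma>\<bar>) > 0" by (intro sum_pos2[of _ \<sigma>]) auto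
    then show ?thesis by (simp add: a_def Lp_norm_1 card_Sym)
  qed
  have ab: "a \<le> b" unfolding a_def b_def by (rule Lp_norm_1_le_2)
  have r: "r \<ge> 1" using r_biglobal_ge_1[OF n _ glob] a by (simp add: a_def)
  have L0: "L \<ge> 0" using a ab by (simp add: L_def)
  have eL: "ln (exp 1 * b / a) = 1 + L" using a ab by (simp add: L_def ln_mult ln_div)
  have "ip n (deg_part n d f) (deg_part n d f) \<le> a\<^sup>2 * (10 ^ 6 * r\<^sup>2 * (1 + L)) ^ d"
  \<comment> \<open>Within this range the level inequality applies. Beyond it
    \<open>L < 4 * d\<close>, and the norm of \<open>f\<close> itself suffices:
    \<open>exp (2 * L) \<le> exp (8 * d)\<close>, which is at most
    \<open>8 ^ (4 * d) = 4096 ^ d\<close>.\<close>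
  proof (cases "4 * real d \<le> L")
    case True
    have "4 * real d < real n / 1000000" using True L by simp
    then have dn: "2 * d \<le> n" by linarith
    have "biglobal n r a b d f"
      using glob dn unfolding r_biglobal_def biglobal_def a_def b_def by auto
    then have "ip n (deg_part n d f) (deg_part n d f) \<le> a\<^sup>2 * (10 ^ 6 * r\<^sup>2 * L / d) ^ d"
      using level_inequality[of n r a b d f] n r a ab True dn by (simp add: L_def)
    also have "\<dots> \<le> a\<^sup>2 * (10 ^ 6 * r\<^sup>2 * (1 + L)) ^ d"
    proof (cases "d = 0")
      case False
      have "L / d \<le> L / 1" using False L0 by (intro divide_left_mono) auto
      then have "10 ^ 6 * r\<^sup>2 * (L / d) \<le> 10 ^ 6 * r\<^sup>2 * (1 + L)" by (intro mult_left_mono) auto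
      then show ?thesis using L0 by (intro mult_left_mono power_mono) auto
    qed simp
    finally show ?thesis .
  next
    case False
    have "ip n (deg_part n d f) (deg_part n d f) \<le> ip n f f" by (rule deg_part_norm_le)
    also have "\<dots> = b\<^sup>2" by (simp add: b_def Lp_norm_2)
    also have "b = a * exp L" using a ab by (simp add: L_def)
    also have "(a * exp L)\<^sup>2 = a\<^sup>2 * exp (2 * L)" by (simp add: power_mult_distrib exp_double)
    also have "\<dots> \<le> a\<^sup>2 * (10 ^ 6 * r\<^sup>2 * (1 + L)) ^ d"
    proof (rule mult_left_mono)
      have "exp (2 * L) \<le> exp (real (4 * d) * 2)" using False by simp
      also have "\<dots> = exp 2 ^ (4 * d)" by (simp only: exp_of_nat_mult)
      also have "\<dots> \<le> 8 ^ (4 * d)" using exp_two_le by (intro power_mono) auto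
      also have "\<dots> = 4096 ^ d" by (simp add: power_mult)
      also have "\<dots> \<le> (10 ^ 6 * r\<^sup>2 * (1 + L)) ^ d"
      proof (rule power_mono)
        have "(10::real) ^ 6 * 1 * 1 \<le> 10 ^ 6 * r\<^sup>2 * (1 + L)" using r L0 by (intro mult_mono) auto
        moreover have "(4096::real) \<le> 10 ^ 6 * 1 * 1" by simp
        ultimately show "4096 \<le> 10 ^ 6 * r\<^sup>2 * (1 + L)" by (rule order_trans[rotated])
      qed simp
      finally show "exp (2 * L) \<le> (10 ^ 6 * r\<^sup>2 * (1 + L)) ^ d" .
    qed simp
    finally show ?thesis .
  qed
  then show "(Lp_norm (Sym n) 2 (deg_part n d f))\<^sup>2 \<le> (Lp_norm (Sym n) 1 f)\<^sup>2 *
              (10 ^ 6 * r\<^sup>2 * ln (exp 1 * Lp_norm (Sym n) 2 f / Lp_norm (Sym n) 1 f)) ^ d"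
    unfolding Lp_norm_2[of n "deg_part n d f"] eL[unfolded a_def b_def] a_def .
qed

end
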